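(* Let $X$ be a non-monotone L\'evy process and let $\tau$ be an independent phase-type random time with representation $(\boldsymbol\alpha,\boldsymbol T)$ on the phases $\{1,\dots,n\}$, with underlying phase process $J$ and $\boldsymbol\alpha\in\mathcal I(\boldsymbol T)$. Let $\widehat{\boldsymbol\alpha}\in\mathcal I(\boldsymbol T)$, and let $\mathbb P^*$ and $\widehat{\mathbb P}^*$ be the laws associated with the time-reversed representations derived from $(\boldsymbol\alpha,\boldsymbol T)$ and $(\widehat{\boldsymbol\alpha},\boldsymbol T)$, respectively (all notation as defined in the context). Then for every phase $k\in\{1,\dots,n\}$, $$\mathbb P\bigl(\overline X_\tau\in \mathrm dx,\ X_\tau-\overline X_\tau\in \mathrm dy\,\big|\,J_{\overline\sigma_\tau}=k\bigr)=\mathbb P\bigl(\overline X_\tau\in \mathrm dx\,\big|\,J_{\overline\sigma_\tau}=k\bigr)\,\widehat{\mathbb P}^*\bigl(\underline X_\tau\in \mathrm dy\,\big|\,J_{\underline\sigma_\tau}=k\bigr)$$ as measures in $(x,y)\in[0,\infty)\times(-\infty,0]$. Equivalently, for every phase $k$, $$\mathbb P^*\bigl(\underline X_\tau\in \mathrm dy\,\big|\,J_{\underline\sigma_\tau}=k\bigr)=\widehat{\mathbb P}^*\bigl(\underline X_\tau\in \mathrm dy\,\big|\,J_{\underline\sigma_\tau}=k\bigr).$$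
   Context: Running extrema. For a L\'evy process $X_t$, $t\ge 0$ (with $X_0=0$ and the convention $X_{0-}=0$), put $\overline X_t=\sup_{s\le t}X_s$, $\overline\sigma_t=\inf\{s\in[0,t]: X_s\vee X_{s-}=\overline X_t\}$, $\underline X_t=\inf_{s\le t}X_s$, $\underline\sigma_t=\sup\{s\in[0,t]: X_s\wedge X_{s-}=\underline X_t\}$. Phase-type time. $\tau$ has a phase-type distribution with representation $(\boldsymbol\alpha,\boldsymbol T)$ if $\tau=\inf\{t\ge 0: J_t=\dagger\}$ is the lifetime of a terminating time-homogeneous Markov jump process $J$ on the finite set of phases $\{1,\dots,n\}$ with initial distribution $\boldsymbol\alpha$ (a probability row vector) and sub-generator $\boldsymbol T$, where $\dagger$ is an additional absorbing state. The column vector of exit rates is $\boldsymbol t=-\boldsymbol T\boldsymbol 1$, with $\boldsymbol 1$ the column vector of ones. $\mathcal I(\boldsymbol T)$ denotes the set of all probability row vectors $\widehat{\boldsymbol\alpha}$ on the phases such that $\boldsymbol T+\boldsymbol t\widehat{\boldsymbol\alpha}$ is irreducible. Then $\boldsymbol T$ is invertible. Time reversal. For $\boldsymbol\beta\in\mathcal I(\boldsymbol T)$ let $\boldsymbol\nu=-\boldsymbol\beta\boldsymbol T^{-1}$ (positive entries) and let $\boldsymbol\Delta_{\boldsymbol\nu}$ be the diagonal matrix with $\boldsymbol\nu$ on the diagonal. The time-reversed representation derived from $(\boldsymbol\beta,\boldsymbol T)$ has initial distribution $\boldsymbol t^{\top}\boldsymbol\Delta_{\boldsymbol\nu}$ and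 generator $\boldsymbol\Delta_{\boldsymbol\nu}^{-1}\boldsymbol T^{\top}\boldsymbol\Delta_{\boldsymbol\nu}$. It is denoted $(\boldsymbol\alpha^*,\boldsymbol T^* )$ for $\boldsymbol\beta=\boldsymbol\alpha$ and $(\widehat{\boldsymbol\alpha}^*,\widehat{\boldsymbol T}^* )$ for $\boldsymbol\beta=\widehat{\boldsymbol\alpha}$. Laws. Under each of $\mathbb P$, $\mathbb P^*$, $\widehat{\mathbb P}^*$ the processes $X$ and $J$ are independent, $X$ has the law of the given L\'evy process, and $\tau$ is the lifetime of $J$; the phase process $J$ is Markov with (initial distribution, generator) equal to $(\boldsymbol\alpha,\boldsymbol T)$ under $\mathbb P$, $(\boldsymbol\alpha^*,\boldsymbol T^* )$ under $\mathbb P^*$, and $(\widehat{\boldsymbol\alpha}^*,\widehat{\boldsymbol T}^* )$ under $\widehat{\mathbb P}^*$. All the conditioning events above have positive probability. Convention. On the event that the extremum is attained at the terminal time, i.e. $\overline\sigma_\tau=\tau$ (respectively $\underline\sigma_\tau=\tau$), the symbol $J_{\overline\sigma_\tau}$ (respectively $J_{\underline\sigma_\tau}$) is understood as the last phase $J_{\tau-}$. *)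

theory Defs
  imports "HOL-Probability.Probability"
begin

section \<open>Levy processes\<close>

text \<open>Processes are indexed by \<^typ>\<open>real\<close>; only the times \<open>t \<ge> 0\<close> are meaningful,
  and no definition below looks at negative times.\<close>

definition cadlag :: "(real \<Rightarrow> real) \<Rightarrow> bool" where
  "cadlag x \<longleftrightarrow> (\<forall>t\<ge>0. continuous (at_right t) x) \<and> (\<forall>t>0. \<exists>l. (x \<longlongrightarrow> l) (at_left t))"

definition levy_process :: "'w measure \<Rightarrow> (real \<Rightarrow> 'w \<Rightarrow> real) \<Rightarrow> bool" where
  "levy_process M X \<longleftrightarrow>
     prob_space M \<and>
     (\<forall>t\<ge>0. X t \<in> borel_measurable M) \<and>
     (\<forall>\<omega>\<in>space M. X 0 \<omega> = 0 \<and> cadlag (\<lambda>t. X t \<omega>)) \<and>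
     (\<forall>m (s :: nat \<Rightarrow> real). 0 \<le> s 0 \<longrightarrow> (\<forall>i<m. s i < s (Suc i)) \<longrightarrow>
        prob_space.indep_vars M (\<lambda>_. borel) (\<lambda>i \<omega>. X (s (Suc i)) \<omega> - X (s i) \<omega>) {..<m}) \<and>
     (\<forall>s\<ge>0. \<forall>h\<ge>0. distr M borel (\<lambda>\<omega>. X (s + h) \<omega> - X s \<omega>) = distr M borel (X h))"

definition non_monotone :: "'w measure \<Rightarrow> (real \<Rightarrow> 'w \<Rightarrow> real) \<Rightarrow> bool" where
  "non_monotone M X \<longleftrightarrow>
     \<not> (AE \<omega> in M. mono_on {0..} (\<lambda>t. X t \<omega>)) \<and>
     \<not> (AE \<omega> in M. antimono_on {0..} (\<lambda>t. X t \<omega>))"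

definition path_map :: "(real \<Rightarrow> 'w \<Rightarrow> 's) \<Rightarrow> 'w \<Rightarrow> real \<Rightarrow> 's" where
  "path_map Y \<omega> = (\<lambda>t\<in>{0..}. Y t \<omega>)"

definition process_law :: "'w measure \<Rightarrow> 's measure \<Rightarrow> (real \<Rightarrow> 'w \<Rightarrow> 's) \<Rightarrow> (real \<Rightarrow> 's) measure"
  where "process_law M S Y = distr M (Pi\<^sub>M {0..} (\<lambda>_. S)) (path_map Y)"


section \<open>Running extrema\<close>

text \<open>The left limit \<open>X\<^sub>t\<^sub>-\<close>, with \<open>X\<^sub>0\<^sub>- = 0\<close>.\<close>

definition left_value :: "(real \<Rightarrow> 'w \<Rightarrow> real) \<Rightarrow> real \<Rightarrow> 'w \<Rightarrow> real" where
  "left_value X t \<omega> = (if t \<le> 0 then 0 else Lim (at_left t) (\<lambda>s. X s \<omega>))"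

definition run_sup :: "(real \<Rightarrow> 'w \<Rightarrow> real) \<Rightarrow> real \<Rightarrow> 'w \<Rightarrow> real" where
  "run_sup X t \<omega> = (SUP s\<in>{0..t}. X s \<omega>)"

definition run_inf :: "(real \<Rightarrow> 'w \<Rightarrow> real) \<Rightarrow> real \<Rightarrow> 'w \<Rightarrow> real" where
  "run_inf X t \<omega> = (INF s\<in>{0..t}. X s \<omega>)"

definition sup_time :: "(real \<Rightarrow> 'w \<Rightarrow> real) \<Rightarrow> real \<Rightarrow> 'w \<Rightarrow> real" where
  "sup_time X t \<omega> = Inf {s\<in>{0..t}. max (X s \<omega>) (left_value X s \<omega>) = run_sup X t \<omega>}"

definition inf_time :: "(real \<Rightarrow> 'w \<Rightarrow> real) \<Rightarrow> real \<Rightarrow> 'w \<Rightarrow> real" where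
  "inf_time X t \<omega> = Sup {s\<in>{0..t}. min (X s \<omega>) (left_value X s \<omega>) = run_inf X t \<omega>}"


section \<open>Finite Markov jump processes\<close>

definition matrix_exp :: "real^'s^'s \<Rightarrow> real^'s^'s" where
  "matrix_exp A = (\<Sum>m. (1 / fact m) *\<^sub>R ((\<lambda>B. A ** B) ^^ m) (mat 1))"

text \<open>Right-continuous piecewise constant paths with finitely many jumps in bounded intervals.\<close>

definition jump_path :: "(real \<Rightarrow> 's) \<Rightarrow> bool" where
  "jump_path j \<longleftrightarrow>
     (\<forall>t\<ge>0. eventually (\<lambda>s. j s = j t) (at_right t)) \<and>
     (\<forall>t>0. \<exists>i. eventually (\<lambda>s. j s = i) (at_left t))"

text \<open>Initial distribution \<open>a\<close> and generator \<open>Q\<close>; the transition matrix over a time \<open>h\<close> is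
  \<open>matrix_exp (h *\<^sub>R Q)\<close>. The last conjunct is the time-homogeneous Markov property, multiplied
  out by the probability of the conditioning event.\<close>

definition markov_jump_process ::
  "'w measure \<Rightarrow> (real \<Rightarrow> 'w \<Rightarrow> 's::finite) \<Rightarrow> real^'s \<Rightarrow> real^'s^'s \<Rightarrow> bool" where
  "markov_jump_process M J a Q \<longleftrightarrow>
     prob_space M \<and>
     (\<forall>t\<ge>0. J t \<in> measurable M (count_space UNIV)) \<and>
     (\<forall>\<omega>\<in>space M. jump_path (\<lambda>t. J t \<omega>)) \<and>
     (\<forall>i. \<P>(\<omega> in M. J 0 \<omega> = i) = a $ i) \<and>
     (\<forall>m (s :: nat \<Rightarrow> real) x. 0 \<le> s 0 \<longrightarrow> (\<forall>l\<le>m. s l < s (Suc l)) \<longrightarrow>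
        \<P>(\<omega> in M. \<forall>l\<le>Suc m. J (s l) \<omega> = x l) =
        \<P>(\<omega> in M. \<forall>l\<le>m. J (s l) \<omega> = x l) *
          matrix_exp ((s (Suc m) - s m) *\<^sub>R Q) $ x m $ x (Suc m))"


section \<open>Phase-type times\<close>

definition prob_vector :: "real^'n \<Rightarrow> bool" where
  "prob_vector a \<longleftrightarrow> (\<forall>i. 0 \<le> a $ i) \<and> (\<Sum>i\<in>UNIV. a $ i) = 1"

definition subgenerator :: "real^'n^'n \<Rightarrow> bool" where
  "subgenerator T \<longleftrightarrow> (\<forall>i j. i \<noteq> j \<longrightarrow> 0 \<le> T $ i $ j) \<and> (\<forall>i. (\<Sum>j\<in>UNIV. T $ i $ j) \<le> 0)"

definition exit_rates :: "real^'n^'n \<Rightarrow> real^'n" where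
  "exit_rates T = - (T *v 1)"

text \<open>The absorbing state is \<^term>\<open>None\<close>; the phase \<open>i\<close> is \<^term>\<open>Some i\<close>.\<close>

definition extend_initial :: "real^'n \<Rightarrow> real^('n option)" where
  "extend_initial a = (\<chi> i. case i of Some p \<Rightarrow> a $ p | None \<Rightarrow> 0)"

definition extend_generator :: "real^'n^'n \<Rightarrow> real^('n option)^('n option)" where
  "extend_generator T = (\<chi> i j. case i of
      None \<Rightarrow> 0
    | Some p \<Rightarrow> (case j of Some q \<Rightarrow> T $ p $ q | None \<Rightarrow> exit_rates T $ p))"

text \<open>The almost sure absorption in the second conjunct says that the process is terminating.\<close>

definition phase_process ::
  "'w measure \<Rightarrow> (real \<Rightarrow> 'w \<Rightarrow> 'n::finite option) \<Rightarrow> real^'n \<Rightarrow> real^'n^'n \<Rightarrow> bool" where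
  "phase_process M J a T \<longleftrightarrow>
     markov_jump_process M J (extend_initial a) (extend_generator T) \<and>
     (AE \<omega> in M. \<exists>t\<ge>0. J t \<omega> = None)"

text \<open>The value 0 is a convention on the null event of no absorption.\<close>

definition lifetime :: "(real \<Rightarrow> 'w \<Rightarrow> 'n option) \<Rightarrow> 'w \<Rightarrow> real" where
  "lifetime J \<omega> = (if \<exists>t\<ge>0. J t \<omega> = None then Inf {t. 0 \<le> t \<and> J t \<omega> = None} else 0)"

text \<open>The left limit \<open>J\<^sub>t\<^sub>-\<close>. Its value for \<open>t \<le> 0\<close> is irrelevant: a lifetime 0 has
  probability 0, as the initial distribution lives on the phases.\<close>

definition left_phase :: "(real \<Rightarrow> 'w \<Rightarrow> 'n option) \<Rightarrow> real \<Rightarrow> 'w \<Rightarrow> 'n option" where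
  "left_phase J t \<omega> =
     (if t \<le> 0 then J 0 \<omega> else (THE i. eventually (\<lambda>s. J s \<omega> = i) (at_left t)))"

definition phase_at :: "(real \<Rightarrow> 'w \<Rightarrow> 'n option) \<Rightarrow> real \<Rightarrow> 'w \<Rightarrow> 'n option" where
  "phase_at J s \<omega> = (if s = lifetime J \<omega> then left_phase J s \<omega> else J s \<omega>)"

definition phase_at_sup ::
  "(real \<Rightarrow> 'w \<Rightarrow> real) \<Rightarrow> (real \<Rightarrow> 'w \<Rightarrow> 'n option) \<Rightarrow> 'w \<Rightarrow> 'n option" where
  "phase_at_sup X J \<omega> = phase_at J (sup_time X (lifetime J \<omega>) \<omega>) \<omega>"

definition phase_at_inf ::
  "(real \<Rightarrow> 'w \<Rightarrow> real) \<Rightarrow> (real \<Rightarrow> 'w \<Rightarrow> 'n option) \<Rightarrow> 'w \<Rightarrow> 'n option" where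
  "phase_at_inf X J \<omega> = phase_at J (inf_time X (lifetime J \<omega>) \<omega>) \<omega>"

definition levy_with_phases ::
  "'w measure \<Rightarrow> (real \<Rightarrow> 'w \<Rightarrow> real) \<Rightarrow> (real \<Rightarrow> 'w \<Rightarrow> 'n::finite option) \<Rightarrow>
   real^'n \<Rightarrow> real^'n^'n \<Rightarrow> bool" where
  "levy_with_phases M X J a T \<longleftrightarrow>
     levy_process M X \<and> phase_process M J a T \<and>
     prob_space.indep_set M
       (sets (vimage_algebra (space M) (path_map X) (Pi\<^sub>M {0..} (\<lambda>_. borel))))
       (sets (vimage_algebra (space M) (path_map J) (Pi\<^sub>M {0..} (\<lambda>_. count_space UNIV))))"


section \<open>Restart distributions and time reversal\<close>

text \<open>Strong connectivity of the graph of nonzero entries. Diagonal entries play no role, so a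
  \<open>1 \<times> 1\<close> matrix is irreducible, as is usual for generators.\<close>

definition irreducible_matrix :: "real^'n^'n \<Rightarrow> bool" where
  "irreducible_matrix A \<longleftrightarrow> (\<forall>i j. (i, j) \<in> {(p, q). A $ p $ q \<noteq> 0}\<^sup>*)"

definition restart_vectors :: "real^'n^'n \<Rightarrow> (real^'n) set" where
  "restart_vectors T =
     {b. prob_vector b \<and> irreducible_matrix (T + (\<chi> i j. exit_rates T $ i * b $ j))}"

definition diag_matrix :: "real^'n \<Rightarrow> real^'n^'n" where
  "diag_matrix v = (\<chi> i j. if i = j then v $ i else 0)"

definition occupation :: "real^'n \<Rightarrow> real^'n^'n \<Rightarrow> real^'n" where
  "occupation b T = - (b v* matrix_inv T)"

definition reversed_initial :: "real^'n \<Rightarrow> real^'n^'n \<Rightarrow> real^'n" where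
  "reversed_initial b T = exit_rates T v* diag_matrix (occupation b T)"

definition reversed_generator :: "real^'n \<Rightarrow> real^'n^'n \<Rightarrow> real^'n^'n" where
  "reversed_generator b T =
     matrix_inv (diag_matrix (occupation b T)) ** transpose T ** diag_matrix (occupation b T)"


section \<open>Conditional laws\<close>

text \<open>The law on \<open>N\<close> of \<open>Y\<close> under \<open>M\<close>, conditioned on an event of positive probability.\<close>

definition cond_law :: "'w measure \<Rightarrow> 'v measure \<Rightarrow> ('w \<Rightarrow> 'v) \<Rightarrow> ('w \<Rightarrow> bool) \<Rightarrow> 'v measure" where
  "cond_law M N Y E = distr (uniform_measure M {\<omega>\<in>space M. E \<omega>}) N Y"

end

theory Submission
  imports Defs
begin

text \<open>
  The killed process is sampled on a grid of mesh \<open>h\<close>, after subtracting the small linear tilt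
  \<open>e * t\<close>, which selects the correct extremal point of the limit. For the sampled walk, the event that
  the extremum sits at the \<open>m\<close>-th grid point in phase \<open>k\<close> factorises: the steps before and after \<open>m\<close> are
  independent, and so are the phases before and after \<open>m\<close> given the phase \<open>k\<close> at \<open>m\<close>. Summed over all
  grid points this is a product of a pre-extremum and a post-extremum series. Letting \<open>h\<close> and then
  \<open>e\<close> tend to 0 yields the conditional independence, although neither series need converge by itself.

  Reversing the steps after the maximum turns the maximum into a minimum, and the probability
  \<open>trans T t *v exit_rates T\<close> of leaving at time \<open>t\<close> becomes, up to the factor \<open>occupation b T\<close>, the
  probability that the reversed phase process is in state \<open>k\<close> at time \<open>t\<close>. Hence the
  post-maximum series of the original process and the pre-minimum series of every reversed process are
  proportional in the limit. The constants are cancelled by cross multiplication, since the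
  conditioning events have positive probability.
\<close>

section \<open>The matrix exponential\<close>

text \<open>The square matrices with the operator norm form a Banach algebra, so that the library's
  \<^const>\<open>exp\<close> and its derivative apply; the type \<^typ>\<open>real^'n^'n\<close> itself carries the
  componentwise product and the Euclidean norm.\<close>

typedef (overloaded) 'n sqmat = "UNIV :: (real^'n^'n) set" morphisms mat_of sqmat_of ..

setup_lifting type_definition_sqmat

instantiation sqmat :: (finite) real_normed_algebra_1
begin

lift_definition zero_sqmat :: "'a sqmat" is 0 .
lift_definition one_sqmat :: "'a sqmat" is "mat 1" .
lift_definition plus_sqmat :: "'a sqmat \<Rightarrow> 'a sqmat \<Rightarrow> 'a sqmat" is "(+)" .
lift_definition minus_sqmat :: "'a sqmat \<Rightarrow> 'a sqmat \<Rightarrow> 'a sqmat" is "(-)" .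
lift_definition uminus_sqmat :: "'a sqmat \<Rightarrow> 'a sqmat" is uminus .
lift_definition times_sqmat :: "'a sqmat \<Rightarrow> 'a sqmat \<Rightarrow> 'a sqmat" is "(**)" .
lift_definition scaleR_sqmat :: "real \<Rightarrow> 'a sqmat \<Rightarrow> 'a sqmat" is scaleR .
lift_definition norm_sqmat :: "'a sqmat \<Rightarrow> real" is "\<lambda>A. onorm ((*v) A)" .

definition dist_sqmat :: "'a sqmat \<Rightarrow> 'a sqmat \<Rightarrow> real" where
  "dist_sqmat A B = norm (A - B)"
definition sgn_sqmat :: "'a sqmat \<Rightarrow> 'a sqmat" where
  "sgn_sqmat A = inverse (norm A) *\<^sub>R A"
definition uniformity_sqmat :: "('a sqmat \<times> 'a sqmat) filter" where
  "uniformity_sqmat = (INF e\<in>{0 <..}. principal {(A, B). dist A B < e})"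
definition open_sqmat :: "'a sqmat set \<Rightarrow> bool" where
  "open_sqmat S = (\<forall>A\<in>S. \<forall>\<^sub>F (A', B) in uniformity. A' = A \<longrightarrow> B \<in> S)"

instance
proof
  fix A B C :: "'a sqmat" and r s :: real
  have bl: "bounded_linear ((*v) M)" for M :: "real^'a^'a"
    by simp
  show "A + B + C = A + (B + C)" "A + B = B + A" "0 + A = A" "- A + A = 0" "A - B = A + - B"
    by (transfer, simp)+
  show "A * B * C = A * (B * C)" "1 * A = A" "A * 1 = A"
    by (transfer, simp add: matrix_mul_assoc)+
  show "(A + B) * C = A * C + B * C" "A * (B + C) = A * B + A * C"
    by (transfer, simp add: vec_eq_iff matrix_matrix_mult_def algebra_simps sum.distrib)+
  show "(0::'a sqmat) \<noteq> 1"
    by transfer (simp add: mat_def vec_eq_iff)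
  show "r *\<^sub>R (A + B) = r *\<^sub>R A + r *\<^sub>R B" "(r + s) *\<^sub>R A = r *\<^sub>R A + s *\<^sub>R A"
    "r *\<^sub>R s *\<^sub>R A = (r * s) *\<^sub>R A" "1 *\<^sub>R A = A"
    by (transfer, simp add: scaleR_add_right scaleR_add_left)+
  show "r *\<^sub>R A * B = r *\<^sub>R (A * B)" "A * r *\<^sub>R B = r *\<^sub>R (A * B)"
    by (transfer, simp add: vec_eq_iff matrix_matrix_mult_def sum_distrib_left mult.assoc mult.left_commute)+
  show "dist A B = norm (A - B)" by (rule dist_sqmat_def)
  show "sgn A = inverse (norm A) *\<^sub>R A" by (rule sgn_sqmat_def)
  show "uniformity = (INF e\<in>{0 <..}. principal {(A, B). dist (A::'a sqmat) B < e})"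
    by (rule uniformity_sqmat_def)
  show "open S = (\<forall>A\<in>S. \<forall>\<^sub>F (A', B) in uniformity. A' = A \<longrightarrow> B \<in> S)" for S :: "'a sqmat set"
    by (rule open_sqmat_def)
  show "(norm A = 0) = (A = 0)"
    by transfer (simp add: onorm_eq_0 matrix_eq)
  show "norm (A + B) \<le> norm A + norm B"
  proof transfer
    fix A B :: "real^'a^'a"
    have "(*v) (A + B) = (\<lambda>x. A *v x + B *v x)"
      by (simp add: fun_eq_iff matrix_vector_mult_add_rdistrib)
    then show "onorm ((*v) (A + B)) \<le> onorm ((*v) A) + onorm ((*v) B)"
      using onorm_triangle[OF bl bl] by simp
  qed
  show "norm (r *\<^sub>R A) = \<bar>r\<bar> * norm A"
  proof transfer
    fix r and A :: "real^'a^'a"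
    have "(*v) (r *\<^sub>R A) = (\<lambda>x. r *\<^sub>R (A *v x))"
      by (simp add: fun_eq_iff scaleR_matrix_vector_assoc)
    then show "onorm ((*v) (r *\<^sub>R A)) = \<bar>r\<bar> * onorm ((*v) A)"
      using onorm_scaleR[OF bl] by simp
  qed
  show "norm (A * B) \<le> norm A * norm B"
  proof transfer
    fix A B :: "real^'a^'a"
    have "(*v) (A ** B) = (*v) A \<circ> (*v) B"
      by (simp add: fun_eq_iff matrix_vector_mul_assoc)
    then show "onorm ((*v) (A ** B)) \<le> onorm ((*v) A) * onorm ((*v) B)"
      using onorm_compose[OF bl bl] by simp
  qed
  show "norm (1::'a sqmat) = 1"
  proof transfer
    have "(*v) (mat 1) = (\<lambda>x :: real^'a. x)"
      by (simp add: fun_eq_iff)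
    then show "onorm ((*v) (mat 1 :: real^'a^'a)) = 1"
      using onorm_id[where 'a="real^'a"] by simp
  qed
qed

end

lemma norm_le_sum_entries: "norm A \<le> (\<Sum>i\<in>UNIV. \<Sum>j\<in>UNIV. \<bar>mat_of A $ i $ j\<bar>)"
  by transfer (rule onorm_le_matrix_component_sum)

lemma bounded_linear_entry: "bounded_linear (\<lambda>A :: 'n::finite sqmat. mat_of A $ i $ j)"
  by (rule bounded_linear_intro[where K=1])
    (transfer, simp add: matrix_component_le_onorm)+

lemma sqmat_LIMSEQ_I:
  fixes f :: "'b \<Rightarrow> 'n::finite sqmat"
  assumes "\<And>i j. ((\<lambda>x. mat_of (f x) $ i $ j) \<longlongrightarrow> mat_of B $ i $ j) F"
  shows "(f \<longlongrightarrow> B) F"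
proof -
  have "((\<lambda>x. \<Sum>i\<in>UNIV. \<Sum>j\<in>UNIV. \<bar>mat_of (f x) $ i $ j - mat_of B $ i $ j\<bar>) \<longlongrightarrow> 0) F"
    by (intro tendsto_null_sum tendsto_rabs_zero) (use assms in \<open>simp add: LIM_zero_iff\<close>)
  then have "((\<lambda>x. norm (f x - B)) \<longlongrightarrow> 0) F"
    by (rule Lim_null_comparison[rotated])
      (use norm_le_sum_entries[of "f _ - B"] in \<open>simp add: minus_sqmat.rep_eq\<close>)
  then show ?thesis
    by (rule tendsto_norm_zero_cancel[THEN LIM_zero_cancel])
qed

instance sqmat :: (finite) banach
proof
  fix X :: "nat \<Rightarrow> 'a sqmat"
  assume "Cauchy X"
  then have "Cauchy (\<lambda>n. mat_of (X n) $ i $ j)" for i j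
    by (rule bounded_linear.Cauchy[OF bounded_linear_entry])
  then have "\<forall>i j. \<exists>l. (\<lambda>n. mat_of (X n) $ i $ j) \<longlonglongrightarrow> l"
    by (simp add: Cauchy_convergent_iff convergent_def)
  then obtain l where "\<And>i j. (\<lambda>n. mat_of (X n) $ i $ j) \<longlonglongrightarrow> l i j"
    by metis
  then have "X \<longlonglongrightarrow> sqmat_of (\<chi> i j. l i j)"
    by (intro sqmat_LIMSEQ_I) (simp add: sqmat_of_inverse)
  then show "convergent X"
    by (rule convergentI)
qed

abbreviation mat_pow :: "real^'n^'n \<Rightarrow> nat \<Rightarrow> real^'n^'n" where
  "mat_pow A m \<equiv> ((\<lambda>B. A ** B) ^^ m) (mat 1)"

lemma mat_of_power: "mat_of (A ^ m) = mat_pow (mat_of A) m"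
  by (induction m) (simp_all add: times_sqmat.rep_eq one_sqmat.rep_eq)

lemma matrix_exp_eq: "matrix_exp A = mat_of (exp (sqmat_of A))"
proof -
  have "(\<lambda>m. mat_of (sqmat_of A ^ m /\<^sub>R fact m) $ i $ j) sums mat_of (exp (sqmat_of A)) $ i $ j" for i j
    using bounded_linear.sums[OF bounded_linear_entry exp_converges] .
  then have "(\<lambda>m. \<Sum>k<m. ((1 / fact k) *\<^sub>R mat_pow A k) $ i $ j)
      \<longlonglongrightarrow> mat_of (exp (sqmat_of A)) $ i $ j" for i j
    by (simp add: sums_def mat_of_power scaleR_sqmat.rep_eq sqmat_of_inverse inverse_eq_divide)
  then have "(\<lambda>k. (1 / fact k) *\<^sub>R mat_pow A k) sums mat_of (exp (sqmat_of A))"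
    unfolding sums_def by (intro vec_tendstoI) simp
  then show ?thesis
    unfolding matrix_exp_def by (simp add: sums_iff)
qed

lemma matrix_exp_entry_sums:
  "(\<lambda>m. 1 / fact m * (mat_pow A m $ i $ j)) sums (matrix_exp A $ i $ j)"
  using bounded_linear.sums[OF bounded_linear_entry exp_converges, of "sqmat_of A" i j]
  by (simp add: matrix_exp_eq mat_of_power scaleR_sqmat.rep_eq sqmat_of_inverse inverse_eq_divide)

lemma sqmat_of_simps:
  "sqmat_of (r *\<^sub>R A) = r *\<^sub>R sqmat_of A" "sqmat_of (A + B) = sqmat_of A + sqmat_of B"
  "sqmat_of (A ** B) = sqmat_of A * sqmat_of B" "sqmat_of (mat 1) = 1"
  for A B :: "real^'n::finite^'n"
  by (simp_all add: mat_of_inject[symmetric] sqmat_of_inverse scaleR_sqmat.rep_eq plus_sqmat.rep_eq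
      times_sqmat.rep_eq one_sqmat.rep_eq)

lemma matrix_exp_0 [simp]: "matrix_exp (0 *\<^sub>R A) = mat 1"
  by (simp only: matrix_exp_eq sqmat_of_simps) (simp add: one_sqmat.rep_eq)

lemma matrix_exp_add: "matrix_exp ((s + t) *\<^sub>R A) = matrix_exp (s *\<^sub>R A) ** matrix_exp (t *\<^sub>R A)"
proof -
  have "exp ((s + t) *\<^sub>R sqmat_of A) = exp (s *\<^sub>R sqmat_of A) * exp (t *\<^sub>R sqmat_of A)"
    by (subst exp_add_commuting[symmetric]) (simp_all add: scaleR_add_left)
  then show ?thesis
    by (simp add: matrix_exp_eq sqmat_of_simps times_sqmat.rep_eq)
qed

lemma matrix_exp_entry_deriv:
  "((\<lambda>t. matrix_exp (t *\<^sub>R A) $ i $ j) has_real_derivative (matrix_exp (t *\<^sub>R A) ** A) $ i $ j) (at t)"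
  using bounded_linear.has_vector_derivative[OF bounded_linear_entry[of i j]
      exp_scaleR_has_vector_derivative_right[of "sqmat_of A" t UNIV]]
  by (simp add: has_real_derivative_iff_has_vector_derivative matrix_exp_eq sqmat_of_simps
      times_sqmat.rep_eq sqmat_of_inverse)

lemma matrix_exp_commute: "matrix_exp (t *\<^sub>R A) ** A = A ** matrix_exp (t *\<^sub>R A)"
proof -
  have "mat_of (exp (t *\<^sub>R sqmat_of A) * sqmat_of A) = mat_of (sqmat_of A * exp (t *\<^sub>R sqmat_of A))"
    by (simp add: exp_times_scaleR_commute)
  then show ?thesis
    by (simp add: matrix_exp_eq sqmat_of_simps times_sqmat.rep_eq sqmat_of_inverse)
qed

lemma mat_pow_nonneg:
  assumes "\<And>i j. 0 \<le> A $ i $ j" shows "0 \<le> mat_pow A m $ i $ j"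
  using assms
  by (induction m arbitrary: i) (auto simp: mat_def matrix_matrix_mult_def intro!: sum_nonneg)

lemma matrix_exp_shift:
  "matrix_exp (t *\<^sub>R A) = exp (- (t * c)) *\<^sub>R matrix_exp (t *\<^sub>R (A + c *\<^sub>R mat 1))"
proof -
  have "t *\<^sub>R sqmat_of A = (- (t * c)) *\<^sub>R 1 + t *\<^sub>R (sqmat_of A + c *\<^sub>R 1)"
    by (simp add: algebra_simps)
  then have "exp (t *\<^sub>R sqmat_of A) = exp ((- (t * c)) *\<^sub>R 1) * exp (t *\<^sub>R (sqmat_of A + c *\<^sub>R 1))"
    by (simp only:) (rule exp_add_commuting, simp add: algebra_simps)
  also have "exp ((- (t * c)) *\<^sub>R (1::'a sqmat)) = exp (- (t * c)) *\<^sub>R 1"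
    using exp_of_real[of "- (t * c)", where 'a="'a sqmat"] by (simp add: of_real_def)
  finally show ?thesis
    by (simp add: matrix_exp_eq sqmat_of_simps scaleR_sqmat.rep_eq)
qed

lemma matrix_exp_ge:
  fixes A :: "real^'n::finite^'n"
  assumes A: "\<And>i j. i \<noteq> j \<Longrightarrow> 0 \<le> A $ i $ j" and c: "\<And>i. 0 \<le> A $ i $ i + c" and t: "0 \<le> t"
  shows "0 \<le> matrix_exp (t *\<^sub>R A) $ i $ j"
    and "exp (- (t * c)) \<le> matrix_exp (t *\<^sub>R A) $ i $ i"
    and "i \<noteq> j \<Longrightarrow> exp (- (t * c)) * t * A $ i $ j \<le> matrix_exp (t *\<^sub>R A) $ i $ j"
proof -
  define B where "B = t *\<^sub>R (A + c *\<^sub>R mat 1)"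
  have B: "0 \<le> B $ i $ j" for i j
    using A[of i j] c[of i] t by (cases "i = j") (auto simp: B_def mat_def)
  have ex: "matrix_exp (t *\<^sub>R A) $ i $ j = exp (- (t * c)) * matrix_exp B $ i $ j" for i j
    unfolding B_def by (subst matrix_exp_shift[where c=c]) simp
  note s = matrix_exp_entry_sums[of B]
  have nn: "0 \<le> 1 / fact m * (mat_pow B m $ i $ j)" for m i j
    using mat_pow_nonneg[OF B, of m i j] by simp
  have le: "sum (\<lambda>m. 1 / fact m * (mat_pow B m $ i $ j)) I \<le> matrix_exp B $ i $ j" if "finite I" for I i j
    using sum_le_suminf[OF sums_summable[OF s] that, of i j] nn s[of i j] by (simp add: sums_iff)
  show "0 \<le> matrix_exp (t *\<^sub>R A) $ i $ j"
    using le[of "{}" i j] by (simp add: ex)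
  show "exp (- (t * c)) \<le> matrix_exp (t *\<^sub>R A) $ i $ i"
    using le[of "{0}" i i] by (simp add: ex mat_def)
  show "exp (- (t * c)) * t * A $ i $ j \<le> matrix_exp (t *\<^sub>R A) $ i $ j" if "i \<noteq> j"
    using le[of "{1}" i j] that by (simp add: ex mult.assoc) (simp add: B_def mat_def)
qed

section \<open>Subgenerators\<close>

abbreviation trans :: "real^'n^'n \<Rightarrow> real \<Rightarrow> real^'n^'n" where
  "trans U t \<equiv> matrix_exp (t *\<^sub>R U)"

definition surv :: "real^'n::finite^'n \<Rightarrow> real \<Rightarrow> 'n \<Rightarrow> real" where
  "surv U t i = (\<Sum>j\<in>UNIV. trans U t $ i $ j)"

definition exit_flow :: "real^'n::finite^'n \<Rightarrow> real \<Rightarrow> 'n \<Rightarrow> real" where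
  "exit_flow U t i = (\<Sum>j\<in>UNIV. trans U t $ i $ j * exit_rates U $ j)"

definition occ_prob :: "real^'n \<Rightarrow> real^'n::finite^'n \<Rightarrow> real \<Rightarrow> 'n \<Rightarrow> real" where
  "occ_prob a U t k = (\<Sum>i\<in>UNIV. a $ i * trans U t $ i $ k)"

lemma exit_rates_nth: "exit_rates U $ i = - (\<Sum>j\<in>UNIV. U $ i $ j)"
  by (simp add: exit_rates_def matrix_vector_mult_def)

lemma subgenerator_bound:
  assumes "subgenerator (U :: real^'n::finite^'n)"
  obtains c where "0 \<le> c" "\<And>t i j. 0 \<le> t \<Longrightarrow> 0 \<le> trans U t $ i $ j"
    "\<And>t i. 0 \<le> t \<Longrightarrow> exp (- (t * c)) \<le> trans U t $ i $ i"
    "\<And>t i j. 0 \<le> t \<Longrightarrow> i \<noteq> j \<Longrightarrow> exp (- (t * c)) * t * U $ i $ j \<le> trans U t $ i $ j"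
proof -
  define c where "c = (\<Sum>i\<in>UNIV. \<bar>U $ i $ i\<bar>)"
  have "\<bar>U $ i $ i\<bar> \<le> c" for i
    unfolding c_def by (rule member_le_sum) auto
  then have c: "0 \<le> U $ i $ i + c" for i
    by (smt (verit))
  have "0 \<le> U $ i $ j" if "i \<noteq> j" for i j
    using assms that by (simp add: subgenerator_def)
  note ge = matrix_exp_ge[of U c, OF this c]
  show ?thesis
  proof (rule that)
    show "0 \<le> c" by (simp add: c_def sum_nonneg)
  qed (use ge in auto)
qed

lemma trans_nonneg: "subgenerator U \<Longrightarrow> 0 \<le> t \<Longrightarrow> 0 \<le> trans U t $ i $ j"
  by (rule subgenerator_bound[of U]) auto

lemma trans_diag_pos: "subgenerator U \<Longrightarrow> 0 \<le> t \<Longrightarrow> 0 < trans U t $ i $ i"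
proof (rule subgenerator_bound[of U])
  fix c assume "0 \<le> t" "\<And>t i. 0 \<le> t \<Longrightarrow> exp (- (t * c)) \<le> trans U t $ i $ i"
  then have "exp (- (t * c)) \<le> trans U t $ i $ i" by blast
  then show "0 < trans U t $ i $ i"
    by (rule less_le_trans[OF exp_gt_zero])
qed

lemma trans_add: "trans U (s + t) $ i $ j = (\<Sum>k\<in>UNIV. trans U s $ i $ k * trans U t $ k $ j)"
  by (simp add: matrix_exp_add matrix_matrix_mult_def)

lemma trans_pos_step:
  assumes "subgenerator U" "0 < t" "U $ i $ j \<noteq> 0 \<or> i = j"
  shows "0 < trans U t $ i $ j"
proof (cases "i = j")
  case True
  then show ?thesis using trans_diag_pos[of U t] assms by simp
next
  case False
  then have "0 < U $ i $ j"
    using assms by (simp add: subgenerator_def order_less_le)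
  then have pos: "0 < exp (- (t * c)) * t * U $ i $ j" for c
    using assms by simp
  show ?thesis
  proof (rule subgenerator_bound[OF assms(1)])
    fix c assume "\<And>t i j. 0 \<le> t \<Longrightarrow> i \<noteq> j \<Longrightarrow> exp (- (t * c)) * t * U $ i $ j \<le> trans U t $ i $ j"
    from this[of t i j] pos[of c] assms(2) False show ?thesis by simp
  qed
qed

lemma trans_continuous: "isCont (\<lambda>t. trans U t $ i $ j) t"
  using matrix_exp_entry_deriv DERIV_isCont by blast

lemma surv_0 [simp]: "surv U 0 i = 1"
  unfolding surv_def matrix_exp_0 by (simp add: mat_def)


lemma surv_has_derivative: "((\<lambda>t. surv U t i) has_real_derivative (- exit_flow U t i)) (at t)"
proof -
  have "(\<Sum>j\<in>UNIV. (trans U t ** U) $ i $ j) = - exit_flow U t i"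
    by (simp add: exit_flow_def exit_rates_nth matrix_matrix_mult_def sum_negf sum_distrib_left)
      (rule sum.swap)
  moreover have "((\<lambda>t. surv U t i) has_real_derivative (\<Sum>j\<in>UNIV. (trans U t ** U) $ i $ j)) (at t)"
    unfolding surv_def by (intro DERIV_sum matrix_exp_entry_deriv)
  ultimately show ?thesis by simp
qed

lemma exit_rates_nonneg: "subgenerator U \<Longrightarrow> 0 \<le> exit_rates U $ i"
  by (simp add: exit_rates_nth subgenerator_def)

lemma exit_flow_nonneg: "subgenerator U \<Longrightarrow> 0 \<le> t \<Longrightarrow> 0 \<le> exit_flow U t i"
  unfolding exit_flow_def by (intro sum_nonneg mult_nonneg_nonneg trans_nonneg exit_rates_nonneg)

lemma surv_nonneg: "subgenerator U \<Longrightarrow> 0 \<le> t \<Longrightarrow> 0 \<le> surv U t i"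
  unfolding surv_def by (intro sum_nonneg trans_nonneg)

lemma surv_antimono:
  assumes "subgenerator U" "0 \<le> s" "s \<le> t"
  shows "surv U t i \<le> surv U s i"
proof (rule DERIV_nonpos_imp_nonincreasing[OF assms(3)])
  fix x assume "s \<le> x"
  then have "0 \<le> exit_flow U x i"
    using assms by (intro exit_flow_nonneg) auto
  then show "\<exists>y. ((\<lambda>t. surv U t i) has_real_derivative y) (at x) \<and> y \<le> 0"
    using surv_has_derivative by (intro exI[of _ "- exit_flow U x i"]) auto
qed

lemma surv_le_1: "subgenerator U \<Longrightarrow> 0 \<le> t \<Longrightarrow> surv U t i \<le> 1"
  using surv_antimono[of U 0 t i] by simp

lemma surv_less_1:
  assumes U: "subgenerator U" and t: "0 < t" and pos: "\<And>s. 0 < s \<Longrightarrow> 0 < exit_flow U s i"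
  shows "surv U t i < 1"
proof -
  have "\<exists>z>0. z < t \<and> surv U t i - surv U 0 i = (t - 0) * (- exit_flow U z i)"
    by (rule MVT2[OF t]) (rule surv_has_derivative)
  then obtain z where z: "0 < z" "surv U t i - 1 = t * (- exit_flow U z i)"
    by auto
  have "0 < t * exit_flow U z i"
    using pos[OF z(1)] t by simp
  then show ?thesis using z(2) by simp
qed

lemma trans_le_surv: "subgenerator U \<Longrightarrow> 0 \<le> t \<Longrightarrow> trans U t $ i $ j \<le> surv U t i"
  unfolding surv_def by (rule member_le_sum) (auto intro: trans_nonneg)

lemma surv_add: "surv U (s + t) i = (\<Sum>k\<in>UNIV. trans U s $ i $ k * surv U t k)"
  by (simp add: surv_def trans_add sum_distrib_left) (rule sum.swap)

lemma exit_flow_add: "exit_flow U (s + t) i = (\<Sum>k\<in>UNIV. trans U s $ i $ k * exit_flow U t k)"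
  by (simp add: exit_flow_def trans_add sum_distrib_left sum_distrib_right mult.assoc) (rule sum.swap)

lemma occ_prob_add: "occ_prob a U (s + t) k = (\<Sum>j\<in>UNIV. occ_prob a U s j * trans U t $ j $ k)"
  by (simp add: occ_prob_def trans_add sum_distrib_left sum_distrib_right mult.assoc) (rule sum.swap)

lemma surv_decay:
  assumes U: "subgenerator (U :: real^'n::finite^'n)"
    and lim: "\<And>i. ((\<lambda>t. surv U t i) \<longlongrightarrow> 0) at_top"
  obtains a C where "0 < a" "0 < C" "\<And>t i. 0 \<le> t \<Longrightarrow> surv U t i \<le> C * exp (- (a * t))"
proof -
  have "\<forall>\<^sub>F t in at_top. \<forall>i. surv U t i < 1/2"
    using lim by (intro eventually_all_finite order_tendstoD) auto
  then have "\<forall>\<^sub>F t in at_top. 0 < t \<and> (\<forall>i. surv U t i < 1/2)"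
    by (intro eventually_conj eventually_gt_at_top)
  then obtain u where u: "0 < u" "\<And>i. surv U u i < 1/2"
    using eventually_happens'[OF trivial_limit_at_top_linorder] by blast
  have pow: "surv U (real n * u) i \<le> (1/2)^n" for n i
  proof (induction n arbitrary: i)
    case (Suc n)
    have "surv U (real (Suc n) * u) i = (\<Sum>k\<in>UNIV. trans U u $ i $ k * surv U (real n * u) k)"
      using surv_add[of U u "real n * u" i] by (simp add: algebra_simps)
    also have "\<dots> \<le> (\<Sum>k\<in>UNIV. trans U u $ i $ k * (1/2)^n)"
      using Suc u by (intro sum_mono mult_left_mono trans_nonneg[OF U]) auto
    also have "\<dots> = surv U u i * (1/2)^n"
      by (simp add: surv_def sum_distrib_right)
    also have "\<dots> \<le> (1/2) * (1/2)^n"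
      using u(2)[of i] by (intro mult_right_mono) auto
    finally show ?case by simp
  qed simp
  show ?thesis
  proof (rule that)
    show "0 < ln 2 / u" "0 < (2::real)" using u by auto
    fix t :: real and i assume t: "0 \<le> t"
    define n where "n = nat \<lfloor>t / u\<rfloor>"
    have n: "real n \<le> t / u" "t / u < real n + 1"
      using t u by (auto simp: n_def)
    have "surv U t i \<le> surv U (real n * u) i"
      using n u by (intro surv_antimono[OF U]) (auto simp: field_simps)
    also have "\<dots> \<le> (1/2)^n" by (rule pow)
    also have "\<dots> = exp (- (ln 2 * real n))"
      by (simp add: exp_minus exp_of_nat2_mult power_one_over inverse_eq_divide)
    also have "\<dots> \<le> exp (ln 2 - ln 2 / u * t)"
    proof -
      have "ln 2 * (t / u) \<le> ln 2 * (real n + 1)"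
        using n by (intro mult_left_mono) auto
      then show ?thesis by (simp add: algebra_simps)
    qed
    also have "\<dots> = 2 * exp (- (ln 2 / u * t))"
      by (simp add: exp_diff exp_minus divide_inverse)
    finally show "surv U t i \<le> 2 * exp (- (ln 2 / u * t))" .
  qed
qed

lemma sum_UNIV_option: "(\<Sum>x\<in>UNIV. f x) = f None + (\<Sum>x\<in>UNIV. f (Some x))"
  for f :: "'n::finite option \<Rightarrow> real"
  by (simp add: UNIV_option_conv sum.reindex)

lemma trans_extend:
  fixes U :: "real^'n::finite^'n"
  shows "trans (extend_generator U) t $ Some i $ Some j = trans U t $ i $ j"
    and "trans (extend_generator U) t $ None $ None = 1"
    and "trans (extend_generator U) t $ None $ Some j = 0"
    and "trans (extend_generator U) t $ Some i $ None = 1 - surv U t i"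
proof -
  define B where "B = t *\<^sub>R extend_generator U"
  have B: "B $ None $ x = 0" "B $ Some p $ Some q = (t *\<^sub>R U) $ p $ q"
    "(\<Sum>y\<in>UNIV. B $ x $ y) = 0" for x p q
    by (cases x; simp add: B_def extend_generator_def sum_UNIV_option exit_rates_nth sum_distrib_left[symmetric])+
  have none: "mat_pow B m $ None $ x = mat 1 $ None $ x * (if m = 0 then 1 else 0)" for m x
    by (cases m) (auto simp: matrix_matrix_mult_def B)
  have nz: "mat_pow B m $ None $ Some q = 0" for m q
    unfolding none by (simp add: mat_def)
  have some: "mat_pow B m $ Some p $ Some q = mat_pow (t *\<^sub>R U) m $ p $ q" for m p q
    by (induction m arbitrary: p) (simp_all add: matrix_matrix_mult_def B sum_UNIV_option nz, simp add: mat_def)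
  have row: "(\<Sum>y\<in>UNIV. mat_pow B m $ x $ y) = (if m = 0 then 1 else 0)" for m x
  proof (induction m arbitrary: x)
    case (Suc m)
    have "(\<Sum>y\<in>UNIV. mat_pow B (Suc m) $ x $ y) = (\<Sum>z\<in>UNIV. B $ x $ z * (\<Sum>y\<in>UNIV. mat_pow B m $ z $ y))"
      by (simp add: matrix_matrix_mult_def sum_distrib_left) (rule sum.swap)
    then show ?case by (simp add: Suc B)
  qed (simp add: mat_def)
  show 1: "trans (extend_generator U) t $ Some i $ Some j = trans U t $ i $ j" for i j
    using matrix_exp_entry_sums[of B "Some i" "Some j"] matrix_exp_entry_sums[of "t *\<^sub>R U" i j]
    by (simp only: some B_def[symmetric]) (rule sums_unique2)
  have n: "trans (extend_generator U) t $ None $ x = mat 1 $ None $ x" for x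
  proof -
    have "(\<lambda>m. 1 / fact m * (mat_pow B m $ None $ x)) sums (\<Sum>m\<in>{0}. 1 / fact m * (mat_pow B m $ None $ x))"
      by (rule sums_finite) (auto simp: none)
    then show ?thesis
      using matrix_exp_entry_sums[of B None x] by (simp add: B_def[symmetric] sums_unique2)
  qed
  show "trans (extend_generator U) t $ None $ None = 1" "trans (extend_generator U) t $ None $ Some j = 0"
    by (simp_all add: n mat_def)
  have "(\<Sum>y\<in>UNIV. trans (extend_generator U) t $ Some i $ y) = 1"
  proof -
    have "(\<lambda>m. \<Sum>y\<in>UNIV. 1 / fact m * (mat_pow B m $ Some i $ y))
        sums (\<Sum>y\<in>UNIV. trans (extend_generator U) t $ Some i $ y)"
      unfolding B_def by (intro sums_sum matrix_exp_entry_sums)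
    moreover have "(\<Sum>y\<in>UNIV. 1 / fact m * (mat_pow B m $ Some i $ y)) = (if m = 0 then 1 else 0)" for m
      by (simp only: sum_distrib_left[symmetric] row) simp
    ultimately have "(\<lambda>m. if m = 0 then 1 else 0 :: real) sums (\<Sum>y\<in>UNIV. trans (extend_generator U) t $ Some i $ y)"
      by simp
    then show ?thesis
      using sums_unique2 sums_single[of 0 "\<lambda>_. 1 :: real"] by blast
  qed
  then show "trans (extend_generator U) t $ Some i $ None = 1 - surv U t i"
    by (simp add: sum_UNIV_option 1 surv_def)
qed

section \<open>Restart distributions and time reversal\<close>

lemma matrix_mult_nth: "(A ** B) $ i $ j = (\<Sum>k\<in>UNIV. A $ i $ k * B $ k $ j)"
  by (simp add: matrix_matrix_mult_def)

lemma matrix_inv_inverse: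
  assumes "invertible (A :: real^'n::finite^'n)"
  shows "A ** matrix_inv A = mat 1" "matrix_inv A ** A = mat 1"
  using someI_ex[OF assms[unfolded invertible_def]] by (simp_all add: matrix_inv_def)

lemma restart_vectorsD:
  assumes "b \<in> restart_vectors U"
  shows "0 \<le> b $ i" "(\<Sum>i\<in>UNIV. b $ i) = 1"
    "(i, j) \<in> {(p, q). U $ p $ q + exit_rates U $ p * b $ q \<noteq> 0}\<^sup>*"
  using assms by (auto simp: restart_vectors_def prob_vector_def irreducible_matrix_def)

lemma occ_prob_pos:
  assumes U: "subgenerator (U :: real^'n::finite^'n)" and b: "b \<in> restart_vectors U" and "0 < t"
  shows "0 < occ_prob b U t k"
proof -
  define R where "R k \<longleftrightarrow> (\<forall>t>0. 0 < occ_prob b U t k)" for k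
  note b' = restart_vectorsD[OF b]
  have nn: "0 \<le> occ_prob b U t k" if "0 \<le> t" for t k
    unfolding occ_prob_def using b' that by (intro sum_nonneg mult_nonneg_nonneg trans_nonneg[OF U]) auto
  have start: "R k" if "b $ k \<noteq> 0" for k
    unfolding R_def
  proof safe
    fix t :: real assume "0 < t"
    then have "0 < b $ k * trans U t $ k $ k"
      using that b'(1)[of k] trans_diag_pos[OF U, of t k] by simp
    also have "\<dots> \<le> occ_prob b U t k"
      unfolding occ_prob_def using b' \<open>0 < t\<close>
      by (intro member_le_sum[of k UNIV "\<lambda>i. b $ i * trans U t $ i $ k"] mult_nonneg_nonneg trans_nonneg[OF U]) auto
    finally show "0 < occ_prob b U t k" .
  qed
  have step: "R j" if "R i" "U $ i $ j + exit_rates U $ i * b $ j \<noteq> 0" for i j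
  proof (cases "b $ j = 0")
    case True
    with that have ij: "U $ i $ j \<noteq> 0" by simp
    show ?thesis unfolding R_def
    proof safe
      fix t :: real assume t: "0 < t"
      then have "0 < occ_prob b U (t/2) i * trans U (t/2) $ i $ j"
        using that(1) trans_pos_step[OF U, of "t/2" i j] ij by (simp add: R_def)
      also have "\<dots> \<le> (\<Sum>k\<in>UNIV. occ_prob b U (t/2) k * trans U (t/2) $ k $ j)"
        using t by (intro member_le_sum[of i UNIV "\<lambda>k. occ_prob b U (t/2) k * trans U (t/2) $ k $ j"] mult_nonneg_nonneg trans_nonneg[OF U] nn) auto
      also have "\<dots> = occ_prob b U t j"
        using occ_prob_add[of b U "t/2" "t/2" j] by simp
      finally show "0 < occ_prob b U t j" .
    qed
  qed (rule start)
  obtain i where "b $ i \<noteq> 0"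
    using b'(2) by (metis sum.neutral zero_neq_one)
  note i = start[OF this]
  from b'(3)[of i k] have "R k"
    by (induction rule: rtrancl_induct) (use i step in auto)
  then show ?thesis using assms(3) by (simp add: R_def)
qed

lemma exit_flow_pos:
  assumes U: "subgenerator (U :: real^'n::finite^'n)" and b: "b \<in> restart_vectors U"
    and lim: "\<And>i. ((\<lambda>t. surv U t i) \<longlongrightarrow> 0) at_top" and "0 < t"
  shows "0 < exit_flow U t k"
proof -
  define R where "R k \<longleftrightarrow> (\<forall>t>0. 0 < exit_flow U t k)" for k
  note b' = restart_vectorsD[OF b]
  have start: "R k" if "exit_rates U $ k \<noteq> 0" for k
    unfolding R_def
  proof safe
    fix t :: real assume "0 < t"
    then have "0 < trans U t $ k $ k * exit_rates U $ k"
      using that exit_rates_nonneg[OF U, of k] trans_diag_pos[OF U, of t k] by simp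
    also have "\<dots> \<le> exit_flow U t k"
      unfolding exit_flow_def using \<open>0 < t\<close>
      by (intro member_le_sum[of k UNIV "\<lambda>i. trans U t $ k $ i * exit_rates U $ i"] mult_nonneg_nonneg trans_nonneg[OF U] exit_rates_nonneg[OF U]) auto
    finally show "0 < exit_flow U t k" .
  qed
  have step: "R i" if "R j" "U $ i $ j + exit_rates U $ i * b $ j \<noteq> 0" for i j
  proof (cases "exit_rates U $ i = 0")
    case True
    with that have ij: "U $ i $ j \<noteq> 0" by simp
    show ?thesis unfolding R_def
    proof safe
      fix t :: real assume t: "0 < t"
      then have "0 < trans U (t/2) $ i $ j * exit_flow U (t/2) j"
        using that(1) trans_pos_step[OF U, of "t/2" i j] ij by (simp add: R_def)
      also have "\<dots> \<le> (\<Sum>k\<in>UNIV. trans U (t/2) $ i $ k * exit_flow U (t/2) k)"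
        using t by (intro member_le_sum[of j UNIV "\<lambda>k. trans U (t/2) $ i $ k * exit_flow U (t/2) k"] mult_nonneg_nonneg trans_nonneg[OF U] exit_flow_nonneg[OF U]) auto
      also have "\<dots> = exit_flow U t i"
        using exit_flow_add[of U "t/2" "t/2" i] by simp
      finally show "0 < exit_flow U t i" .
    qed
  qed (rule start)
  have "\<exists>i. exit_rates U $ i \<noteq> 0"
  proof (rule ccontr)
    assume "\<nexists>i. exit_rates U $ i \<noteq> 0"
    then have "((\<lambda>t. surv U t k) has_real_derivative 0) (at t)" for t k
      using surv_has_derivative[of U k t] by (simp add: exit_flow_def)
    then have "surv U t k = surv U 0 k" for t k
      by (intro DERIV_isconst_all) auto
    then have "surv U t k = 1" for t k
      by (metis surv_0)
    with lim[of k] show False by (simp add: tendsto_const_iff)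
  qed
  then obtain i where "exit_rates U $ i \<noteq> 0" ..
  note i = start[OF this]
  from b'(3)[of k i] have "R k"
    by (induction rule: converse_rtrancl_induct) (use i step in auto)
  then show ?thesis using assms(4) by (simp add: R_def)
qed

lemma surv_tendsto_0:
  assumes U: "subgenerator (U :: real^'n::finite^'n)" and b: "b \<in> restart_vectors U"
    and lim: "((\<lambda>t. \<Sum>i\<in>UNIV. occ_prob b U t i) \<longlongrightarrow> 0) at_top"
  shows "((\<lambda>t. surv U t i) \<longlongrightarrow> 0) at_top"
proof -
  let ?p = "occ_prob b U 1 i"
  have p: "0 < ?p" using occ_prob_pos[OF U b] by simp
  have le: "surv U t i \<le> inverse ?p * (\<Sum>i\<in>UNIV. occ_prob b U (1 + t) i)" if "0 \<le> t" for t
  proof -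
    have "0 \<le> occ_prob b U 1 j * surv U t j" for j
      using that occ_prob_pos[OF U b, of 1 j] surv_nonneg[OF U, of t j] by simp
    then have "?p * surv U t i \<le> (\<Sum>j\<in>UNIV. occ_prob b U 1 j * surv U t j)"
      by (intro member_le_sum[of i UNIV "\<lambda>j. occ_prob b U 1 j * surv U t j"]) auto
    also have "\<dots> = (\<Sum>i\<in>UNIV. occ_prob b U (1 + t) i)"
      unfolding occ_prob_add by (simp add: surv_def sum_distrib_left) (rule sum.swap)
    finally show ?thesis using p by (simp add: field_simps)
  qed
  have "((\<lambda>t. \<Sum>i\<in>UNIV. occ_prob b U (1 + t) i) \<longlongrightarrow> 0) at_top"
    by (rule filterlim_compose[OF lim]) (rule filterlim_tendsto_add_at_top[OF tendsto_const filterlim_ident])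
  then have lim': "((\<lambda>t. inverse ?p * (\<Sum>i\<in>UNIV. occ_prob b U (1 + t) i)) \<longlongrightarrow> 0) at_top"
    by (rule tendsto_mult_right_zero)
  show ?thesis
    by (rule tendsto_sandwich[OF _ _ tendsto_const lim'])
      (use le surv_nonneg[OF U] in \<open>auto intro!: eventually_mono[OF eventually_ge_at_top[of 0]]\<close>)
qed

locale reversal =
  fixes U :: "real^'n::finite^'n" and b :: "real^'n"
  assumes U: "subgenerator U" and b: "b \<in> restart_vectors U"
    and lim: "\<And>i. ((\<lambda>t. surv U t i) \<longlongrightarrow> 0) at_top"
begin

abbreviation nu :: "'n \<Rightarrow> real" where "nu i \<equiv> occupation b U $ i"

lemma trans_tendsto_0: "((\<lambda>t. trans U t $ i $ j) \<longlongrightarrow> 0) at_top"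
  by (rule tendsto_sandwich[OF _ _ tendsto_const lim[of i]])
    (use trans_nonneg[OF U] trans_le_surv[OF U] in
      \<open>auto intro!: eventually_mono[OF eventually_ge_at_top[of 0]]\<close>)

lemma invertible_gen: "invertible U"
proof -
  have "x = 0" if "U *v x = 0" for x
  proof -
    define f where "f i t = (\<Sum>j\<in>UNIV. trans U t $ i $ j * x $ j)" for i t
    have "(f i has_real_derivative 0) (at t)" for i t
    proof -
      have "((\<lambda>t. \<Sum>j\<in>UNIV. trans U t $ i $ j * x $ j) has_real_derivative
          (\<Sum>j\<in>UNIV. (trans U t ** U) $ i $ j * x $ j)) (at t)"
        by (intro DERIV_sum DERIV_cmult_right matrix_exp_entry_deriv)
      also have "(\<Sum>j\<in>UNIV. (trans U t ** U) $ i $ j * x $ j) = (trans U t *v (U *v x)) $ i"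
        by (simp add: matrix_vector_mul_assoc) (simp add: matrix_vector_mult_def)
      finally show ?thesis using that by (simp add: f_def[abs_def])
    qed
    then have const: "f i t = f i 0" for i t
      by (intro DERIV_isconst_all) auto
    have "f i 0 = x $ i" for i
      unfolding f_def matrix_exp_0 by (simp add: mat_def mult_delta_left mult_delta_right)
    moreover have "(f i \<longlongrightarrow> 0) at_top" for i
      unfolding f_def[abs_def] by (intro tendsto_null_sum tendsto_mult_left_zero trans_tendsto_0)
    then have "((\<lambda>t::real. f i 0) \<longlongrightarrow> 0) at_top" for i
      by (rule Lim_transform_eventually[of "f i"]) (intro always_eventually allI const)
    then have "f i 0 = 0" for i
      by (simp add: tendsto_const_iff)
    ultimately show ?thesis
      by (simp add: vec_eq_iff)
  qed
  then show ?thesis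
    by (simp add: invertible_left_inverse matrix_left_invertible_ker)
qed

lemma occupation_gen: "(\<Sum>i\<in>UNIV. nu i * U $ i $ j) = - b $ j"
proof -
  have "((b v* matrix_inv U) v* U) $ j = b $ j"
    using invertible_gen by (simp add: vector_matrix_mul_assoc matrix_inv_inverse)
  then show ?thesis
    by (simp add: occupation_def vector_matrix_mult_def[of _ U] sum_negf mult.commute)
qed

lemma occupation_pos: "0 < nu k"
proof -
  define y where "y t = (\<Sum>i\<in>UNIV. nu i * trans U t $ i $ k)" for t
  have dy: "(y has_real_derivative - occ_prob b U t k) (at t)" for t
  proof -
    have "((\<lambda>t. \<Sum>i\<in>UNIV. nu i * trans U t $ i $ k) has_real_derivative
        (\<Sum>i\<in>UNIV. nu i * (trans U t ** U) $ i $ k)) (at t)"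
      by (intro DERIV_sum DERIV_cmult matrix_exp_entry_deriv)
    also have "(\<Sum>i\<in>UNIV. nu i * (trans U t ** U) $ i $ k) = (\<Sum>i\<in>UNIV. \<Sum>j\<in>UNIV. nu i * U $ i $ j * trans U t $ j $ k)"
      by (simp add: matrix_exp_commute) (simp add: matrix_matrix_mult_def sum_distrib_left mult.assoc)
    also have "\<dots> = (\<Sum>j\<in>UNIV. (\<Sum>i\<in>UNIV. nu i * U $ i $ j) * trans U t $ j $ k)"
      by (subst sum.swap) (simp add: sum_distrib_right)
    also have "\<dots> = - occ_prob b U t k"
      by (simp add: occupation_gen occ_prob_def sum_negf)
    finally show ?thesis by (simp add: y_def[abs_def])
  qed
  have lt: "y t < y s" if "0 \<le> s" "s < t" for s t
    using that
  proof (intro DERIV_neg_imp_decreasing_open[of s t y])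
    fix x assume "s < x"
    then show "\<exists>d. (y has_real_derivative d) (at x) \<and> d < 0"
      using dy[of x] occ_prob_pos[OF U b, of x k] that by (intro exI[of _ "- occ_prob b U x k"]) auto
  qed (use dy DERIV_isCont in \<open>auto intro!: continuous_at_imp_continuous_on\<close>)
  have "(y \<longlongrightarrow> 0) at_top"
    unfolding y_def[abs_def] by (intro tendsto_null_sum tendsto_mult_right_zero trans_tendsto_0)
  then have "0 \<le> y 1"
    by (rule tendsto_upperbound) (auto intro!: eventually_mono[OF eventually_gt_at_top[of 1]] less_imp_le lt)
  also have "y 1 < y 0" by (rule lt) auto
  also have "y 0 = nu k"
    unfolding y_def matrix_exp_0 by (simp add: mat_def mult_delta_left mult_delta_right)
  finally show ?thesis .
qed

lemma reversed_generator_nth: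
  "reversed_generator b U $ i $ j = nu j * U $ j $ i / nu i"
proof -
  define D where "D = diag_matrix (occupation b U)"
  define E where "E = diag_matrix (\<chi> i. 1 / nu i)"
  have nz: "nu i \<noteq> 0" for i using occupation_pos[of i] by simp
  have ed: "E ** D = mat 1" "D ** E = mat 1"
    using nz by (simp_all add: D_def E_def vec_eq_iff matrix_matrix_mult_def diag_matrix_def mat_def mult_delta_left mult_delta_right)
  have "invertible D"
    using ed unfolding invertible_def by blast
  then have "matrix_inv D = E"
    using matrix_inv_inverse(1)[of D] ed(1) matrix_mul_assoc[of E D "matrix_inv D"] by simp
  then show ?thesis
    unfolding reversed_generator_def D_def[symmetric]
    by (simp add: E_def D_def matrix_matrix_mult_def diag_matrix_def transpose_def
        mult_delta_left mult_delta_right)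
qed

lemma reversed_initial_nth: "reversed_initial b U $ i = exit_rates U $ i * nu i"
  by (simp add: reversed_initial_def vector_matrix_mult_def diag_matrix_def if_distrib cong: if_cong)

lemma exit_rates_reversed: "exit_rates (reversed_generator b U) $ i = b $ i / nu i"
  using occupation_gen[of i]
  by (simp add: exit_rates_nth reversed_generator_nth sum_divide_distrib[symmetric])

lemma subgenerator_reversed: "subgenerator (reversed_generator b U)"
  unfolding subgenerator_def
proof safe
  show "0 \<le> reversed_generator b U $ i $ j" if "i \<noteq> j" for i j
    using U that occupation_pos[of i] occupation_pos[of j]
    by (auto simp: reversed_generator_nth subgenerator_def intro!: divide_nonneg_pos mult_nonneg_nonneg)
  have "0 \<le> exit_rates (reversed_generator b U) $ i" for i
    using restart_vectorsD(1)[OF b, of i] occupation_pos[of i] by (simp add: exit_rates_reversed)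
  then show "(\<Sum>j\<in>UNIV. reversed_generator b U $ i $ j) \<le> 0" for i
    by (simp add: exit_rates_nth)
qed

lemma trans_reversed: "trans (reversed_generator b U) t $ i $ j = nu j * trans U t $ j $ i / nu i"
proof -
  have nz: "nu i \<noteq> 0" for i using occupation_pos[of i] by simp
  let ?B = "t *\<^sub>R reversed_generator b U"
  have comm: "A ** mat_pow A m = mat_pow A m ** A" for A :: "real^'n^'n" and m
    by (induction m) (simp_all add: matrix_mul_assoc)
  have "mat_pow ?B m $ i $ j = nu j * mat_pow (t *\<^sub>R U) m $ j $ i / nu i" for m i j
  proof (induction m arbitrary: i)
    case (Suc m)
    have "mat_pow ?B (Suc m) $ i $ j = (\<Sum>k\<in>UNIV. ?B $ i $ k * mat_pow ?B m $ k $ j)"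
      by (simp only: funpow.simps o_apply matrix_mult_nth)
    also have "\<dots> = (\<Sum>k\<in>UNIV. nu j * (mat_pow (t *\<^sub>R U) m $ j $ k * (t * U $ k $ i)) / nu i)"
      unfolding Suc using nz by (auto simp: reversed_generator_nth field_simps intro!: sum.cong)
    also have "\<dots> = nu j * (mat_pow (t *\<^sub>R U) m ** (t *\<^sub>R U)) $ j $ i / nu i"
      by (simp add: matrix_mult_nth[of _ "t *\<^sub>R U"] sum_divide_distrib sum_distrib_left)
    finally show ?case by (simp only: comm[symmetric] funpow.simps o_apply)
  qed (use nz in \<open>auto simp: mat_def\<close>)
  then have "(\<lambda>m. nu j / nu i * (1 / fact m * (mat_pow (t *\<^sub>R U) m $ j $ i))) sums trans (reversed_generator b U) t $ i $ j"
    using matrix_exp_entry_sums[of ?B i j] by (simp add: mult_ac)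
  then show ?thesis
    using sums_unique2 sums_mult[OF matrix_exp_entry_sums[of "t *\<^sub>R U" j i], of "nu j / nu i"] by fastforce
qed

lemma occ_prob_reversed:
  "occ_prob (reversed_initial b U) (reversed_generator b U) t k = nu k * exit_flow U t k"
proof -
  have nz: "nu i \<noteq> 0" for i using occupation_pos[of i] by simp
  show ?thesis
    unfolding occ_prob_def exit_flow_def sum_distrib_left
    using nz by (auto simp: trans_reversed reversed_initial_nth field_simps intro!: sum.cong)
qed

lemma exit_flow_reversed: "exit_flow (reversed_generator b U) t k = occ_prob b U t k / nu k"
proof -
  have nz: "nu i \<noteq> 0" for i using occupation_pos[of i] by simp
  show ?thesis
    unfolding occ_prob_def exit_flow_def sum_divide_distrib
    using nz by (auto simp: trans_reversed exit_rates_reversed field_simps intro!: sum.cong)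
qed

lemma surv_reversed_tendsto_0: "((\<lambda>t. surv (reversed_generator b U) t i) \<longlongrightarrow> 0) at_top"
  unfolding surv_def trans_reversed
  by (intro tendsto_null_sum tendsto_divide_zero tendsto_mult_right_zero trans_tendsto_0)

end

section \<open>Cadlag paths and their extrema\<close>

definition lv :: "(real \<Rightarrow> real) \<Rightarrow> real \<Rightarrow> real" where
  "lv x t = (if t \<le> 0 then 0 else Lim (at_left t) x)"

definition wsup :: "(real \<Rightarrow> real) \<Rightarrow> real \<Rightarrow> real \<Rightarrow> real" where
  "wsup x a b = (SUP s\<in>{a..b}. x s)"

definition amax :: "(real \<Rightarrow> real) \<Rightarrow> real \<Rightarrow> real set" where
  "amax x t = {s\<in>{0..t}. max (x s) (lv x s) = wsup x 0 t}"

lemma cadlag_right: "cadlag x \<Longrightarrow> 0 \<le> t \<Longrightarrow> (x \<longlongrightarrow> x t) (at_right t)"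
  by (simp add: cadlag_def continuous_within)

lemma cadlag_left:
  assumes "cadlag x" "0 < t" shows "(x \<longlongrightarrow> lv x t) (at_left t)"
proof -
  obtain l where "(x \<longlongrightarrow> l) (at_left t)"
    using assms by (auto simp: cadlag_def)
  then show ?thesis
    using assms tendsto_Lim[OF trivial_limit_at_left_real, of x l t] by (simp add: lv_def)
qed

lemma cadlag_uminus: "cadlag x \<Longrightarrow> cadlag (\<lambda>t. - x t)"
  by (auto simp: cadlag_def intro!: continuous_minus) (blast intro: tendsto_minus)

lemma lv_uminus: "cadlag x \<Longrightarrow> lv (\<lambda>t. - x t) t = - lv x t"
  using tendsto_Lim[OF trivial_limit_at_left_real tendsto_minus[OF cadlag_left], of x t]
  by (simp add: lv_def)

lemma cadlag_nhd:
  assumes x: "cadlag x" and "0 \<le> a" "a \<le> s" "x s < c" "a < s \<Longrightarrow> lv x s < c"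
  obtains d where "0 < d" "\<And>u. a \<le> u \<Longrightarrow> \<bar>u - s\<bar> < d \<Longrightarrow> x u < c"
proof -
  have "\<forall>\<^sub>F u in at_right s. x u < c"
    using cadlag_right[OF x, of s] assms by (auto dest: order_tendstoD(2))
  then obtain b where b: "s < b" "\<And>u. s < u \<Longrightarrow> u < b \<Longrightarrow> x u < c"
    by (auto simp: eventually_at_right_field)
  have "\<exists>b<s. \<forall>u. a \<le> u \<longrightarrow> b < u \<longrightarrow> u < s \<longrightarrow> x u < c"
  proof (cases "a < s")
    case True
    then have "\<forall>\<^sub>F u in at_left s. x u < c"
      using cadlag_left[OF x, of s] assms by (auto dest: order_tendstoD(2))
    then show ?thesis
      by (auto simp: eventually_at_left_field)
  next
    case False
    then show ?thesis using assms by (intro exI[of _ "s - 1"]) auto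
  qed
  then obtain b' where b': "b' < s" "\<And>u. a \<le> u \<Longrightarrow> b' < u \<Longrightarrow> u < s \<Longrightarrow> x u < c"
    by auto
  show ?thesis
  proof (rule that)
    show "0 < min (b - s) (s - b')" using b b' by simp
    show "x u < c" if "a \<le> u" "\<bar>u - s\<bar> < min (b - s) (s - b')" for u
      using b(2)[of u] b'(2)[of u] that \<open>x s < c\<close> by (cases u s rule: linorder_cases) auto
  qed
qed

lemma cadlag_local_bound:
  assumes x: "cadlag x" and ab: "0 \<le> a" "a \<le> b"
    and C: "\<And>c d. c \<in> C \<Longrightarrow> d \<in> C \<Longrightarrow> max c d \<in> C"
    and loc: "\<And>s. s \<in> {a..b} \<Longrightarrow> \<exists>c\<in>C. x s < c \<and> (a < s \<longrightarrow> lv x s < c)"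
  shows "\<exists>c\<in>C. \<forall>s\<in>{a..b}. x s \<le> c"
proof -
  define P where "P p q \<longleftrightarrow> (a \<le> p \<longrightarrow> q \<le> b \<longrightarrow> (\<exists>c\<in>C. \<forall>s\<in>{p..q}. x s \<le> c))" for p q
  have "P a b"
    using ab(2)
  proof (induction rule: Bolzano)
    case (trans p q r)
    show ?case
      unfolding P_def
    proof (intro impI)
      assume "a \<le> p" "r \<le> b"
      then obtain c d where cd: "c \<in> C" "d \<in> C" "\<forall>s\<in>{p..q}. x s \<le> c" "\<forall>s\<in>{q..r}. x s \<le> d"
        using trans unfolding P_def by (meson order_trans)
      show "\<exists>c\<in>C. \<forall>s\<in>{p..r}. x s \<le> c"
      proof (intro bexI[of _ "max c d"] ballI)
        fix s assume "s \<in> {p..r}"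
        then show "x s \<le> max c d"
          using cd(3,4) by (cases "s \<le> q") (auto simp: le_max_iff_disj)
      qed (use C cd in auto)
    qed
  next
    case (local s)
    then obtain c where c: "c \<in> C" "x s < c" "a < s \<longrightarrow> lv x s < c"
      using loc[of s] by auto
    obtain d where d: "0 < d" "\<And>u. a \<le> u \<Longrightarrow> \<bar>u - s\<bar> < d \<Longrightarrow> x u < c"
      using cadlag_nhd[OF x ab(1) local(1) c(2)] c(3) by blast
    show ?case
      unfolding P_def
    proof (intro exI[of _ d] conjI allI impI bexI[of _ c] ballI)
      fix p q r assume "p \<le> s \<and> s \<le> q \<and> q - p < d" "a \<le> p" "q \<le> b" "r \<in> {p..q}"
      then show "x r \<le> c" using d(2)[of r] by (intro less_imp_le) auto
    qed (use c d in auto)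
  qed
  then show ?thesis by (simp add: P_def)
qed

lemma cadlag_bdd:
  assumes "cadlag x" "0 \<le> a" shows "bdd_above (x ` {a..b})"
proof (cases "a \<le> b")
  case True
  have "\<exists>c\<in>UNIV. \<forall>s\<in>{a..b}. x s \<le> c"
  proof (rule cadlag_local_bound[OF assms True])
    show "\<exists>c\<in>UNIV. x s < c \<and> (a < s \<longrightarrow> lv x s < c)" for s
      by (rule bexI[of _ "max (x s) (lv x s) + 1"]) auto
  qed auto
  then show ?thesis by (auto intro: bdd_aboveI2)
qed simp

lemma wsup_upper: "cadlag x \<Longrightarrow> 0 \<le> a \<Longrightarrow> a \<le> s \<Longrightarrow> s \<le> b \<Longrightarrow> x s \<le> wsup x a b"
  unfolding wsup_def by (intro cSUP_upper cadlag_bdd) auto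

lemma wsup_least: "a \<le> b \<Longrightarrow> (\<And>s. a \<le> s \<Longrightarrow> s \<le> b \<Longrightarrow> x s \<le> c) \<Longrightarrow> wsup x a b \<le> c"
  unfolding wsup_def by (intro cSUP_least) auto

lemma wsup_upper_left:
  assumes x: "cadlag x" and "0 \<le> a" "a < s" "s \<le> b"
  shows "lv x s \<le> wsup x a b"
proof (rule tendsto_upperbound[OF cadlag_left[OF x]])
  have "\<forall>\<^sub>F u in at_left s. u \<in> {a<..<s}"
    using assms by (intro eventually_at_left_real)
  then show "\<forall>\<^sub>F u in at_left s. x u \<le> wsup x a b"
    by eventually_elim (use assms in \<open>auto intro: wsup_upper\<close>)
qed (use assms in auto)

lemma wsup_mono:
  "cadlag x \<Longrightarrow> 0 \<le> a \<Longrightarrow> a \<le> c \<Longrightarrow> c \<le> d \<Longrightarrow> d \<le> b \<Longrightarrow> wsup x c d \<le> wsup x a b"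
  by (intro wsup_least) (auto intro: wsup_upper)

lemma cadlag_attains:
  assumes x: "cadlag x" and ab: "0 \<le> a" "a \<le> b"
  obtains s where "s \<in> {a..b}" "x s = wsup x a b \<or> (a < s \<and> lv x s = wsup x a b)"
proof (rule ccontr)
  let ?M = "wsup x a b"
  assume "\<not> thesis"
  with that have lt: "x s \<noteq> ?M \<and> (a < s \<longrightarrow> lv x s \<noteq> ?M)" if "s \<in> {a..b}" for s
    using \<open>s \<in> {a..b}\<close> by blast
  have "\<exists>c\<in>{..<?M}. \<forall>s\<in>{a..b}. x s \<le> c"
  proof (rule cadlag_local_bound[OF x ab])
    fix s assume s: "s \<in> {a..b}"
    define v where "v = (if a < s then max (x s) (lv x s) else x s)"
    have "v < ?M"
      using lt[OF s] wsup_upper[OF x ab(1), of s b] wsup_upper_left[OF x ab(1), of s b] s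
      by (auto simp: v_def)
    then show "\<exists>c\<in>{..<?M}. x s < c \<and> (a < s \<longrightarrow> lv x s < c)"
      by (intro bexI[of _ "(v + ?M) / 2"]) (auto simp: v_def split: if_splits)
  qed auto
  then obtain c where c: "c < ?M" "\<forall>s\<in>{a..b}. x s \<le> c" by auto
  then have "?M \<le> c" using ab by (intro wsup_least) auto
  with c show False by simp
qed

locale path =
  fixes x :: "real \<Rightarrow> real"
  assumes x: "cadlag x" and x0: "x 0 = 0"
begin

lemma amaxI:
  assumes s: "s \<in> {a..b}" "0 \<le> a" "b \<le> t" "x s = wsup x 0 t \<or> (a < s \<and> lv x s = wsup x 0 t)"
  shows "s \<in> amax x t"
proof -
  have "x s \<le> wsup x 0 t"
    using s x by (intro wsup_upper) auto
  moreover have "lv x s \<le> wsup x 0 t"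
  proof (cases "0 < s")
    case True
    then show ?thesis using s x by (intro wsup_upper_left) auto
  next
    case False
    then show ?thesis using s wsup_upper[OF x, of 0 0 t] x0 by (auto simp: lv_def)
  qed
  ultimately show ?thesis using s by (auto simp: amax_def)
qed

lemma amaxD:
  assumes "s \<in> amax x t"
  shows "0 \<le> s" "s \<le> t" "x s = wsup x 0 t \<or> (0 < s \<and> lv x s = wsup x 0 t)"
  using assms x0 by (auto simp: amax_def lv_def max_def split: if_splits)

lemma amax_nonempty: "0 \<le> t \<Longrightarrow> amax x t \<noteq> {}"
  using cadlag_attains[OF x, of 0 t] amaxI[of _ 0 t t] by force

lemma amax_closed: "closed (amax x t)"
proof -
  have "s \<in> amax x t" if s: "s \<in> closure (amax x t)" for s
  proof (rule ccontr)
    assume n: "s \<notin> amax x t"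
    have "closure (amax x t) \<subseteq> {0..t}"
      by (rule closure_minimal) (auto simp: amax_def)
    then have st: "0 \<le> s" "s \<le> t" using s by auto
    let ?M = "wsup x 0 t"
    have "max (x s) (lv x s) \<le> ?M"
      using wsup_upper[OF x, of 0 s t] wsup_upper_left[OF x, of 0 s t] wsup_upper[OF x, of 0 0 t] st x0
      by (cases "0 < s") (auto simp: lv_def)
    then have "max (x s) (lv x s) < ?M"
      using n st by (auto simp: amax_def)
    then obtain c where c: "max (x s) (lv x s) < c" "c < ?M"
      using dense by blast
    obtain d where d: "0 < d" "\<And>u. 0 \<le> u \<Longrightarrow> \<bar>u - s\<bar> < d \<Longrightarrow> x u < c"
      using cadlag_nhd[OF x order_refl st(1), of c] c by auto
    obtain u where u: "u \<in> amax x t" "dist u s < d"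
      using s d(1) by (auto simp: closure_approachable)
    have us: "0 \<le> u" "\<bar>u - s\<bar> < d"
      using u amaxD(1)[OF u(1)] by (auto simp: dist_real_def)
    then have xu: "x u < ?M"
      using d(2)[of u] c by auto
    then have "0 < u" "lv x u = ?M"
      using amaxD(3)[OF u(1)] by auto
    moreover have "lv x u \<le> c"
    proof (rule tendsto_upperbound[OF cadlag_left[OF x \<open>0 < u\<close>]])
      have "max 0 (s - d) < u" using us \<open>0 < u\<close> by auto
      from eventually_at_left_real[OF this]
      show "\<forall>\<^sub>F v in at_left u. x v \<le> c"
        by eventually_elim (use us d(2) in \<open>auto intro!: less_imp_le\<close>)
    qed simp
    ultimately show False using c by simp
  qed
  then show ?thesis
    using closure_subset_eq by blast
qed

lemma amax_bdd: "bdd_below (amax x t)" "bdd_above (amax x t)"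
  by (auto simp: amax_def intro: bdd_belowI[of _ 0] bdd_aboveI[of _ t])

lemma Inf_amax: "0 \<le> t \<Longrightarrow> Inf (amax x t) \<in> amax x t"
  by (intro closed_contains_Inf amax_nonempty amax_closed amax_bdd)

lemma Sup_amax: "0 \<le> t \<Longrightarrow> Sup (amax x t) \<in> amax x t"
  by (intro closed_contains_Sup amax_nonempty amax_closed amax_bdd)

lemma wsup_init_less:
  assumes "0 \<le> r" "r < Inf (amax x t)" "0 \<le> t"
  shows "wsup x 0 r < wsup x 0 t"
proof -
  have rt: "r \<le> t" using amaxD(2)[OF Inf_amax[OF assms(3)]] assms by simp
  obtain s where s: "s \<in> {0..r}" "x s = wsup x 0 r \<or> (0 < s \<and> lv x s = wsup x 0 r)"
    using cadlag_attains[OF x, of 0 r] assms by auto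
  have "wsup x 0 r \<noteq> wsup x 0 t"
  proof
    assume "wsup x 0 r = wsup x 0 t"
    then have "s \<in> amax x t" using s rt by (intro amaxI[of s 0 r]) auto
    then have "Inf (amax x t) \<le> s" by (intro cInf_lower amax_bdd)
    then show False using s assms by simp
  qed
  then show ?thesis
    using wsup_mono[OF x, of 0 0 r t] assms rt by simp
qed

lemma wsup_tail_less:
  assumes "Sup (amax x t) < r" "r \<le> t" "0 \<le> t"
  shows "wsup x r t < wsup x 0 t"
proof -
  have r0: "0 \<le> r" using amaxD(1)[OF Sup_amax[OF assms(3)]] assms by simp
  obtain s where s: "s \<in> {r..t}" "x s = wsup x r t \<or> (r < s \<and> lv x s = wsup x r t)"
    using cadlag_attains[OF x, of r t] assms r0 by auto
  have "wsup x r t \<noteq> wsup x 0 t"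
  proof
    assume "wsup x r t = wsup x 0 t"
    then have "s \<in> amax x t" using s r0 by (intro amaxI[of s r t]) auto
    then have "s \<le> Sup (amax x t)" by (intro cSup_upper amax_bdd)
    then show False using s assms by simp
  qed
  then show ?thesis
    using wsup_mono[OF x, of 0 r t t] assms r0 by simp
qed

lemma amax_approx:
  assumes s: "s \<in> amax x t" and t: "0 < t" "lv x t = x t" and pos: "0 < d" "0 < e"
  obtains u v where "u < v" "\<And>r. u < r \<Longrightarrow> r < v \<Longrightarrow>
    0 < r \<and> r < t \<and> \<bar>r - s\<bar> < d \<and> wsup x 0 t - e < x r"
proof (cases "x s = wsup x 0 t \<and> s < t")
  case True
  then have "\<forall>\<^sub>F u in at_right s. wsup x 0 t - e < x u"
    using order_tendstoD(1)[OF cadlag_right[OF x amaxD(1)[OF s]], of "wsup x 0 t - e"] pos by simp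
  then obtain b where b: "s < b" "\<And>u. s < u \<Longrightarrow> u < b \<Longrightarrow> wsup x 0 t - e < x u"
    by (auto simp: eventually_at_right_field)
  show ?thesis
    by (rule that[of s "min b (min t (s + d))"]) (use True b pos amaxD[OF s] in auto)
next
  case False
  then have 1: "0 < s" "lv x s = wsup x 0 t"
    using amaxD[OF s] t by (cases "s = t"; auto)+
  then have "\<forall>\<^sub>F u in at_left s. wsup x 0 t - e < x u"
    using order_tendstoD(1)[OF cadlag_left[OF x], of s "wsup x 0 t - e"] pos by simp
  then obtain b where b: "b < s" "\<And>u. b < u \<Longrightarrow> u < s \<Longrightarrow> wsup x 0 t - e < x u"
    by (auto simp: eventually_at_left_field)
  show ?thesis
    by (rule that[of "max b (max 0 (s - d))" s]) (use 1 b pos amaxD[OF s] in auto)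
qed

lemma amax_restrict:
  assumes "s \<in> amax x t" "s < b" "b \<le> t"
  shows "amax x b = amax x t \<inter> {..b}"
proof -
  have "wsup x 0 t \<le> wsup x 0 b"
    using amaxD[OF assms(1)] wsup_upper[OF x, of 0 s b] wsup_upper_left[OF x, of 0 s b] assms by auto
  then have "wsup x 0 b = wsup x 0 t"
    using wsup_mono[OF x, of 0 0 b t] amaxD(1)[OF assms(1)] assms by auto
  then show ?thesis using assms by (auto simp: amax_def)
qed

lemma Inf_amax_restrict:
  assumes "Inf (amax x t) < b" "b \<le> t" "0 \<le> t"
  shows "Inf (amax x b) = Inf (amax x t)"
proof (rule cInf_eq_minimum)
  note i = Inf_amax[OF assms(3)]
  show "Inf (amax x t) \<in> amax x b"
    using amax_restrict[OF i assms(1,2)] i assms by auto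
  show "Inf (amax x t) \<le> r" if "r \<in> amax x b" for r
    using that amax_restrict[OF i assms(1,2)] by (intro cInf_lower amax_bdd) auto
qed

lemma Sup_amax_restrict:
  assumes "Sup (amax x t) < b" "b \<le> t" "0 \<le> t"
  shows "Sup (amax x b) = Sup (amax x t)"
proof (rule cSup_eq_maximum)
  note i = Sup_amax[OF assms(3)]
  show "Sup (amax x t) \<in> amax x b"
    using amax_restrict[OF i assms(1,2)] i assms by auto
  show "r \<le> Sup (amax x t)" if "r \<in> amax x b" for r
    using that amax_restrict[OF i assms(1,2)] by (intro cSup_upper amax_bdd) auto
qed

end

text \<open>For \<open>c = 1\<close> the tilt penalises late times and picks out the first point of maximum, for
  \<open>c = -1\<close> the last one.\<close>

lemma tilted_argmax_close:
  fixes y :: "real \<Rightarrow> real"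
  assumes t: "0 < t" and c: "c = 1 \<or> c = -1" and s: "0 \<le> s" "s \<le> t"
    and upper: "\<And>r. 0 \<le> r \<Longrightarrow> r \<le> t \<Longrightarrow> y r \<le> M"
    and near: "\<And>d e. 0 < d \<Longrightarrow> 0 < e \<Longrightarrow> \<exists>u v. u < v \<and> (\<forall>r. u < r \<longrightarrow> r < v \<longrightarrow>
        0 < r \<and> r < t \<and> \<bar>r - s\<bar> < d \<and> M - e < y r)"
    and far: "\<And>d. 0 < d \<Longrightarrow> \<exists>m<M. \<forall>r. 0 \<le> r \<longrightarrow> r \<le> t \<longrightarrow> d \<le> c * (s - r) \<longrightarrow> y r \<le> m"
    and d: "0 < d"
  shows "\<exists>e0>0. \<forall>e. 0 < e \<longrightarrow> e < e0 \<longrightarrow> (\<exists>h0>0. \<forall>h. 0 < h \<longrightarrow> h < h0 \<longrightarrow>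
    (\<forall>m::nat. real m * h < t \<longrightarrow>
       (\<forall>i::nat. real i * h < t \<longrightarrow> y (real i * h) - c * (e * (real i * h)) \<le> y (real m * h) - c * (e * (real m * h))) \<longrightarrow>
       \<bar>real m * h - s\<bar> < d \<and> \<bar>y (real m * h) - M\<bar> < d))"
proof -
  obtain m0 where m0: "m0 < M" "\<And>r. 0 \<le> r \<Longrightarrow> r \<le> t \<Longrightarrow> d \<le> c * (s - r) \<Longrightarrow> y r \<le> m0"
    using far[OF d] by blast
  define e0 where "e0 = min (M - m0) d / (2 * t)"
  have e0: "0 < e0" using m0 d t by (simp add: e0_def)
  have e0t: "2 * (e * t) \<le> M - m0" "2 * (e * t) \<le> d" if "e < e0" for e
    using that t by (simp_all add: e0_def field_simps)
  show ?thesis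
  proof (rule exI[of _ e0], intro conjI e0 allI impI)
    fix e assume e: "0 < e" "e < e0"
    define eta where "eta = min (e * d / 2) (min ((M - m0) / 2) (d / 2))"
    have eta: "0 < eta" "eta \<le> e * d / 2" "eta \<le> (M - m0) / 2" "eta \<le> d / 2"
      unfolding eta_def using e d m0(1) by (simp, intro min.cobounded1,
        intro min.coboundedI2 min.cobounded1, intro min.coboundedI2 min.cobounded2)
    obtain u v where uv: "u < v" "\<And>r. u < r \<Longrightarrow> r < v \<Longrightarrow>
        0 < r \<and> r < t \<and> \<bar>r - s\<bar> < d / 2 \<and> M - eta < y r"
      using near[of "d/2" eta] d eta(1) by auto
    have u0: "0 \<le> u"
    proof (rule ccontr)
      assume neg: "\<not> 0 \<le> u"
      define w where "w = (if v \<le> 0 then (u + v) / 2 else u / 2)"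
      have "u < w" "w < v" "w \<le> 0"
        using neg uv(1) by (auto simp: w_def)
      then show False using uv(2)[of w] by simp
    qed
    show "\<exists>h0>0. \<forall>h. 0 < h \<longrightarrow> h < h0 \<longrightarrow> (\<forall>m::nat. real m * h < t \<longrightarrow>
       (\<forall>i::nat. real i * h < t \<longrightarrow> y (real i * h) - c * (e * (real i * h)) \<le> y (real m * h) - c * (e * (real m * h))) \<longrightarrow>
       \<bar>real m * h - s\<bar> < d \<and> \<bar>y (real m * h) - M\<bar> < d)"
    proof (intro exI[of _ "v - u"] conjI allI impI)
      show "0 < v - u" using uv by simp
      fix h and m :: nat assume h: "0 < h" "h < v - u" and mt: "real m * h < t"
        and mx: "\<forall>i::nat. real i * h < t \<longrightarrow> y (real i * h) - c * (e * (real i * h)) \<le> y (real m * h) - c * (e * (real m * h))"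
      define j where "j = nat \<lfloor>u / h\<rfloor> + 1"
      define p where "p = real j * h"
      define q where "q = real m * h"
      have "real j = real_of_int \<lfloor>u / h\<rfloor> + 1"
        using u0 h by (simp add: j_def)
      then have "u / h < real j" "real j \<le> u / h + 1"
        by linarith+
      then have "u < p" "p < v"
        using h by (auto simp: p_def field_simps)
      then have p: "0 < p" "p < t" "\<bar>p - s\<bar> < d / 2" "M - eta < y p"
        using uv(2)[of p] by auto
      have q: "0 \<le> q" "q < t" using h mt by (auto simp: q_def)
      have qp: "y p - y q \<le> e * (c * (p - q))"
        using mx[rule_format, of j, folded p_def q_def] p(2) by (simp add: algebra_simps)
      have cpq: "c * (p - q) \<le> t"
        using c p q by auto
      then have "e * (c * (p - q)) \<le> e * t" using e by simp
      with qp have qp': "y p - y q \<le> e * t" by simp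
      have "\<not> d \<le> c * (s - q)"
      proof
        assume "d \<le> c * (s - q)"
        then have "y q \<le> m0" using m0(2)[of q] q by simp
        moreover have "2 * (y p - y q) \<le> M - m0" "2 * (M - y p) < M - m0"
          using qp' p(4) eta(3) e0t(1)[OF e(2)] by auto
        ultimately show False by simp
      qed
      moreover have "\<not> d \<le> c * (q - s)"
      proof
        assume a: "d \<le> c * (q - s)"
        have "c * (p - q) \<le> - (d / 2)"
          using c
        proof
          assume "c = 1"
          then show ?thesis using a p(3) by (simp only: mult_1_left)
        next
          assume "c = - 1"
          then show ?thesis using a p(3) by (simp only: mult_minus1 minus_diff_eq)
        qed
        then have "e * (c * (p - q)) \<le> e * (- (d / 2))"
          using e by (intro mult_left_mono) auto
        then show False using qp upper[of q] q p(4) eta(2) by simp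
      qed
      ultimately have 1: "\<bar>q - s\<bar> < d" using c by auto
      have "\<bar>y q - M\<bar> < d"
        using upper[of q] q qp' p(4) eta(4) e0t(2)[OF e(2)] d by linarith
      with 1 show "\<bar>real m * h - s\<bar> < d" "\<bar>y (real m * h) - M\<bar> < d"
        by (simp_all add: q_def)
    qed
  qed
qed

section \<open>Iterated limits\<close>

definition iter_seq :: "(nat \<times> nat) filter" where
  "iter_seq = Abs_filter (\<lambda>P. \<forall>\<^sub>F n in sequentially. \<forall>\<^sub>F m in sequentially. P (n, m))"

lemma eventually_iter_seq:
  "eventually P iter_seq \<longleftrightarrow> (\<forall>\<^sub>F n in sequentially. \<forall>\<^sub>F m in sequentially. P (n, m))"
  unfolding iter_seq_def
proof (rule eventually_Abs_filter, rule is_filter.intro)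
  show "\<forall>\<^sub>F n in sequentially. \<forall>\<^sub>F m in sequentially. P (n, m) \<and> Q (n, m)"
    if "\<forall>\<^sub>F n in sequentially. \<forall>\<^sub>F m in sequentially. P (n, m)"
      "\<forall>\<^sub>F n in sequentially. \<forall>\<^sub>F m in sequentially. Q (n, m)" for P Q :: "nat \<times> nat \<Rightarrow> bool"
    using that by eventually_elim (rule eventually_conj)
  show "\<forall>\<^sub>F n in sequentially. \<forall>\<^sub>F m in sequentially. Q (n, m)"
    if "\<forall>x. P x \<longrightarrow> Q x" "\<forall>\<^sub>F n in sequentially. \<forall>\<^sub>F m in sequentially. P (n, m)" for P Q :: "nat \<times> nat \<Rightarrow> bool"
    using that(2) by eventually_elim (use that(1) in \<open>auto elim: eventually_mono\<close>)
qed simp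

lemma iter_seq_neq_bot [simp]: "iter_seq \<noteq> bot"
  by (simp add: trivial_limit_def eventually_iter_seq)

lemma (in prob_space) iterated_dominated_convergence:
  fixes Z :: "nat \<Rightarrow> nat \<Rightarrow> 'a \<Rightarrow> real"
  assumes [measurable]: "\<And>n m. Z n m \<in> borel_measurable M" "Y \<in> borel_measurable M"
    and bd: "\<And>n m. AE \<omega> in M. \<bar>Z n m \<omega>\<bar> \<le> 1" "AE \<omega> in M. \<bar>Y \<omega>\<bar> \<le> 1"
    and lim: "AE \<omega> in M. \<forall>e>0. \<forall>\<^sub>F n in sequentially. \<forall>\<^sub>F m in sequentially. \<bar>Z n m \<omega> - Y \<omega>\<bar> < e"
  shows "((\<lambda>p. expectation (Z (fst p) (snd p))) \<longlongrightarrow> expectation Y) iter_seq"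
proof (rule tendstoI)
  fix eta :: real assume "0 < eta"
  define e where "e = eta / 3"
  have e: "0 < e" using \<open>0 < eta\<close> by (simp add: e_def)
  define C where "C n K = {\<omega> \<in> space M. \<exists>m\<ge>K. e \<le> \<bar>Z n m \<omega> - Y \<omega>\<bar>}" for n K
  have C[measurable]: "C n K \<in> sets M" for n K unfolding C_def by measurable
  define A where "A n = (\<Inter>K. C n K)" for n
  have A[measurable]: "A n \<in> sets M" for n unfolding A_def by measurable
  have "(\<lambda>n. expectation (indicator (A n) :: 'a \<Rightarrow> real)) \<longlonglongrightarrow> expectation (\<lambda>_. 0)"
  proof (rule integral_dominated_convergence[where w="\<lambda>_. 1"])
    show "AE \<omega> in M. (\<lambda>n. indicator (A n) \<omega> :: real) \<longlonglongrightarrow> 0"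
      using lim
    proof eventually_elim
      case (elim \<omega>)
      from elim[rule_format, OF e] have "\<forall>\<^sub>F n in sequentially. indicator (A n) \<omega> = (0::real)"
      proof eventually_elim
        case (elim n)
        then obtain K where "\<And>m. K \<le> m \<Longrightarrow> \<bar>Z n m \<omega> - Y \<omega>\<bar> < e"
          by (auto simp: eventually_sequentially)
        then have "\<omega> \<notin> C n K" by (force simp: C_def)
        then show ?case by (auto simp: A_def indicator_def)
      qed
      then show ?case by (rule tendsto_eventually)
    qed
  qed auto
  then have "(\<lambda>n. prob (A n)) \<longlonglongrightarrow> 0" by simp
  then have "\<forall>\<^sub>F n in sequentially. prob (A n) < e"
    using e by (rule order_tendstoD)
  then show "\<forall>\<^sub>F p in iter_seq. dist (expectation (Z (fst p) (snd p))) (expectation Y) < eta"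
    unfolding eventually_iter_seq
  proof eventually_elim
    case (elim n)
    have "(\<lambda>K. prob (C n K)) \<longlonglongrightarrow> prob (A n)"
      unfolding A_def
    proof (rule finite_Lim_measure_decseq)
      show "decseq (C n)"
        unfolding C_def by (rule antimonoI) (auto intro: order_trans)
    qed auto
    then have "\<forall>\<^sub>F K in sequentially. prob (C n K) < e"
      using elim by (rule order_tendstoD)
    then show ?case
    proof eventually_elim
      case (elim m)
      have int: "integrable M (Z n m)" "integrable M Y"
        by (rule integrable_const_bound[where B=1]; simp add: bd)+
      have int2: "integrable M (\<lambda>\<omega>. 2 * indicator (C n m) \<omega> :: real)"
        by (intro integrable_mult_right integrable_real_indicator C) (simp add: emeasure_eq_measure)
      have le: "AE \<omega> in M. \<bar>Z n m \<omega> - Y \<omega>\<bar> \<le> e + 2 * indicator (C n m) \<omega>"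
        using bd(1)[of n m] bd(2) AE_space
      proof eventually_elim
        case (elim \<omega>)
        show ?case
        proof (cases "\<omega> \<in> C n m")
          case True
          then show ?thesis using elim e by simp
        next
          case False
          then show ?thesis using elim by (force simp: C_def)
        qed
      qed
      have "\<bar>expectation (Z n m) - expectation Y\<bar> = \<bar>expectation (\<lambda>\<omega>. Z n m \<omega> - Y \<omega>)\<bar>"
        using int by simp
      also have "\<dots> \<le> expectation (\<lambda>\<omega>. \<bar>Z n m \<omega> - Y \<omega>\<bar>)"
        by (rule integral_abs_bound)
      also have "\<dots> \<le> expectation (\<lambda>\<omega>. e + 2 * indicator (C n m) \<omega>)"
        using int int2 le by (intro integral_mono_AE) auto
      also have "\<dots> = e + 2 * prob (C n m)"
        by (subst Bochner_Integration.integral_add) (use int2 in \<open>auto simp: prob_space\<close>)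
      also have "\<dots> < eta" using elim by (simp add: e_def)
      finally show ?case by (simp add: dist_real_def)
    qed
  qed
qed

section \<open>Measurability of path functionals\<close>

lemma rounding_right: "filterlim (\<lambda>n. (real (nat \<lfloor>t * real (Suc n)\<rfloor>) + 1) / real (Suc n)) (at_right t) sequentially"
  if "0 \<le> t" for t :: real
proof -
  have b: "t < (real (nat \<lfloor>t * real (Suc n)\<rfloor>) + 1) / real (Suc n)"
      "(real (nat \<lfloor>t * real (Suc n)\<rfloor>) + 1) / real (Suc n) \<le> t + 1 / real (Suc n)" for n
  proof -
    define N where "N = real (Suc n)"
    have N: "0 < N" by (simp add: N_def)
    define k where "k = real (nat \<lfloor>t * N\<rfloor>)"
    have "0 \<le> t * N" using that N by simp
    then have "t * N < k + 1" "k \<le> t * N"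
      by (simp_all add: k_def)
    then show "t < (real (nat \<lfloor>t * real (Suc n)\<rfloor>) + 1) / real (Suc n)"
      "(real (nat \<lfloor>t * real (Suc n)\<rfloor>) + 1) / real (Suc n) \<le> t + 1 / real (Suc n)"
      unfolding N_def[symmetric] k_def[symmetric] using N by (simp_all add: field_simps)
  qed
  have "(\<lambda>n. (real (nat \<lfloor>t * real (Suc n)\<rfloor>) + 1) / real (Suc n)) \<longlonglongrightarrow> t"
  proof (rule tendsto_sandwich[OF always_eventually always_eventually tendsto_const])
    show "(\<lambda>n. t + 1 / real (Suc n)) \<longlonglongrightarrow> t"
      using tendsto_add[OF tendsto_const LIMSEQ_Suc[OF lim_inverse_n'], of t] by simp
  qed (intro allI b less_imp_le)+
  then show ?thesis
    using b(1) by (intro tendsto_imp_filterlim_at_right) auto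
qed

lemma rounding_left: "filterlim (\<lambda>n. real (nat (\<lceil>t * real (Suc n)\<rceil> - 1)) / real (Suc n)) (at_left t) sequentially"
  if "0 < t" for t :: real
proof -
  have b: "real (nat (\<lceil>t * real (Suc n)\<rceil> - 1)) / real (Suc n) < t"
      "t - 1 / real (Suc n) \<le> real (nat (\<lceil>t * real (Suc n)\<rceil> - 1)) / real (Suc n)" for n
  proof -
    define N where "N = real (Suc n)"
    have N: "0 < N" by (simp add: N_def)
    define k where "k = real (nat (\<lceil>t * N\<rceil> - 1))"
    have "0 < t * N" using that N by simp
    then have "1 \<le> \<lceil>t * N\<rceil>" by linarith
    then have "k = real_of_int \<lceil>t * N\<rceil> - 1" by (simp add: k_def)
    then have "k < t * N" "t * N - 1 \<le> k" by linarith+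
    then show "real (nat (\<lceil>t * real (Suc n)\<rceil> - 1)) / real (Suc n) < t"
      "t - 1 / real (Suc n) \<le> real (nat (\<lceil>t * real (Suc n)\<rceil> - 1)) / real (Suc n)"
      unfolding N_def[symmetric] k_def[symmetric]
      using N divide_right_mono[of "t * N - 1" k N] by (simp_all add: diff_divide_distrib pos_divide_less_eq)
  qed
  have "(\<lambda>n. real (nat (\<lceil>t * real (Suc n)\<rceil> - 1)) / real (Suc n)) \<longlonglongrightarrow> t"
  proof (rule tendsto_sandwich[OF always_eventually always_eventually _ tendsto_const])
    show "(\<lambda>n. t - 1 / real (Suc n)) \<longlonglongrightarrow> t"
      using tendsto_diff[OF tendsto_const LIMSEQ_Suc[OF lim_inverse_n'], of t] by simp
  qed (intro allI b less_imp_le)+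
  then show ?thesis
    using b(1) by (intro tendsto_imp_filterlim_at_left) auto
qed

lemma pred_Bex_countable:
  "(\<And>i. i \<in> I \<Longrightarrow> Measurable.pred M (P i)) \<Longrightarrow> countable I \<Longrightarrow> Measurable.pred M (\<lambda>x. \<exists>i\<in>I. P i x)"
  unfolding pred_def by (rule sets.sets_Collect_countable_Ex')

lemma measurable_at_random_time:
  fixes Y :: "real \<Rightarrow> 'w \<Rightarrow> real"
  assumes Y[measurable]: "\<And>t. 0 \<le> t \<Longrightarrow> Y t \<in> borel_measurable N"
    and r: "\<And>t \<omega>. \<omega> \<in> space N \<Longrightarrow> 0 \<le> t \<Longrightarrow> ((\<lambda>s. Y s \<omega>) \<longlongrightarrow> Y t \<omega>) (at_right t)"
    and T[measurable]: "T \<in> borel_measurable N" and T0: "\<And>\<omega>. \<omega> \<in> space N \<Longrightarrow> 0 \<le> T \<omega>"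
  shows "(\<lambda>\<omega>. Y (T \<omega>) \<omega>) \<in> borel_measurable N"
proof (rule borel_measurable_LIMSEQ_real)
  show "(\<lambda>\<omega>. Y ((real (nat \<lfloor>T \<omega> * real (Suc n)\<rfloor>) + 1) / real (Suc n)) \<omega>) \<in> borel_measurable N" for n
    by (rule measurable_compose_countable[where f="\<lambda>i \<omega>. Y ((real i + 1) / real (Suc n)) \<omega>"]) measurable
  show "(\<lambda>n. Y ((real (nat \<lfloor>T \<omega> * real (Suc n)\<rfloor>) + 1) / real (Suc n)) \<omega>) \<longlonglongrightarrow> Y (T \<omega>) \<omega>"
    if "\<omega> \<in> space N" for \<omega>
    using filterlim_compose[OF r[OF that T0[OF that]] rounding_right[OF T0[OF that]]] .
qed

lemma wsup_greater_iff:
  assumes x: "cadlag x" and "0 \<le> a" "a \<le> b"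
  shows "c < wsup x a b \<longleftrightarrow> c < x b \<or> (\<exists>q\<in>\<rat>. a \<le> q \<and> q < b \<and> c < x q)"
proof
  assume "c < wsup x a b"
  then obtain s where s: "a \<le> s" "s \<le> b" "c < x s"
    using assms less_cSUP_iff[OF _ cadlag_bdd[OF x], of a b c] by (auto simp: wsup_def)
  show "c < x b \<or> (\<exists>q\<in>\<rat>. a \<le> q \<and> q < b \<and> c < x q)"
  proof (cases "s = b")
    case False
    have "\<forall>\<^sub>F u in at_right s. c < x u"
      using order_tendstoD(1)[OF cadlag_right[OF x, of s] s(3)] s assms by auto
    then obtain d where d: "s < d" "\<And>u. s < u \<Longrightarrow> u < d \<Longrightarrow> c < x u"
      by (auto simp: eventually_at_right_field)
    obtain q where "q \<in> \<rat>" "s < q" "q < min d b"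
      using Rats_dense_in_real[of s "min d b"] d s False by auto
    then show ?thesis using d s by (intro disjI2 bexI[of _ q]) auto
  qed (use s in auto)
next
  assume "c < x b \<or> (\<exists>q\<in>\<rat>. a \<le> q \<and> q < b \<and> c < x q)"
  then show "c < wsup x a b"
    using wsup_upper[OF x assms(2)] assms by (meson less_imp_le less_le_trans order_refl)
qed

lemma (in path) Inf_amax_less_iff:
  assumes t: "0 \<le> t"
  shows "Inf (amax x t) < s \<longleftrightarrow> t < s \<or> (\<exists>q\<in>\<rat>. 0 \<le> q \<and> q < s \<and> q \<le> t \<and> wsup x 0 q = wsup x 0 t)"
proof -
  let ?s = "Inf (amax x t)"
  note s = Inf_amax[OF t]
  show ?thesis
  proof
    assume less: "?s < s"
    show "t < s \<or> (\<exists>q\<in>\<rat>. 0 \<le> q \<and> q < s \<and> q \<le> t \<and> wsup x 0 q = wsup x 0 t)"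
    proof (cases "t < s")
      case False
      obtain q where q: "q \<in> \<rat>" "?s < q" "q < s"
        using Rats_dense_in_real[OF less] by auto
      have "?s \<in> amax x q"
        using amax_restrict[OF s q(2)] q False s by auto
      then have "wsup x 0 q = max (x ?s) (lv x ?s)" by (simp add: amax_def)
      then have "wsup x 0 q = wsup x 0 t" using s by (simp add: amax_def)
      then show ?thesis
        using q amaxD(1)[OF s] False by (intro disjI2 bexI[of _ q]) auto
    qed simp
  next
    assume "t < s \<or> (\<exists>q\<in>\<rat>. 0 \<le> q \<and> q < s \<and> q \<le> t \<and> wsup x 0 q = wsup x 0 t)"
    then show "?s < s"
    proof (elim disjE bexE conjE)
      fix q assume "0 \<le> q" "q < s" "wsup x 0 q = wsup x 0 t"
      then show ?thesis using wsup_init_less[of q t] t by (cases "q < ?s") auto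
    qed (use amaxD(2)[OF s] in simp)
  qed
qed

lemma (in path) less_Sup_amax_iff:
  assumes t: "0 \<le> t"
  shows "s < Sup (amax x t) \<longleftrightarrow> s < 0 \<or> (\<exists>q\<in>\<rat>. 0 \<le> q \<and> s < q \<and> q \<le> t \<and> wsup x q t = wsup x 0 t)"
proof -
  let ?s = "Sup (amax x t)"
  note st = Sup_amax[OF t]
  show ?thesis
  proof
    assume less: "s < ?s"
    show "s < 0 \<or> (\<exists>q\<in>\<rat>. 0 \<le> q \<and> s < q \<and> q \<le> t \<and> wsup x q t = wsup x 0 t)"
    proof (cases "s < 0")
      case False
      obtain q where q: "q \<in> \<rat>" "s < q" "q < ?s"
        using Rats_dense_in_real[OF less] by auto
      have "wsup x 0 t \<le> wsup x q t"
        using amaxD[OF st] wsup_upper[OF x, of q ?s t] wsup_upper_left[OF x, of q ?s t] q False by auto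
      moreover have "wsup x q t \<le> wsup x 0 t"
        using q False amaxD(2)[OF st] by (intro wsup_mono[OF x]) auto
      ultimately show ?thesis
        using q amaxD[OF st] False by (intro disjI2 bexI[of _ q]) auto
    qed simp
  next
    assume "s < 0 \<or> (\<exists>q\<in>\<rat>. 0 \<le> q \<and> s < q \<and> q \<le> t \<and> wsup x q t = wsup x 0 t)"
    then show "s < ?s"
    proof (elim disjE bexE conjE)
      fix q assume "s < q" "q \<le> t" "wsup x q t = wsup x 0 t"
      then show ?thesis using wsup_tail_less[of t q] t by (cases "?s < q") auto
    qed (use amaxD(1)[OF st] in simp)
  qed
qed

locale measurable_path =
  fixes N :: "'w measure" and X :: "real \<Rightarrow> 'w \<Rightarrow> real"
  assumes X_meas[measurable]: "\<And>t. 0 \<le> t \<Longrightarrow> X t \<in> borel_measurable N"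
    and X_cadlag: "\<And>\<omega>. \<omega> \<in> space N \<Longrightarrow> cadlag (\<lambda>t. X t \<omega>)"
    and X_0: "\<And>\<omega>. \<omega> \<in> space N \<Longrightarrow> X 0 \<omega> = 0"
begin

lemma path: "\<omega> \<in> space N \<Longrightarrow> path (\<lambda>t. X t \<omega>)"
  using X_cadlag X_0 by unfold_locales auto

context
  fixes T :: "'w \<Rightarrow> real"
  assumes T[measurable]: "T \<in> borel_measurable N" and T0: "\<And>\<omega>. \<omega> \<in> space N \<Longrightarrow> 0 \<le> T \<omega>"
begin

lemma X_random_time [measurable]: "(\<lambda>\<omega>. X (T \<omega>) \<omega>) \<in> borel_measurable N"
  by (rule measurable_at_random_time[OF X_meas _ T T0]) (auto intro: cadlag_right X_cadlag)

lemma wsup_random_time: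
  assumes "0 \<le> r"
  shows "(\<lambda>\<omega>. if r \<le> T \<omega> then wsup (\<lambda>t. X t \<omega>) r (T \<omega>) else 0) \<in> borel_measurable N"
proof (subst borel_measurable_iff_greater, intro allI)
  fix c :: real
  have q: "(\<lambda>\<omega>. X q \<omega>) \<in> borel_measurable N" if "q \<in> \<rat> \<inter> {r..}" for q
    using that assms by (intro X_meas) auto
  have [measurable]: "Measurable.pred N (\<lambda>\<omega>. \<exists>q\<in>\<rat> \<inter> {r..}. q < T \<omega> \<and> c < X q \<omega>)"
  proof (rule pred_Bex_countable)
    fix q assume "q \<in> \<rat> \<inter> {r..}"
    from q[OF this, measurable] show "Measurable.pred N (\<lambda>\<omega>. q < T \<omega> \<and> c < X q \<omega>)"
      by measurable
  qed (simp add: countable_rat)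
  have "{\<omega> \<in> space N. c < (if r \<le> T \<omega> then wsup (\<lambda>t. X t \<omega>) r (T \<omega>) else 0)}
    = {\<omega> \<in> space N. if r \<le> T \<omega> then c < X (T \<omega>) \<omega> \<or> (\<exists>q\<in>\<rat> \<inter> {r..}. q < T \<omega> \<and> c < X q \<omega>) else c < 0}"
    using wsup_greater_iff[OF X_cadlag assms] by (intro Collect_cong conj_cong) (auto split: if_splits)
  also have "\<dots> \<in> sets N" by measurable
  finally show "{\<omega> \<in> space N. c < (if r \<le> T \<omega> then wsup (\<lambda>t. X t \<omega>) r (T \<omega>) else 0)} \<in> sets N" .
qed

lemma wsup_0_random_time [measurable]: "(\<lambda>\<omega>. wsup (\<lambda>t. X t \<omega>) 0 (T \<omega>)) \<in> borel_measurable N"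
  using wsup_random_time[of 0] T0 by (simp cong: measurable_cong)

end

lemma wsup_0_fixed_time [measurable]: "0 \<le> r \<Longrightarrow> (\<lambda>\<omega>. wsup (\<lambda>t. X t \<omega>) 0 r) \<in> borel_measurable N"
  using wsup_0_random_time[of "\<lambda>_. r"] by simp

context
  fixes T :: "'w \<Rightarrow> real"
  assumes T[measurable]: "T \<in> borel_measurable N" and T0: "\<And>\<omega>. \<omega> \<in> space N \<Longrightarrow> 0 \<le> T \<omega>"
begin

lemma Inf_amax_random_time: "(\<lambda>\<omega>. Inf (amax (\<lambda>t. X t \<omega>) (T \<omega>))) \<in> borel_measurable N"
proof (subst borel_measurable_iff_less, intro allI)
  fix s :: real
  have [measurable]: "Measurable.pred N (\<lambda>\<omega>. \<exists>q\<in>\<rat> \<inter> {0..}. q < s \<and> q \<le> T \<omega> \<and> wsup (\<lambda>t. X t \<omega>) 0 q = wsup (\<lambda>t. X t \<omega>) 0 (T \<omega>))"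
  proof (rule pred_Bex_countable)
    fix q assume "q \<in> \<rat> \<inter> {0::real..}"
    then have [measurable]: "(\<lambda>\<omega>. wsup (\<lambda>t. X t \<omega>) 0 q) \<in> borel_measurable N"
      by (intro wsup_0_fixed_time) auto
    have [measurable]: "(\<lambda>\<omega>. wsup (\<lambda>t. X t \<omega>) 0 (T \<omega>)) \<in> borel_measurable N"
      by (rule wsup_0_random_time[OF T T0])
    show "Measurable.pred N (\<lambda>\<omega>. q < s \<and> q \<le> T \<omega> \<and> wsup (\<lambda>t. X t \<omega>) 0 q = wsup (\<lambda>t. X t \<omega>) 0 (T \<omega>))"
      by measurable
  qed (simp add: countable_rat)
  have "{\<omega> \<in> space N. Inf (amax (\<lambda>t. X t \<omega>) (T \<omega>)) < s}
    = {\<omega> \<in> space N. T \<omega> < s \<or> (\<exists>q\<in>\<rat> \<inter> {0..}. q < s \<and> q \<le> T \<omega> \<and> wsup (\<lambda>t. X t \<omega>) 0 q = wsup (\<lambda>t. X t \<omega>) 0 (T \<omega>))}"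
    using path.Inf_amax_less_iff[OF path T0] by (intro Collect_cong conj_cong) auto
  also have "\<dots> \<in> sets N" by measurable
  finally show "{\<omega> \<in> space N. Inf (amax (\<lambda>t. X t \<omega>) (T \<omega>)) < s} \<in> sets N" .
qed

lemma Sup_amax_random_time: "(\<lambda>\<omega>. Sup (amax (\<lambda>t. X t \<omega>) (T \<omega>))) \<in> borel_measurable N"
proof (subst borel_measurable_iff_greater, intro allI)
  fix s :: real
  have [measurable]: "Measurable.pred N (\<lambda>\<omega>. \<exists>q\<in>\<rat> \<inter> {0..}. s < q \<and> q \<le> T \<omega> \<and>
      (if q \<le> T \<omega> then wsup (\<lambda>t. X t \<omega>) q (T \<omega>) else 0) = wsup (\<lambda>t. X t \<omega>) 0 (T \<omega>))"
  proof (rule pred_Bex_countable)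
    fix q assume "q \<in> \<rat> \<inter> {0::real..}"
    then have [measurable]: "(\<lambda>\<omega>. if q \<le> T \<omega> then wsup (\<lambda>t. X t \<omega>) q (T \<omega>) else 0) \<in> borel_measurable N"
      by (intro wsup_random_time[OF T T0]) auto
    have [measurable]: "(\<lambda>\<omega>. wsup (\<lambda>t. X t \<omega>) 0 (T \<omega>)) \<in> borel_measurable N"
      by (rule wsup_0_random_time[OF T T0])
    show "Measurable.pred N (\<lambda>\<omega>. s < q \<and> q \<le> T \<omega> \<and>
      (if q \<le> T \<omega> then wsup (\<lambda>t. X t \<omega>) q (T \<omega>) else 0) = wsup (\<lambda>t. X t \<omega>) 0 (T \<omega>))"
      by measurable
  qed (simp add: countable_rat)
  have "{\<omega> \<in> space N. s < Sup (amax (\<lambda>t. X t \<omega>) (T \<omega>))}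
    = {\<omega> \<in> space N. s < 0 \<or> (\<exists>q\<in>\<rat> \<inter> {0..}. s < q \<and> q \<le> T \<omega> \<and>
      (if q \<le> T \<omega> then wsup (\<lambda>t. X t \<omega>) q (T \<omega>) else 0) = wsup (\<lambda>t. X t \<omega>) 0 (T \<omega>))}"
    using path.less_Sup_amax_iff[OF path T0] by (intro Collect_cong conj_cong) (auto split: if_splits)
  also have "\<dots> \<in> sets N" by measurable
  finally show "{\<omega> \<in> space N. s < Sup (amax (\<lambda>t. X t \<omega>) (T \<omega>))} \<in> sets N" .
qed

end

end

section \<open>Independent random times\<close>

lemma (in prob_space) prob_random_index_le:
  fixes I :: "'a \<Rightarrow> nat"
  assumes indep: "indep_set A B"
    and I: "\<And>i. {\<omega> \<in> space M. I \<omega> = i} \<in> A"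
    and E: "\<And>i. E i \<in> B" "\<And>i. prob (E i) \<le> p"
  shows "{\<omega> \<in> space M. \<omega> \<in> E (I \<omega>)} \<in> events" "prob {\<omega> \<in> space M. \<omega> \<in> E (I \<omega>)} \<le> p"
proof -
  define F where "F i = {\<omega> \<in> space M. I \<omega> = i} \<inter> E i" for i
  have AB: "A \<subseteq> events" "B \<subseteq> events"
    using indep by (auto simp: indep_set_def indep_sets_def split: bool.splits)
  have F: "F i \<in> events" for i
    unfolding F_def using I E(1) AB by (intro sets.Int) (auto dest: subsetD)
  have eq: "{\<omega> \<in> space M. \<omega> \<in> E (I \<omega>)} = (\<Union>i. F i)"
    by (auto simp: F_def)
  show "{\<omega> \<in> space M. \<omega> \<in> E (I \<omega>)} \<in> events"
    unfolding eq using F by auto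
  have s1: "(\<lambda>i. prob (F i)) sums prob (\<Union>i. F i)"
    by (rule finite_measure_UNION) (use F in \<open>auto simp: disjoint_family_on_def F_def\<close>)
  have "(\<lambda>i. prob {\<omega> \<in> space M. I \<omega> = i}) sums prob (\<Union>i. {\<omega> \<in> space M. I \<omega> = i})"
    by (rule finite_measure_UNION) (use I AB in \<open>auto simp: disjoint_family_on_def\<close>)
  also have "(\<Union>i. {\<omega> \<in> space M. I \<omega> = i}) = space M" by auto
  finally have s2: "(\<lambda>i. p * prob {\<omega> \<in> space M. I \<omega> = i}) sums (p * 1)"
    by (intro sums_mult) (simp add: prob_space)
  have "prob (F i) \<le> p * prob {\<omega> \<in> space M. I \<omega> = i}" for i
    unfolding F_def indep_setD[OF indep I E(1)]
    using E(2)[of i] by (subst mult.commute) (rule mult_right_mono, auto)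
  then show "prob {\<omega> \<in> space M. \<omega> \<in> E (I \<omega>)} \<le> p"
    using sums_le[OF _ s1 s2] by (simp add: eq)
qed

lemma (in prob_space) no_jump_at_independent_time:
  assumes indep: "indep_set (sets VA) (sets VB)" and sp: "space VA = space M" "space VB = space M"
    and T: "T \<in> borel_measurable VA"
    and D: "\<And>s t. 0 \<le> s \<Longrightarrow> s < t \<Longrightarrow> D s t \<in> sets VB"
    and g: "g \<longlonglongrightarrow> (0::real)" "\<And>s n. 0 \<le> s \<Longrightarrow> prob (D s (s + 2 / real (Suc n))) \<le> g n"
  defines "I n \<omega> \<equiv> nat \<lfloor>T \<omega> * real (Suc n)\<rfloor>"
  shows "AE \<omega> in M. \<not> (\<forall>\<^sub>F n in sequentially. 1 \<le> I n \<omega> \<and>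
    \<omega> \<in> D ((real (I n \<omega>) - 1) / real (Suc n)) ((real (I n \<omega>) - 1) / real (Suc n) + 2 / real (Suc n)))"
proof -
  define E where "E n i = (if 1 \<le> i then D ((real i - 1) / real (Suc n)) ((real i - 1) / real (Suc n) + 2 / real (Suc n)) else {})" for n and i :: nat
  define F where "F n = {\<omega> \<in> space M. \<omega> \<in> E n (I n \<omega>)}" for n
  have I: "{\<omega> \<in> space M. I n \<omega> = i} \<in> sets VA" for n i
  proof -
    have "I n \<in> measurable VA (count_space UNIV)"
      unfolding I_def using T by measurable
    then show ?thesis
      using measurable_sets[of "I n" VA "count_space UNIV" "{i}"] sp
      by (simp add: vimage_def Int_def conj_commute)
  qed
  have gn: "0 \<le> g n" for n
    by (rule order_trans[OF measure_nonneg g(2)[of 0 n]]) simp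
  have E: "E n i \<in> sets VB" "prob (E n i) \<le> g n" for n i
  proof -
    have "0 \<le> (real i - 1) / real (Suc n)" if "1 \<le> i"
      using that by simp
    moreover have "s < s + 2 / real (Suc n)" for s :: real by simp
    ultimately show "E n i \<in> sets VB" "prob (E n i) \<le> g n"
      using D g(2) gn by (simp_all add: E_def del: of_nat_Suc)
  qed
  have F: "F n \<in> events" "prob (F n) \<le> g n" for n
    unfolding F_def using prob_random_index_le[OF indep I E] by auto
  have null: "(\<Inter>n\<in>{K..}. F n) \<in> null_sets M" for K
  proof (rule null_setsI)
    have "prob (\<Inter>n\<in>{K..}. F n) \<le> g n" if "K \<le> n" for n
      using finite_measure_mono[of "\<Inter>n\<in>{K..}. F n" "F n"] F[of n] that by (auto intro: order_trans)
    then have "prob (\<Inter>n\<in>{K..}. F n) \<le> 0"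
      by (intro tendsto_lowerbound[OF g(1)]) (auto simp: eventually_sequentially)
    then show "emeasure M (\<Inter>n\<in>{K..}. F n) = 0"
      by (simp add: emeasure_eq_measure measure_le_0_iff)
  qed (use F in auto)
  have "(\<Union>K. \<Inter>n\<in>{K..}. F n) \<in> null_sets M"
    using null by auto
  then show ?thesis
  proof (rule AE_I', intro subsetI, elim CollectE conjE, unfold not_not)
    fix \<omega> assume \<omega>: "\<omega> \<in> space M" and ev: "\<forall>\<^sub>F n in sequentially. 1 \<le> I n \<omega> \<and>
      \<omega> \<in> D ((real (I n \<omega>) - 1) / real (Suc n)) ((real (I n \<omega>) - 1) / real (Suc n) + 2 / real (Suc n))"
    then obtain K where "\<And>n. K \<le> n \<Longrightarrow> 1 \<le> I n \<omega> \<and>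
      \<omega> \<in> D ((real (I n \<omega>) - 1) / real (Suc n)) ((real (I n \<omega>) - 1) / real (Suc n) + 2 / real (Suc n))"
      unfolding eventually_sequentially by blast
    then have "\<omega> \<in> F n" if "K \<le> n" for n
      using that \<omega> by (simp add: F_def E_def)
    then show "\<omega> \<in> (\<Union>K. \<Inter>n\<in>{K..}. F n)" by blast
  qed
qed

lemma rounding_window:
  fixes t d :: real
  assumes t: "0 < t" and d: "0 < d"
  defines "I n \<equiv> nat \<lfloor>t * real (Suc n)\<rfloor>"
  shows "\<forall>\<^sub>F n in sequentially. 1 \<le> I n \<and>
    (real (I n) - 1) / real (Suc n) \<in> {t - d<..<t} \<and>
    (real (I n) - 1) / real (Suc n) + 2 / real (Suc n) \<in> {t<..<t + d}"
proof -
  have "filterlim (\<lambda>n. real (Suc n)) at_top sequentially"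
    by (intro filterlim_compose[OF filterlim_real_sequentially] filterlim_Suc)
  then have "\<forall>\<^sub>F n in sequentially. max (2 / d) (1 / t) < real (Suc n)"
    by (simp only: filterlim_at_top_dense)
  then show ?thesis
  proof eventually_elim
    case (elim n)
    define N where "N = real (Suc n)"
    have N: "0 < N" "2 / d < N" "1 / t < N"
      using elim by (auto simp: N_def)
    then have dN: "2 < d * N" "1 < t * N"
      using t d by (simp_all add: field_simps)
    define k where "k = real (I n)"
    have k: "k \<le> t * N" "t * N < k + 1" "1 \<le> I n"
      using dN(2) unfolding k_def I_def N_def[symmetric] by (simp_all add: le_nat_iff)
    have "(t - d) * N < k - 1" "k - 1 < t * N" "t * N < k + 1" "k + 1 < (t + d) * N"
      using k dN by (simp_all add: algebra_simps)
    then have "t - d < (k - 1) / N" "(k - 1) / N < t" "t < (k + 1) / N" "(k + 1) / N < t + d"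
      using N(1) by (simp_all only: pos_less_divide_eq pos_divide_less_eq)
    moreover have "(k - 1) / N + 2 / N = (k + 1) / N"
      by (simp add: add_divide_distrib[symmetric])
    ultimately show ?case
      using k(3) unfolding N_def k_def by simp
  qed
qed

section \<open>Phase paths\<close>

lemma jump_path_right:
  "jump_path j \<Longrightarrow> 0 \<le> t \<Longrightarrow> \<exists>d>0. \<forall>s. t \<le> s \<longrightarrow> s < t + d \<longrightarrow> j s = j t"
proof -
  assume "jump_path j" "0 \<le> t"
  then have "eventually (\<lambda>s. j s = j t) (at_right t)" by (simp add: jump_path_def)
  then obtain b where "t < b" "\<And>s. t < s \<Longrightarrow> s < b \<Longrightarrow> j s = j t"
    by (auto simp: eventually_at_right_field)
  then show ?thesis
    using order_le_less by (intro exI[of _ "b - t"] conjI allI impI) (simp, fastforce)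
qed

lemma jump_path_left:
  "jump_path j \<Longrightarrow> 0 < t \<Longrightarrow> \<exists>i. \<exists>d>0. \<forall>s. t - d < s \<longrightarrow> s < t \<longrightarrow> j s = i"
proof -
  assume "jump_path j" "0 < t"
  then obtain i where "eventually (\<lambda>s. j s = i) (at_left t)" by (auto simp: jump_path_def)
  then obtain b where "b < t" "\<And>s. b < s \<Longrightarrow> s < t \<Longrightarrow> j s = i"
    by (auto simp: eventually_at_left_field)
  then show ?thesis
    by (intro exI[of _ i] exI[of _ "t - b"]) auto
qed

lemma left_phase_eq:
  assumes "0 < t" "0 < d" "\<And>s. t - d < s \<Longrightarrow> s < t \<Longrightarrow> J s \<omega> = i"
  shows "left_phase J t \<omega> = i"
proof -
  have "t - d < t" using assms(2) by simp
  then have "\<forall>\<^sub>F s in at_left t. s \<in> {t - d<..<t}"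
    by (rule eventually_at_left_real)
  then have ev: "\<forall>\<^sub>F s in at_left t. J s \<omega> = i"
    by eventually_elim (rule assms(3), auto)
  have "(THE i. \<forall>\<^sub>F s in at_left t. J s \<omega> = i) = i"
  proof (rule the_equality)
    show "\<forall>\<^sub>F s in at_left t. J s \<omega> = i" by (rule ev)
    fix i' assume "\<forall>\<^sub>F s in at_left t. J s \<omega> = i'"
    with ev have "\<forall>\<^sub>F s in at_left t. i' = i"
      by eventually_elim simp
    then show "i' = i" by simp
  qed
  then show ?thesis using assms(1) by (simp only: left_phase_def not_le[symmetric] if_False)
qed

locale measurable_phase =
  fixes N :: "'w measure" and J :: "real \<Rightarrow> 'w \<Rightarrow> 'n::finite option"
  assumes J_meas[measurable]: "\<And>t. 0 \<le> t \<Longrightarrow> J t \<in> measurable N (count_space UNIV)"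
    and J_path: "\<And>\<omega>. \<omega> \<in> space N \<Longrightarrow> jump_path (\<lambda>t. J t \<omega>)"
begin

lemma ex_None_iff:
  assumes "\<omega> \<in> space N"
  shows "(\<exists>t\<ge>0. t < s \<and> J t \<omega> = None) \<longleftrightarrow> (\<exists>q\<in>\<rat> \<inter> {0..}. q < s \<and> J q \<omega> = None)"
proof
  assume "\<exists>t\<ge>0. t < s \<and> J t \<omega> = None"
  then obtain t where t: "0 \<le> t" "t < s" "J t \<omega> = None" by auto
  obtain d where d: "0 < d" "\<And>u. t \<le> u \<Longrightarrow> u < t + d \<Longrightarrow> J u \<omega> = J t \<omega>"
    using jump_path_right[OF J_path[OF assms] t(1)] by auto
  obtain q where "q \<in> \<rat>" "t < q" "q < min s (t + d)"
    using Rats_dense_in_real[of t "min s (t + d)"] d t by auto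
  then show "\<exists>q\<in>\<rat> \<inter> {0..}. q < s \<and> J q \<omega> = None"
    using d(2)[of q] t by (intro bexI[of _ q]) auto
next
  assume "\<exists>q\<in>\<rat> \<inter> {0..}. q < s \<and> J q \<omega> = None"
  then show "\<exists>t\<ge>0. t < s \<and> J t \<omega> = None" by (simp add: Bex_def) blast
qed

lemma lifetime_nonneg: "0 \<le> lifetime J \<omega>"
proof (cases "\<exists>t\<ge>0. J t \<omega> = None")
  case True
  then have "0 \<le> Inf {t. 0 \<le> t \<and> J t \<omega> = None}"
    by (intro cInf_greatest) blast+
  then show ?thesis unfolding lifetime_def if_P[OF True] .
next
  case False
  show ?thesis unfolding lifetime_def if_not_P[OF False] by (rule order_refl)
qed

lemma lifetime_measurable [measurable]: "lifetime J \<in> borel_measurable N"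
proof (subst borel_measurable_iff_less, intro allI)
  fix s :: real
  have J0: "J q \<in> measurable N (count_space UNIV)" if "q \<in> \<rat> \<inter> {0..}" for q
    using that by (intro J_meas) auto
  have [measurable]: "Measurable.pred N (\<lambda>\<omega>. \<exists>q\<in>\<rat> \<inter> {0..}. q < s \<and> J q \<omega> = None)" for s
  proof (rule pred_Bex_countable)
    fix q :: real assume "q \<in> \<rat> \<inter> {0..}"
    from J0[OF this, measurable] show "Measurable.pred N (\<lambda>\<omega>. q < s \<and> J q \<omega> = None)"
      by measurable
  qed (simp add: countable_rat)
  have ex: "(\<exists>t\<ge>0. J t \<omega> = None) \<longleftrightarrow> (\<exists>n::nat. \<exists>q\<in>\<rat> \<inter> {0..}. q < real n \<and> J q \<omega> = None)" if "\<omega> \<in> space N" for \<omega>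
    unfolding ex_None_iff[OF that, symmetric] using reals_Archimedean2 by blast
  have life: "lifetime J \<omega> < s \<longleftrightarrow> (if \<exists>t\<ge>0. J t \<omega> = None then \<exists>t\<ge>0. t < s \<and> J t \<omega> = None else 0 < s)" for \<omega>
  proof (cases "\<exists>t\<ge>0. J t \<omega> = None")
    case True
    then have "Inf {t. 0 \<le> t \<and> J t \<omega> = None} < s \<longleftrightarrow> (\<exists>t\<in>{t. 0 \<le> t \<and> J t \<omega> = None}. t < s)"
      by (intro cInf_less_iff bdd_belowI[of _ 0]) auto
    then show ?thesis unfolding lifetime_def if_P[OF True] by blast
  next
    case False
    then have "lifetime J \<omega> = 0" unfolding lifetime_def by (rule if_not_P)
    then show ?thesis using False by auto
  qed
  have "{\<omega> \<in> space N. lifetime J \<omega> < s} =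
    {\<omega> \<in> space N. if \<exists>n::nat. \<exists>q\<in>\<rat> \<inter> {0..}. q < real n \<and> J q \<omega> = None
       then \<exists>q\<in>\<rat> \<inter> {0..}. q < s \<and> J q \<omega> = None else 0 < s}"
    by (intro Collect_cong conj_cong refl) (simp only: life ex ex_None_iff)
  also have "\<dots> \<in> sets N" by measurable
  finally show "{\<omega> \<in> space N. lifetime J \<omega> < s} \<in> sets N" .
qed

lemma J_random_time:
  assumes T[measurable]: "T \<in> borel_measurable N" and T0: "\<And>\<omega>. \<omega> \<in> space N \<Longrightarrow> 0 \<le> T \<omega>"
  shows "Measurable.pred N (\<lambda>\<omega>. J (T \<omega>) \<omega> = i)"
proof -
  have "(\<lambda>\<omega>. if J (T \<omega>) \<omega> = i then 1 else 0 :: real) \<in> borel_measurable N"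
  proof (rule measurable_at_random_time[OF _ _ T T0, where Y="\<lambda>t \<omega>. if J t \<omega> = i then 1 else 0"])
    fix \<omega> and t :: real assume "\<omega> \<in> space N" "0 \<le> t"
    then have "\<forall>\<^sub>F s in at_right t. J s \<omega> = J t \<omega>"
      using J_path by (simp add: jump_path_def)
    then have "\<forall>\<^sub>F s in at_right t. (if J s \<omega> = i then 1 else 0 :: real) = (if J t \<omega> = i then 1 else 0)"
      by eventually_elim simp
    then show "((\<lambda>s. if J s \<omega> = i then 1 else 0 :: real) \<longlongrightarrow> (if J t \<omega> = i then 1 else 0)) (at_right t)"
      by (rule tendsto_eventually)
  qed simp
  then have "Measurable.pred N (\<lambda>\<omega>. (if J (T \<omega>) \<omega> = i then 1 else 0 :: real) = 1)"
    by measurable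
  moreover have "(\<lambda>\<omega>. (if J (T \<omega>) \<omega> = i then 1 else 0 :: real) = 1) = (\<lambda>\<omega>. J (T \<omega>) \<omega> = i)"
    by auto
  ultimately show ?thesis by (simp only:)
qed

lemma left_phase_random_time:
  assumes T[measurable]: "T \<in> borel_measurable N" and T0: "\<And>\<omega>. \<omega> \<in> space N \<Longrightarrow> 0 \<le> T \<omega>"
  shows "Measurable.pred N (\<lambda>\<omega>. left_phase J (T \<omega>) \<omega> = i)"
proof -
  let ?l = "\<lambda>n \<omega>. real (nat (\<lceil>T \<omega> * real (Suc n)\<rceil> - 1)) / real (Suc n)"
  define B where "B n \<omega> \<longleftrightarrow> J (?l n \<omega>) \<omega> = i" for n \<omega>
  have [measurable]: "Measurable.pred N (B n)" for n
    unfolding B_def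
    by (rule measurable_compose_countable[where f="\<lambda>k \<omega>. J (real k / real (Suc n)) \<omega> = i"]) measurable
  have eq: "left_phase J (T \<omega>) \<omega> = i \<longleftrightarrow> (if T \<omega> \<le> 0 then J 0 \<omega> = i
      else \<exists>K. \<forall>n\<ge>K. B n \<omega>)" if \<omega>: "\<omega> \<in> space N" for \<omega>
  proof (cases "T \<omega> \<le> 0")
    case False
    then obtain i' d where d: "0 < d" "\<And>s. T \<omega> - d < s \<Longrightarrow> s < T \<omega> \<Longrightarrow> J s \<omega> = i'"
      using jump_path_left[OF J_path[OF \<omega>], of "T \<omega>"] by auto
    have lp: "left_phase J (T \<omega>) \<omega> = i'"
      using False d by (intro left_phase_eq) auto
    have "\<forall>\<^sub>F s in at_left (T \<omega>). J s \<omega> = i'"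
      using d by (auto simp: eventually_at_left_field intro!: exI[of _ "T \<omega> - d"])
    then have "\<forall>\<^sub>F n in sequentially. J (?l n \<omega>) \<omega> = i'"
      by (rule eventually_compose_filterlim) (use rounding_left[of "T \<omega>"] False in simp)
    then obtain K where "\<And>n. K \<le> n \<Longrightarrow> J (?l n \<omega>) \<omega> = i'"
      unfolding eventually_sequentially by blast
    then have K: "B n \<omega> \<longleftrightarrow> i' = i" if "K \<le> n" for n
      using that by (simp only: B_def)
    have "(\<exists>K. \<forall>n\<ge>K. B n \<omega>) \<longleftrightarrow> i' = i"
    proof
      assume "\<exists>K. \<forall>n\<ge>K. B n \<omega>"
      then obtain K' where K': "\<And>n. K' \<le> n \<Longrightarrow> B n \<omega>" by blast
      show "i' = i" using K[of "max K K'"] K'[of "max K K'"] by simp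
    qed (use K in blast)
    then show ?thesis using False lp by simp
  qed (simp add: left_phase_def)
  have "Measurable.pred N (\<lambda>\<omega>. if T \<omega> \<le> 0 then J 0 \<omega> = i else \<exists>K. \<forall>n\<ge>K. B n \<omega>)"
    by measurable
  then show ?thesis by (subst measurable_cong[OF eq])
qed

lemma phase_at_random_time:
  assumes T[measurable]: "T \<in> borel_measurable N" and T0: "\<And>\<omega>. \<omega> \<in> space N \<Longrightarrow> 0 \<le> T \<omega>"
  shows "Measurable.pred N (\<lambda>\<omega>. phase_at J (T \<omega>) \<omega> = i)"
proof -
  note [measurable] = J_random_time[OF T T0] left_phase_random_time[OF T T0]
  have "Measurable.pred N (\<lambda>\<omega>. if T \<omega> = lifetime J \<omega> then left_phase J (T \<omega>) \<omega> = i else J (T \<omega>) \<omega> = i)"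
    by measurable
  moreover have "(\<lambda>\<omega>. if T \<omega> = lifetime J \<omega> then left_phase J (T \<omega>) \<omega> = i else J (T \<omega>) \<omega> = i)
      = (\<lambda>\<omega>. phase_at J (T \<omega>) \<omega> = i)"
    by (simp add: fun_eq_iff phase_at_def)
  ultimately show ?thesis by (simp only:)
qed

end

section \<open>Levy processes killed at phase-type times\<close>

lemma (in prob_space) indep_set_commute:
  assumes I: "indep_set A B" shows "indep_set B A"
proof (rule indep_setI)
  show "B \<subseteq> events" "A \<subseteq> events"
    using I by (auto simp: indep_set_def indep_sets_def split: bool.splits)
  show "prob (b \<inter> a) = prob b * prob a" if "b \<in> B" "a \<in> A" for a b
    using indep_setD[OF I that(2,1)] by (simp only: Int_commute mult.commute)
qed

lemma (in prob_space) prob_finite_split: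
  fixes Y :: "'a \<Rightarrow> 'b::finite"
  assumes "\<And>y. {\<omega> \<in> space M. Y \<omega> = y} \<in> events" "{\<omega> \<in> space M. P \<omega>} \<in> events"
  shows "prob {\<omega> \<in> space M. P \<omega>} = (\<Sum>y\<in>UNIV. prob {\<omega> \<in> space M. Y \<omega> = y \<and> P \<omega>})"
proof -
  have "{\<omega> \<in> space M. Y \<omega> = y \<and> P \<omega>} \<in> events" for y
  proof -
    have "{\<omega> \<in> space M. Y \<omega> = y \<and> P \<omega>} = {\<omega> \<in> space M. Y \<omega> = y} \<inter> {\<omega> \<in> space M. P \<omega>}" by auto
    then show ?thesis using sets.Int[OF assms(1)[of y] assms(2)] by simp
  qed
  then have "prob (\<Union>y\<in>UNIV. {\<omega> \<in> space M. Y \<omega> = y \<and> P \<omega>}) = (\<Sum>y\<in>UNIV. prob {\<omega> \<in> space M. Y \<omega> = y \<and> P \<omega>})"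
    by (intro finite_measure_finite_Union) (auto simp: disjoint_family_on_def)
  also have "(\<Union>y\<in>UNIV. {\<omega> \<in> space M. Y \<omega> = y \<and> P \<omega>}) = {\<omega> \<in> space M. P \<omega>}" by auto
  finally show ?thesis .
qed

locale killed_levy =
  fixes M :: "'w measure" and X :: "real \<Rightarrow> 'w \<Rightarrow> real" and J :: "real \<Rightarrow> 'w \<Rightarrow> 'n::finite option"
    and a :: "real^'n" and U :: "real^'n^'n"
  assumes lp: "levy_with_phases M X J a U" and U: "subgenerator U"
begin

abbreviation L :: "'w \<Rightarrow> real" where "L \<equiv> lifetime J"

definition VX :: "'w measure" where
  "VX = vimage_algebra (space M) (path_map X) (Pi\<^sub>M {0..} (\<lambda>_. borel))"

definition VJ :: "'w measure" where
  "VJ = vimage_algebra (space M) (path_map J) (Pi\<^sub>M {0..} (\<lambda>_. count_space UNIV))"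

lemma levy: "levy_process M X" and phase: "phase_process M J a U"
  using lp by (auto simp: levy_with_phases_def)

sublocale prob_space M
  using levy by (simp add: levy_process_def)

lemma indep_XJ: "indep_set (sets VX) (sets VJ)"
  using lp by (simp add: levy_with_phases_def VX_def VJ_def)

lemma space_V [simp]: "space VX = space M" "space VJ = space M"
  by (simp_all add: VX_def VJ_def)

lemma sets_V: "sets VX \<subseteq> events" "sets VJ \<subseteq> events"
  using indep_XJ by (auto simp: indep_set_def indep_sets_def split: bool.splits)

sublocale MX: measurable_path M X
  using levy by unfold_locales (auto simp: levy_process_def)

sublocale MJ: measurable_phase M J
  using phase by unfold_locales (auto simp: phase_process_def markov_jump_process_def)

lemma path_component_measurable:
  assumes "0 \<le> t" and Y: "\<And>t \<omega>. 0 \<le> t \<Longrightarrow> \<omega> \<in> space M \<Longrightarrow> Y t \<omega> \<in> space S"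
  shows "Y t \<in> measurable (vimage_algebra (space M) (path_map Y) (Pi\<^sub>M {0..} (\<lambda>_. S))) S"
proof -
  have "path_map Y \<in> measurable (vimage_algebra (space M) (path_map Y) (Pi\<^sub>M {0..} (\<lambda>_. S))) (Pi\<^sub>M {0..} (\<lambda>_. S))"
    using Y by (intro measurable_vimage_algebra1) (auto simp: path_map_def space_PiM PiE_iff)
  from measurable_compose[OF this measurable_component_singleton[of t]] assms(1)
  show ?thesis by (simp add: path_map_def)
qed

sublocale VXX: measurable_path VX X
  by unfold_locales (auto simp: VX_def intro!: path_component_measurable MX.X_cadlag MX.X_0)

sublocale VJJ: measurable_phase VJ J
  by unfold_locales (auto simp: VJ_def intro!: path_component_measurable MJ.J_path)

lemma markov:
  "0 \<le> s 0 \<Longrightarrow> (\<forall>l\<le>m. s l < s (Suc l)) \<Longrightarrow>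
    prob {\<omega> \<in> space M. \<forall>l\<le>Suc m. J (s l) \<omega> = x l} =
    prob {\<omega> \<in> space M. \<forall>l\<le>m. J (s l) \<omega> = x l} * trans (extend_generator U) (s (Suc m) - s m) $ x m $ x (Suc m)"
  using phase unfolding phase_process_def markov_jump_process_def by blast

lemma prob_J_pair:
  assumes "0 \<le> s" "s < t"
  shows "prob {\<omega> \<in> space M. J s \<omega> = x \<and> J t \<omega> = y} =
    prob {\<omega> \<in> space M. J s \<omega> = x} * trans (extend_generator U) (t - s) $ x $ y"
proof -
  have "(\<forall>l\<le>Suc 0. P l) \<longleftrightarrow> P 0 \<and> P (Suc 0)" for P
    by (auto simp: le_Suc_eq)
  then show ?thesis
    using markov[of "\<lambda>l. if l = 0 then s else t" 0 "\<lambda>l. if l = 0 then x else y"] assms by simp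
qed

lemma prob_J_0: "prob {\<omega> \<in> space M. J 0 \<omega> = Some k} = a $ k" "prob {\<omega> \<in> space M. J 0 \<omega> = None} = 0"
  using phase by (simp_all add: phase_process_def markov_jump_process_def extend_initial_def)

lemma prob_J:
  assumes "0 \<le> t" shows "prob {\<omega> \<in> space M. J t \<omega> = Some k} = occ_prob a U t k"
proof (cases "t = 0")
  case True
  have "occ_prob a U 0 k = a $ k"
    unfolding occ_prob_def matrix_exp_0 by (simp add: mat_def mult_delta_right)
  then show ?thesis using True prob_J_0 by simp
next
  case False
  have "prob {\<omega> \<in> space M. J t \<omega> = Some k} = (\<Sum>y\<in>UNIV. prob {\<omega> \<in> space M. J 0 \<omega> = y \<and> J t \<omega> = Some k})"
    using assms by (intro prob_finite_split) auto
  also have "\<dots> = (\<Sum>y\<in>UNIV. prob {\<omega> \<in> space M. J 0 \<omega> = y} * trans (extend_generator U) t $ y $ Some k)"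
    using prob_J_pair[of 0 t] assms False by simp
  also have "\<dots> = occ_prob a U t k"
    by (simp add: sum_UNIV_option trans_extend prob_J_0 occ_prob_def)
  finally show ?thesis .
qed

lemma prob_J_alive:
  assumes "0 \<le> s" "s \<le> t"
  shows "prob {\<omega> \<in> space M. J s \<omega> = Some k \<and> J t \<omega> \<noteq> None} = occ_prob a U s k * surv U (t - s) k"
proof (cases "s = t")
  case True
  then show ?thesis using prob_J[OF assms(1), of k] by (simp cong: conj_cong)
next
  case False
  then have st: "s < t" "0 \<le> t" using assms by auto
  have "prob {\<omega> \<in> space M. J s \<omega> = Some k \<and> J t \<omega> \<noteq> None}
     = (\<Sum>y\<in>UNIV. prob {\<omega> \<in> space M. J t \<omega> = y \<and> (J s \<omega> = Some k \<and> J t \<omega> \<noteq> None)})"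
    using assms st by (intro prob_finite_split) auto
  also have "\<dots> = (\<Sum>y\<in>UNIV. if y = None then 0 else prob {\<omega> \<in> space M. J s \<omega> = Some k \<and> J t \<omega> = y})"
  proof (intro sum.cong refl)
    fix y :: "'n option"
    have "{\<omega> \<in> space M. J t \<omega> = y \<and> J s \<omega> = Some k \<and> J t \<omega> \<noteq> None}
      = (if y = None then {} else {\<omega> \<in> space M. J s \<omega> = Some k \<and> J t \<omega> = y})"
      by auto
    then show "prob {\<omega> \<in> space M. J t \<omega> = y \<and> J s \<omega> = Some k \<and> J t \<omega> \<noteq> None}
      = (if y = None then 0 else prob {\<omega> \<in> space M. J s \<omega> = Some k \<and> J t \<omega> = y})"
      by (simp only: if_distrib[of prob] measure_empty)
  qed
  also have "\<dots> = (\<Sum>j\<in>UNIV. occ_prob a U s k * trans U (t - s) $ k $ j)"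
    by (simp add: sum_UNIV_option prob_J_pair[OF assms(1) st(1)] prob_J[OF assms(1)] trans_extend)
  finally show ?thesis by (simp add: surv_def sum_distrib_left)
qed

lemma AE_absorbing: "AE \<omega> in M. \<forall>s t. 0 \<le> s \<longrightarrow> s < t \<longrightarrow> J s \<omega> = None \<longrightarrow> J t \<omega> = None"
proof -
  have "AE \<omega> in M. \<forall>p\<in>\<rat> \<inter> {0..}. \<forall>q\<in>\<rat> \<inter> {0::real..}. \<forall>k. p < q \<longrightarrow> \<not> (J p \<omega> = None \<and> J q \<omega> = Some k)"
  proof (intro AE_ball_countable' ballI countable_Int1 countable_rat)
    fix p q :: real assume pq: "p \<in> \<rat> \<inter> {0..}" "q \<in> \<rat> \<inter> {0..}"
    show "AE \<omega> in M. \<forall>k. p < q \<longrightarrow> \<not> (J p \<omega> = None \<and> J q \<omega> = Some k)"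
    proof (cases "p < q")
      case True
      have "AE \<omega> in M. \<not> (J p \<omega> = None \<and> J q \<omega> = Some k)" for k
      proof (rule AE_I'[of "{\<omega> \<in> space M. J p \<omega> = None \<and> J q \<omega> = Some k}"])
        have [measurable]: "J p \<in> measurable M (count_space UNIV)" "J q \<in> measurable M (count_space UNIV)"
          using pq by auto
        have "prob {\<omega> \<in> space M. J p \<omega> = None \<and> J q \<omega> = Some k} = 0"
          using pq True by (subst prob_J_pair) (auto simp: trans_extend)
        then show "{\<omega> \<in> space M. J p \<omega> = None \<and> J q \<omega> = Some k} \<in> null_sets M"
          by (intro null_setsI) (auto simp: emeasure_eq_measure)
      qed auto
      then have "AE \<omega> in M. \<forall>k. \<not> (J p \<omega> = None \<and> J q \<omega> = Some k)"
        by (rule AE_all_countable[THEN iffD2, OF allI])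
      then show ?thesis by eventually_elim blast
    qed auto
  qed
  with AE_space show ?thesis
  proof eventually_elim
    case (elim \<omega>)
    show ?case
    proof (intro allI impI)
      fix s t :: real assume st: "0 \<le> s" "s < t" "J s \<omega> = None"
      note jp = MJ.J_path[OF elim(1)]
      obtain d where d: "0 < d" "\<And>u. s \<le> u \<Longrightarrow> u < s + d \<Longrightarrow> J u \<omega> = J s \<omega>"
        using jump_path_right[OF jp st(1)] by auto
      obtain e where e: "0 < e" "\<And>u. t \<le> u \<Longrightarrow> u < t + e \<Longrightarrow> J u \<omega> = J t \<omega>"
        using jump_path_right[OF jp, of t] st by auto
      obtain p where p: "p \<in> \<rat>" "s < p" "p < min t (s + d)"
        using Rats_dense_in_real[of s "min t (s + d)"] d st by auto
      obtain q where q: "q \<in> \<rat>" "t < q" "q < t + e"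
        using Rats_dense_in_real[of t "t + e"] e by auto
      have pq: "p \<in> \<rat> \<inter> {0..}" "q \<in> \<rat> \<inter> {0..}" "p < q"
        using p q st by auto
      have "J p \<omega> = None" "J q \<omega> = J t \<omega>"
        using d(2)[of p] e(2)[of q] p q st by auto
      moreover have "\<not> (J p \<omega> = None \<and> J q \<omega> = Some k)" for k
        using bspec[OF bspec[OF elim(2) pq(1)] pq(2)] pq(3) by blast
      ultimately show "J t \<omega> = None"
        by (cases "J t \<omega>") auto
    qed
  qed
qed

lemma AE_lifetime: "AE \<omega> in M. 0 < L \<omega> \<and> (\<forall>t\<ge>0. J t \<omega> = None \<longleftrightarrow> L \<omega> \<le> t)"
proof -
  have 0: "AE \<omega> in M. J 0 \<omega> \<noteq> None"
  proof (rule AE_I'[of "{\<omega> \<in> space M. J 0 \<omega> = None}"])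
    show "{\<omega> \<in> space M. J 0 \<omega> = None} \<in> null_sets M"
      using prob_J_0(2) by (intro null_setsI) (auto simp: emeasure_eq_measure)
  qed auto
  have ex: "AE \<omega> in M. \<exists>t\<ge>0. J t \<omega> = None"
    using phase by (simp add: phase_process_def)
  from AE_absorbing 0 ex AE_space show ?thesis
  proof eventually_elim
    case (elim \<omega>)
    note jp = MJ.J_path[OF elim(4)]
    define S where "S = {t. 0 \<le> t \<and> J t \<omega> = None}"
    have LS: "L \<omega> = Inf S"
      unfolding lifetime_def if_P[OF elim(3)] S_def by (rule refl)
    have ne: "S \<noteq> {}" using elim(3) by (auto simp: S_def)
    have bdd: "bdd_below S" by (rule bdd_belowI[of _ 0]) (auto simp: S_def)
    have L0: "0 \<le> L \<omega>" by (rule MJ.lifetime_nonneg)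
    have after: "J t \<omega> = None" if less: "L \<omega> < t" for t
    proof -
      obtain s where "s \<in> S" "s < t"
        using cInf_lessD[OF ne less[unfolded LS]] by blast
      then show ?thesis using elim(1) by (auto simp: S_def)
    qed
    obtain d where d: "0 < d" "\<And>u. L \<omega> \<le> u \<Longrightarrow> u < L \<omega> + d \<Longrightarrow> J u \<omega> = J (L \<omega>) \<omega>"
      using jump_path_right[OF jp L0] by auto
    have at: "J (L \<omega>) \<omega> = None"
      using d(2)[of "L \<omega> + d / 2"] after[of "L \<omega> + d / 2"] d(1) by auto
    have before: "J t \<omega> \<noteq> None" if "0 \<le> t" "t < L \<omega>" for t
    proof
      assume "J t \<omega> = None"
      then have "L \<omega> \<le> t" unfolding LS using that by (intro cInf_lower bdd) (auto simp: S_def)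
      then show False using that by simp
    qed
    have "L \<omega> \<noteq> 0" using at elim(2) by auto
    then have "0 < L \<omega>" using L0 by simp
    moreover have "J t \<omega> = None \<longleftrightarrow> L \<omega> \<le> t" if "0 \<le> t" for t
      using before[OF that] after[of t] at by (cases t "L \<omega>" rule: linorder_cases) auto
    ultimately show ?case by blast
  qed
qed

lemma AE_X_continuous_at_lifetime: "AE \<omega> in M. 0 < L \<omega> \<longrightarrow> lv (\<lambda>t. X t \<omega>) (L \<omega>) = X (L \<omega>) \<omega>"
proof -
  define D where "D k s t = {\<omega> \<in> space M. 1 / real (Suc k) < \<bar>X t \<omega> - X s \<omega>\<bar>}" for k s t
  define I where "I n \<omega> = nat \<lfloor>L \<omega> * real (Suc n)\<rfloor>" for n \<omega>
  have "AE \<omega> in M. \<not> (\<forall>\<^sub>F n in sequentially. 1 \<le> I n \<omega> \<and>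
    \<omega> \<in> D k ((real (I n \<omega>) - 1) / real (Suc n)) ((real (I n \<omega>) - 1) / real (Suc n) + 2 / real (Suc n)))" for k
    unfolding I_def
  proof (rule no_jump_at_independent_time[OF indep_set_commute[OF indep_XJ] space_V(2,1)])
    show "L \<in> borel_measurable VJ" by (rule VJJ.lifetime_measurable)
    show "D k s t \<in> sets VX" if "0 \<le> s" "s < t" for s t
    proof -
      have [measurable]: "X s \<in> borel_measurable VX" "X t \<in> borel_measurable VX"
        using that by auto
      have "{\<omega> \<in> space VX. 1 / real (Suc k) < \<bar>X t \<omega> - X s \<omega>\<bar>} \<in> sets VX"
        by measurable
      then show ?thesis by (simp add: D_def)
    qed
    define g where "g n = prob {\<omega> \<in> space M. 1 / real (Suc k) < \<bar>X (2 / real (Suc n)) \<omega>\<bar>}" for n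
    have lim0: "filterlim (\<lambda>n. 2 / real (Suc n)) (at_right 0) sequentially"
    proof (rule tendsto_imp_filterlim_at_right)
      show "(\<lambda>n. 2 / real (Suc n)) \<longlonglongrightarrow> 0"
        using tendsto_mult_right_zero[OF LIMSEQ_Suc[OF lim_inverse_n'], of 2] by simp
    qed simp
    have "(\<lambda>n. expectation (indicator {\<omega> \<in> space M. 1 / real (Suc k) < \<bar>X (2 / real (Suc n)) \<omega>\<bar>} :: 'w \<Rightarrow> real)) \<longlonglongrightarrow> expectation (\<lambda>_. 0)"
    proof (rule integral_dominated_convergence[where w="\<lambda>_. 1"])
      show "AE \<omega> in M. (\<lambda>n. indicator {\<omega> \<in> space M. 1 / real (Suc k) < \<bar>X (2 / real (Suc n)) \<omega>\<bar>} \<omega> :: real) \<longlonglongrightarrow> 0"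
      proof (rule AE_I2)
        fix \<omega> assume \<omega>: "\<omega> \<in> space M"
        have "(\<lambda>n. X (2 / real (Suc n)) \<omega>) \<longlonglongrightarrow> 0"
          using filterlim_compose[OF cadlag_right[OF MX.X_cadlag[OF \<omega>] order_refl] lim0] MX.X_0[OF \<omega>] by simp
        then have "(\<lambda>n. \<bar>X (2 / real (Suc n)) \<omega>\<bar>) \<longlonglongrightarrow> 0"
          by (rule tendsto_rabs_zero)
        then have "\<forall>\<^sub>F n in sequentially. \<bar>X (2 / real (Suc n)) \<omega>\<bar> < 1 / real (Suc k)"
          by (rule order_tendstoD) simp
        then have "\<forall>\<^sub>F n in sequentially. indicator {\<omega> \<in> space M. 1 / real (Suc k) < \<bar>X (2 / real (Suc n)) \<omega>\<bar>} \<omega> = (0::real)"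
          by eventually_elim (simp add: indicator_def)
        then show "(\<lambda>n. indicator {\<omega> \<in> space M. 1 / real (Suc k) < \<bar>X (2 / real (Suc n)) \<omega>\<bar>} \<omega> :: real) \<longlonglongrightarrow> 0"
          by (rule tendsto_eventually)
      qed
    qed auto
    then show "g \<longlonglongrightarrow> 0" by (simp add: g_def[abs_def] Int_def conj_commute)
    show "prob (D k s (s + 2 / real (Suc n))) \<le> g n" if s: "0 \<le> s" for s n
    proof -
      let ?h = "2 / real (Suc n)" and ?B = "{x :: real. 1 / real (Suc k) < \<bar>x\<bar>}"
      have [measurable]: "X s \<in> borel_measurable M" "X (s + ?h) \<in> borel_measurable M" "X ?h \<in> borel_measurable M"
        using s by auto
      have "distr M borel (\<lambda>\<omega>. X (s + ?h) \<omega> - X s \<omega>) = distr M borel (X ?h)"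
        using levy s unfolding levy_process_def by simp
      then have "measure (distr M borel (\<lambda>\<omega>. X (s + ?h) \<omega> - X s \<omega>)) ?B = measure (distr M borel (X ?h)) ?B"
        by (rule arg_cong)
      then have "prob (D k s (s + ?h)) = g n"
        by (simp add: measure_distr D_def g_def vimage_def Int_def conj_commute del: of_nat_Suc)
      then show ?thesis by simp
    qed
  qed
  then have "AE \<omega> in M. \<forall>k. \<not> (\<forall>\<^sub>F n in sequentially. 1 \<le> I n \<omega> \<and>
    \<omega> \<in> D k ((real (I n \<omega>) - 1) / real (Suc n)) ((real (I n \<omega>) - 1) / real (Suc n) + 2 / real (Suc n)))"
    unfolding AE_all_countable by blast
  with AE_space show ?thesis
  proof eventually_elim
    case (elim \<omega>)
    show ?case
    proof (intro impI, rule ccontr)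
      assume L0: "0 < L \<omega>" and ne: "lv (\<lambda>t. X t \<omega>) (L \<omega>) \<noteq> X (L \<omega>) \<omega>"
      let ?l = "lv (\<lambda>t. X t \<omega>) (L \<omega>)" and ?r = "X (L \<omega>) \<omega>"
      define e where "e = \<bar>?r - ?l\<bar> / 4"
      have e: "0 < e" using ne by (simp add: e_def)
      obtain k where k: "1 / real (Suc k) < e"
        by (rule nat_approx_posE[OF e])
      note cl = MX.X_cadlag[OF elim(1)]
      have "\<forall>\<^sub>F t in at_left (L \<omega>). \<bar>X t \<omega> - ?l\<bar> < e"
        using tendstoD[OF cadlag_left[OF cl L0] e] by (simp add: dist_real_def)
      then obtain b where b: "b < L \<omega>" "\<And>t. b < t \<Longrightarrow> t < L \<omega> \<Longrightarrow> \<bar>X t \<omega> - ?l\<bar> < e"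
        by (auto simp: eventually_at_left_field)
      have "\<forall>\<^sub>F t in at_right (L \<omega>). \<bar>X t \<omega> - ?r\<bar> < e"
        using tendstoD[OF cadlag_right[OF cl less_imp_le[OF L0]] e] by (simp add: dist_real_def)
      then obtain c where c: "L \<omega> < c" "\<And>t. L \<omega> < t \<Longrightarrow> t < c \<Longrightarrow> \<bar>X t \<omega> - ?r\<bar> < e"
        by (auto simp: eventually_at_right_field)
      define d where "d = min (L \<omega> - b) (c - L \<omega>)"
      have dbc: "d \<le> L \<omega> - b" "d \<le> c - L \<omega>" by (simp_all add: d_def)
      have "0 < d" using b c by (simp add: d_def)
      from rounding_window[OF L0 this]
      have "\<forall>\<^sub>F n in sequentially. 1 \<le> I n \<omega> \<and>
        \<omega> \<in> D k ((real (I n \<omega>) - 1) / real (Suc n)) ((real (I n \<omega>) - 1) / real (Suc n) + 2 / real (Suc n))"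
        unfolding I_def[symmetric]
      proof eventually_elim
        case (elim n)
        let ?s = "(real (I n \<omega>) - 1) / real (Suc n)"
        let ?t = "?s + 2 / real (Suc n)"
        have st: "L \<omega> - d < ?s" "?s < L \<omega>" "L \<omega> < ?t" "?t < L \<omega> + d"
          using elim by (simp_all only: greaterThanLessThan_iff)
        have "\<bar>X ?s \<omega> - ?l\<bar> < e"
          by (rule b(2)) (use st dbc in linarith)+
        moreover have "\<bar>X ?t \<omega> - ?r\<bar> < e"
          by (rule c(2)) (use st dbc in linarith)+
        moreover have "\<bar>?r - ?l\<bar> = 4 * e" by (simp add: e_def)
        ultimately have "1 / real (Suc k) < \<bar>X ?t \<omega> - X ?s \<omega>\<bar>"
          using k by linarith
        then show ?case using elim \<open>\<omega> \<in> space M\<close> by (simp add: D_def del: of_nat_Suc)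
      qed
      then show False using elim(2) by blast
    qed
  qed
qed

lemma AE_J_continuous_at:
  assumes T: "T \<in> borel_measurable VX"
  shows "AE \<omega> in M. 0 < T \<omega> \<longrightarrow> (\<exists>d>0. \<forall>s. \<bar>s - T \<omega>\<bar> < d \<longrightarrow> J s \<omega> = J (T \<omega>) \<omega>)"
proof -
  define D where "D s t = {\<omega> \<in> space M. J s \<omega> \<noteq> J t \<omega>}" for s t
  define I where "I n \<omega> = nat \<lfloor>T \<omega> * real (Suc n)\<rfloor>" for n \<omega>
  have "AE \<omega> in M. \<not> (\<forall>\<^sub>F n in sequentially. 1 \<le> I n \<omega> \<and>
    \<omega> \<in> D ((real (I n \<omega>) - 1) / real (Suc n)) ((real (I n \<omega>) - 1) / real (Suc n) + 2 / real (Suc n)))"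
    unfolding I_def
  proof (rule no_jump_at_independent_time[OF indep_XJ space_V(1,2) T])
    show "D s t \<in> sets VJ" if "0 \<le> s" "s < t" for s t
    proof -
      have [measurable]: "J s \<in> measurable VJ (count_space UNIV)" "J t \<in> measurable VJ (count_space UNIV)"
        using that by auto
      have "{\<omega> \<in> space VJ. J s \<omega> \<noteq> J t \<omega>} \<in> sets VJ"
        by measurable
      then show ?thesis by (simp add: D_def)
    qed
    define g where "g n = (\<Sum>x\<in>UNIV. 1 - trans (extend_generator U) (2 / real (Suc n)) $ x $ x)" for n
    have lim0: "(\<lambda>n. 2 / real (Suc n)) \<longlonglongrightarrow> 0"
      using tendsto_mult_right_zero[OF LIMSEQ_Suc[OF lim_inverse_n'], of 2] by simp
    have "(\<lambda>n. trans (extend_generator U) (2 / real (Suc n)) $ x $ x) \<longlonglongrightarrow> trans (extend_generator U) 0 $ x $ x" for x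
      by (rule isCont_tendsto_compose[OF trans_continuous lim0])
    then have "(\<lambda>n. trans (extend_generator U) (2 / real (Suc n)) $ x $ x) \<longlonglongrightarrow> 1" for x
      unfolding matrix_exp_0 by (simp add: mat_def)
    then have "(\<lambda>n. 1 - trans (extend_generator U) (2 / real (Suc n)) $ x $ x) \<longlonglongrightarrow> 1 - 1" for x
      by (intro tendsto_diff tendsto_const)
    then show "g \<longlonglongrightarrow> 0"
      unfolding g_def[abs_def] by (intro tendsto_null_sum) simp
    have diag: "trans (extend_generator U) t $ x $ x \<le> 1" if "0 \<le> t" for t x
      using that trans_le_surv[OF U that] surv_le_1[OF U that]
      by (cases x) (auto simp: trans_extend intro: order_trans)
    show "prob (D s (s + 2 / real (Suc n))) \<le> g n" if s: "0 \<le> s" for s n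
    proof -
      let ?t = "s + 2 / real (Suc n)"
      have [measurable]: "J s \<in> measurable M (count_space UNIV)" "J ?t \<in> measurable M (count_space UNIV)"
        using s by auto
      have "prob (D s ?t) = (\<Sum>x\<in>UNIV. prob {\<omega> \<in> space M. J s \<omega> = x \<and> J s \<omega> \<noteq> J ?t \<omega>})"
        unfolding D_def by (rule prob_finite_split) measurable
      also have "\<dots> \<le> g n"
        unfolding g_def
      proof (rule sum_mono)
        fix x
        have "prob {\<omega> \<in> space M. J s \<omega> = x \<and> J s \<omega> \<noteq> J ?t \<omega>} = prob ({\<omega> \<in> space M. J s \<omega> = x} - {\<omega> \<in> space M. J s \<omega> = x \<and> J ?t \<omega> = x})"
          by (rule arg_cong[where f=prob]) auto
        also have "\<dots> = prob {\<omega> \<in> space M. J s \<omega> = x} - prob {\<omega> \<in> space M. J s \<omega> = x \<and> J ?t \<omega> = x}"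
          by (rule finite_measure_Diff) (measurable, blast)
        also have "\<dots> = prob {\<omega> \<in> space M. J s \<omega> = x} * (1 - trans (extend_generator U) (2 / real (Suc n)) $ x $ x)"
          using s by (subst prob_J_pair) (auto simp: algebra_simps)
        also have "\<dots> \<le> 1 * (1 - trans (extend_generator U) (2 / real (Suc n)) $ x $ x)"
          using diag[of "2 / real (Suc n)" x] by (intro mult_right_mono) auto
        finally show "prob {\<omega> \<in> space M. J s \<omega> = x \<and> J s \<omega> \<noteq> J ?t \<omega>} \<le> 1 - trans (extend_generator U) (2 / real (Suc n)) $ x $ x"
          by simp
      qed
      finally show ?thesis .
    qed
  qed
  with AE_space show ?thesis
  proof eventually_elim
    case (elim \<omega>)
    show ?case
    proof (intro impI)
      assume T0: "0 < T \<omega>"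
      note jp = MJ.J_path[OF elim(1)]
      obtain d where d: "0 < d" "\<And>u. T \<omega> \<le> u \<Longrightarrow> u < T \<omega> + d \<Longrightarrow> J u \<omega> = J (T \<omega>) \<omega>"
        using jump_path_right[OF jp less_imp_le[OF T0]] by auto
      obtain i e where e: "0 < e" "\<And>u. T \<omega> - e < u \<Longrightarrow> u < T \<omega> \<Longrightarrow> J u \<omega> = i"
        using jump_path_left[OF jp T0] by blast
      define r where "r = min d e"
      have r: "0 < r" "r \<le> d" "r \<le> e" using d e by (auto simp: r_def)
      have i: "i = J (T \<omega>) \<omega>"
      proof (rule ccontr)
        assume ne: "i \<noteq> J (T \<omega>) \<omega>"
        from rounding_window[OF T0 r(1)]
        have "\<forall>\<^sub>F n in sequentially. 1 \<le> I n \<omega> \<and>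
          \<omega> \<in> D ((real (I n \<omega>) - 1) / real (Suc n)) ((real (I n \<omega>) - 1) / real (Suc n) + 2 / real (Suc n))"
          unfolding I_def[symmetric]
        proof eventually_elim
          case (elim n)
          let ?s = "(real (I n \<omega>) - 1) / real (Suc n)"
          let ?t = "?s + 2 / real (Suc n)"
          have st: "T \<omega> - r < ?s" "?s < T \<omega>" "T \<omega> < ?t" "?t < T \<omega> + r"
            using elim by (simp_all only: greaterThanLessThan_iff)
          have "J ?s \<omega> = i"
            by (rule e(2)) (use st r in linarith)+
          moreover have "J ?t \<omega> = J (T \<omega>) \<omega>"
            by (rule d(2)) (use st r in linarith)+
          ultimately have "J ?s \<omega> \<noteq> J ?t \<omega>" using ne by simp
          then show ?case using elim \<open>\<omega> \<in> space M\<close> by (simp add: D_def del: of_nat_Suc)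
        qed
        then show False using elim(2) by blast
      qed
      have "J s \<omega> = J (T \<omega>) \<omega>" if "\<bar>s - T \<omega>\<bar> < r" for s
        using d(2)[of s] e(2)[of s] i that r by (cases "T \<omega> \<le> s") auto
      then show "\<exists>d>0. \<forall>s. \<bar>s - T \<omega>\<bar> < d \<longrightarrow> J s \<omega> = J (T \<omega>) \<omega>"
        using r(1) by blast
    qed
  qed
qed

end

section \<open>Convergence of the sampled extremum\<close>

lemma tendsto_iter_seq_fst: "f \<longlonglongrightarrow> l \<Longrightarrow> ((\<lambda>p. f (fst p)) \<longlongrightarrow> l) iter_seq"
  unfolding tendsto_def eventually_iter_seq by simp

lemma tendsto_iter_seq_snd: "f \<longlonglongrightarrow> l \<Longrightarrow> ((\<lambda>p. f (snd p)) \<longlongrightarrow> l) iter_seq"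
  unfolding tendsto_def eventually_iter_seq by simp

abbreviation tilt :: "nat \<times> nat \<Rightarrow> real" where "tilt p \<equiv> 1 / real (Suc (fst p))"
abbreviation mesh :: "nat \<times> nat \<Rightarrow> real" where "mesh p \<equiv> 1 / real (Suc (snd p))"

lemma tilt_tendsto: "(tilt \<longlongrightarrow> 0) iter_seq"
  using tendsto_iter_seq_fst[OF LIMSEQ_Suc[OF lim_inverse_n']] .

lemma mesh_tendsto: "(mesh \<longlongrightarrow> 0) iter_seq"
  using tendsto_iter_seq_snd[OF LIMSEQ_Suc[OF lim_inverse_n']] .

lemma eventually_iter_seq_tilt_mesh:
  assumes "\<exists>e0>0. \<forall>e. 0 < e \<longrightarrow> e < e0 \<longrightarrow> (\<exists>h0>0. \<forall>h. 0 < h \<longrightarrow> h < h0 \<longrightarrow> P e h)"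
  shows "\<forall>\<^sub>F p in iter_seq. P (tilt p) (mesh p)"
proof -
  have small: "\<forall>\<^sub>F n in sequentially. 1 / real (Suc n) < r" if "0 < r" for r :: real
    using order_tendstoD(2)[OF LIMSEQ_Suc[OF lim_inverse_n'] that] .
  obtain e0 where e0: "0 < e0" "\<And>e. 0 < e \<Longrightarrow> e < e0 \<Longrightarrow> \<exists>h0>0. \<forall>h. 0 < h \<longrightarrow> h < h0 \<longrightarrow> P e h"
    using assms by blast
  from small[OF e0(1)]
  show ?thesis
    unfolding eventually_iter_seq
  proof eventually_elim
    case (elim n)
    obtain h0 where h0: "0 < h0" "\<And>h. 0 < h \<Longrightarrow> h < h0 \<Longrightarrow> P (1 / real (Suc n)) h"
      using e0(2)[OF _ elim] by auto
    from small[OF h0(1)] show ?case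
      by eventually_elim (simp add: h0(2) del: of_nat_Suc)
  qed
qed

definition up :: "real \<Rightarrow> real set" where "up c = (if c = 1 then {0<..} else {..0})"
definition dn :: "real \<Rightarrow> real set" where "dn c = (if c = 1 then {..0} else {0<..})"

text \<open>The index \<open>m\<close> is the first maximum of \<open>w\<close> on \<open>{..n}\<close> for \<open>c = 1\<close> and the last minimum for
  \<open>c = -1\<close>.\<close>

definition marker :: "real \<Rightarrow> (nat \<Rightarrow> real) \<Rightarrow> nat \<Rightarrow> nat \<Rightarrow> bool" where
  "marker c w n m \<longleftrightarrow> m \<le> n \<and> (\<forall>i<m. w m - w i \<in> up c) \<and> (\<forall>j. m < j \<longrightarrow> j \<le> n \<longrightarrow> w j - w m \<in> dn c)"

lemma marker_unique:
  assumes "marker c w n m" "marker c w n m'" shows "m = m'"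
proof (cases m m' rule: linorder_cases)
  case less
  then have "w m' - w m \<in> up c" "w m' - w m \<in> dn c"
    using assms by (auto simp: marker_def)
  then show ?thesis by (auto simp: up_def dn_def split: if_splits)
next
  case greater
  then have "w m - w m' \<in> up c" "w m - w m' \<in> dn c"
    using assms by (auto simp: marker_def)
  then show ?thesis by (auto simp: up_def dn_def split: if_splits)
qed

lemma marker_extremal:
  assumes "c = 1 \<or> c = -1" "marker c w n m" "i \<le> n"
  shows "c * w i \<le> c * w m"
proof (cases i m rule: linorder_cases)
  case less
  then have "w m - w i \<in> up c" using assms by (auto simp: marker_def)
  then show ?thesis using assms(1) by (auto simp: up_def)
next
  case greater
  then have "w i - w m \<in> dn c" using assms by (auto simp: marker_def)
  then show ?thesis using assms(1) by (auto simp: dn_def)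
qed simp

lemma marker_Suc:
  assumes "c = 1 \<or> c = -1" "marker c w n m"
  shows "marker c w (Suc n) (if w (Suc n) - w m \<in> dn c then m else Suc n)"
proof (cases "w (Suc n) - w m \<in> dn c")
  case True
  then show ?thesis using assms by (auto simp: marker_def le_Suc_eq)
next
  case False
  have "w (Suc n) - w i \<in> up c" if "i < Suc n" for i
    using marker_extremal[OF assms, of i] that False assms(1) by (auto simp: up_def dn_def)
  then show ?thesis using False by (auto simp: marker_def)
qed

lemma marker_exists: "c = 1 \<or> c = -1 \<Longrightarrow> \<exists>m. marker c w n m"
proof (induction n)
  case 0
  then show ?case by (auto simp: marker_def)
next
  case (Suc n)
  then show ?case using marker_Suc by blast
qed

lemma marker_le: "marker c w n m \<Longrightarrow> m \<le> n"
  by (simp add: marker_def)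

lemma sum_marker:
  fixes f :: "nat \<Rightarrow> real"
  assumes "marker c w n m"
  shows "(\<Sum>i\<le>n. if marker c w n i then f i else 0) = f m"
proof -
  have "marker c w n i \<longleftrightarrow> i = m" for i
    using marker_unique[OF assms] assms by blast
  then show ?thesis using marker_le[OF assms] by simp
qed

lemma cadlag_sign: "c = 1 \<or> c = -1 \<Longrightarrow> cadlag x \<Longrightarrow> cadlag (\<lambda>t. c * x t)"
  using cadlag_uminus[of x] by auto

lemma (in measurable_path) measurable_path_sign:
  assumes "c = 1 \<or> c = -1" shows "measurable_path N (\<lambda>t \<omega>. c * X t \<omega>)"
proof
  show "(\<lambda>\<omega>. c * X t \<omega>) \<in> borel_measurable N" if "0 \<le> t" for t
    using X_meas[OF that] by simp
qed (use cadlag_sign[OF assms X_cadlag] X_0 in auto)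

context killed_levy
begin

definition ext_time :: "real \<Rightarrow> real \<Rightarrow> 'w \<Rightarrow> real" where
  "ext_time c b \<omega> = (if c = 1 then Inf (amax (\<lambda>t. c * X t \<omega>) b) else Sup (amax (\<lambda>t. c * X t \<omega>) b))"

definition ext_value :: "real \<Rightarrow> 'w \<Rightarrow> real" where
  "ext_value c \<omega> = c * wsup (\<lambda>t. c * X t \<omega>) 0 (L \<omega>)"

definition ext_phase :: "real \<Rightarrow> 'w \<Rightarrow> 'n option" where
  "ext_phase c \<omega> = phase_at J (ext_time c (L \<omega>) \<omega>) \<omega>"

lemma sup_ext:
  "run_sup X (L \<omega>) \<omega> = ext_value 1 \<omega>"
  "phase_at_sup X J \<omega> = ext_phase 1 \<omega>"
  by (simp_all add: run_sup_def ext_value_def wsup_def phase_at_sup_def ext_phase_def sup_time_def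
      ext_time_def amax_def left_value_def lv_def)

lemma inf_ext:
  assumes "\<omega> \<in> space M"
  shows "run_inf X (L \<omega>) \<omega> = ext_value (-1) \<omega>"
  "phase_at_inf X J \<omega> = ext_phase (-1) \<omega>"
proof -
  have r: "run_inf X t \<omega> = - wsup (\<lambda>t. - X t \<omega>) 0 t" for t
    by (simp add: run_inf_def wsup_def Inf_real_def image_image)
  then show "run_inf X (L \<omega>) \<omega> = ext_value (-1) \<omega>"
    by (simp add: ext_value_def)
  have lv: "left_value X s \<omega> = - lv (\<lambda>t. - X t \<omega>) s" for s
    using lv_uminus[OF MX.X_cadlag[OF assms], of s] by (simp add: left_value_def lv_def)
  have "min (X s \<omega>) (left_value X s \<omega>) = run_inf X t \<omega> \<longleftrightarrow>
    max (- X s \<omega>) (lv (\<lambda>t. - X t \<omega>) s) = wsup (\<lambda>t. - X t \<omega>) 0 t" for s t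
    unfolding lv r by (auto simp: min_def max_def)
  then show "phase_at_inf X J \<omega> = ext_phase (-1) \<omega>"
    by (simp add: phase_at_inf_def ext_phase_def inf_time_def ext_time_def amax_def)
qed

definition good :: "'w \<Rightarrow> bool" where
  "good \<omega> \<longleftrightarrow> \<omega> \<in> space M \<and> 0 < L \<omega> \<and> (\<forall>t\<ge>0. J t \<omega> = None \<longleftrightarrow> L \<omega> \<le> t) \<and>
    lv (\<lambda>t. X t \<omega>) (L \<omega>) = X (L \<omega>) \<omega> \<and>
    (\<forall>b\<in>\<rat> \<inter> {0..}. \<forall>c\<in>{1,-1}. 0 < ext_time c b \<omega> \<longrightarrow>
      (\<exists>d>0. \<forall>s. \<bar>s - ext_time c b \<omega>\<bar> < d \<longrightarrow> J s \<omega> = J (ext_time c b \<omega>) \<omega>))"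

lemma ext_time_measurable:
  assumes "c = 1 \<or> c = -1" "measurable_path N X" "T \<in> borel_measurable N" "\<And>\<omega>. \<omega> \<in> space N \<Longrightarrow> 0 \<le> T \<omega>"
  shows "(\<lambda>\<omega>. ext_time c (T \<omega>) \<omega>) \<in> borel_measurable N"
proof -
  interpret Y: measurable_path N "\<lambda>t \<omega>. c * X t \<omega>"
    using measurable_path.measurable_path_sign[OF assms(2,1)] .
  show ?thesis
    using Y.Inf_amax_random_time[OF assms(3,4)] Y.Sup_amax_random_time[OF assms(3,4)]
    by (cases "c = 1") (simp_all add: ext_time_def)
qed

lemma ext_value_measurable: "c = 1 \<or> c = -1 \<Longrightarrow> ext_value c \<in> borel_measurable M"
proof -
  assume c: "c = 1 \<or> c = -1"
  interpret Y: measurable_path M "\<lambda>t \<omega>. c * X t \<omega>"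
    using measurable_path.measurable_path_sign[OF MX.measurable_path_axioms c] .
  show ?thesis
    unfolding ext_value_def[abs_def]
    using Y.wsup_0_random_time[OF MJ.lifetime_measurable MJ.lifetime_nonneg] by simp
qed

lemma path_sign: "c = 1 \<or> c = -1 \<Longrightarrow> \<omega> \<in> space M \<Longrightarrow> path (\<lambda>t. c * X t \<omega>)"
  using measurable_path.path[OF measurable_path.measurable_path_sign[OF MX.measurable_path_axioms]] .

lemma ext_time_amax:
  assumes "c = 1 \<or> c = -1" "\<omega> \<in> space M" "0 \<le> b"
  shows "ext_time c b \<omega> \<in> amax (\<lambda>t. c * X t \<omega>) b"
  using path.Inf_amax[OF path_sign[OF assms(1,2)] assms(3)] path.Sup_amax[OF path_sign[OF assms(1,2)] assms(3)]
  unfolding ext_time_def by (cases "c = 1") simp_all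

lemma ext_time_bounds:
  assumes "c = 1 \<or> c = -1" "\<omega> \<in> space M" "0 \<le> b"
  shows "0 \<le> ext_time c b \<omega>" "ext_time c b \<omega> \<le> b"
  using path.amaxD(1,2)[OF path_sign[OF assms(1,2)] ext_time_amax[OF assms]] .

lemma ext_phase_measurable:
  assumes c: "c = 1 \<or> c = -1" shows "Measurable.pred M (\<lambda>\<omega>. ext_phase c \<omega> = i)"
  unfolding ext_phase_def
proof (rule MJ.phase_at_random_time)
  show "(\<lambda>\<omega>. ext_time c (L \<omega>) \<omega>) \<in> borel_measurable M"
    using c MX.measurable_path_axioms MJ.lifetime_measurable MJ.lifetime_nonneg by (rule ext_time_measurable)
qed (use ext_time_bounds[OF c] MJ.lifetime_nonneg in auto)

lemma AE_good: "AE \<omega> in M. good \<omega>"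
proof -
  have "AE \<omega> in M. \<forall>b\<in>\<rat> \<inter> {0..}. \<forall>c\<in>{1,-1}. 0 < ext_time c b \<omega> \<longrightarrow>
      (\<exists>d>0. \<forall>s. \<bar>s - ext_time c b \<omega>\<bar> < d \<longrightarrow> J s \<omega> = J (ext_time c b \<omega>) \<omega>)"
  proof (intro AE_ball_countable' countable_Int1 countable_rat)
    fix b c :: real assume "b \<in> \<rat> \<inter> {0..}" "c \<in> {1,-1}"
    then have "(\<lambda>\<omega>. ext_time c b \<omega>) \<in> borel_measurable VX"
      by (intro ext_time_measurable[where T="\<lambda>_. b"] VXX.measurable_path_axioms) auto
    from AE_J_continuous_at[OF this]
    show "AE \<omega> in M. 0 < ext_time c b \<omega> \<longrightarrow>
      (\<exists>d>0. \<forall>s. \<bar>s - ext_time c b \<omega>\<bar> < d \<longrightarrow> J s \<omega> = J (ext_time c b \<omega>) \<omega>)" .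
  qed auto
  with AE_space AE_lifetime AE_X_continuous_at_lifetime show ?thesis
    by eventually_elim (unfold good_def, blast)
qed

lemma ext_time_restrict:
  assumes c: "c = 1 \<or> c = -1" "\<omega> \<in> space M" and b: "ext_time c t \<omega> < b" "b \<le> t" "0 \<le> t"
  shows "ext_time c b \<omega> = ext_time c t \<omega>"
  using path.Inf_amax_restrict[OF path_sign[OF c] _ b(2,3)] path.Sup_amax_restrict[OF path_sign[OF c] _ b(2,3)] b(1)
  by (simp add: ext_time_def split: if_splits)

lemma phase_near_ext_time:
  assumes g: "good \<omega>" and c: "c = 1 \<or> c = -1"
  shows "\<exists>d>0. \<forall>s. 0 \<le> s \<longrightarrow> s < L \<omega> \<longrightarrow> \<bar>s - ext_time c (L \<omega>) \<omega>\<bar> < d \<longrightarrow> J s \<omega> = ext_phase c \<omega>"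
proof -
  let ?s = "ext_time c (L \<omega>) \<omega>"
  have \<omega>: "\<omega> \<in> space M" and L0: "0 < L \<omega>" using g by (auto simp: good_def)
  note jp = MJ.J_path[OF \<omega>]
  have s: "0 \<le> ?s" "?s \<le> L \<omega>" using ext_time_bounds[OF c \<omega>] L0 by auto
  consider "?s = L \<omega>" | "?s < L \<omega>" "?s = 0" | "?s < L \<omega>" "0 < ?s"
    using s by linarith
  then show ?thesis
  proof cases
    case 1
    obtain i d where d: "0 < d" "\<And>u. L \<omega> - d < u \<Longrightarrow> u < L \<omega> \<Longrightarrow> J u \<omega> = i"
      using jump_path_left[OF jp L0] by blast
    have "ext_phase c \<omega> = i"
      unfolding ext_phase_def phase_at_def if_P[OF 1] unfolding 1 by (rule left_phase_eq[OF L0 d(1)]) (rule d(2))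
    then have "J s \<omega> = ext_phase c \<omega>" if "s < L \<omega>" "\<bar>s - ?s\<bar> < d" for s
      using d(2)[of s] that 1 by simp
    then show ?thesis using d(1) by blast
  next
    case 2
    obtain d where d: "0 < d" "\<And>u. 0 \<le> u \<Longrightarrow> u < d \<Longrightarrow> J u \<omega> = J 0 \<omega>"
      using jump_path_right[OF jp order_refl] by auto
    have "ext_phase c \<omega> = J 0 \<omega>"
      unfolding ext_phase_def phase_at_def using 2 by simp
    then have "J s \<omega> = ext_phase c \<omega>" if "0 \<le> s" "\<bar>s - ?s\<bar> < d" for s
      using d(2)[of s] that 2 by simp
    then show ?thesis using d(1) by blast
  next
    case 3
    obtain b where b: "b \<in> \<rat>" "?s < b" "b < L \<omega>"
      using Rats_dense_in_real[OF 3(1)] by auto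
    have eq: "ext_time c b \<omega> = ?s"
      using b L0 by (intro ext_time_restrict[OF c \<omega>]) auto
    have bc: "b \<in> \<rat> \<inter> {0..}" "c \<in> {1,-1}" using b 3 c by auto
    have all: "\<forall>b\<in>\<rat> \<inter> {0..}. \<forall>c\<in>{1,-1}. 0 < ext_time c b \<omega> \<longrightarrow>
      (\<exists>d>0. \<forall>s. \<bar>s - ext_time c b \<omega>\<bar> < d \<longrightarrow> J s \<omega> = J (ext_time c b \<omega>) \<omega>)"
      using g unfolding good_def by (elim conjE)
    note bspec[OF bspec[OF all bc(1)] bc(2)]
    then have "\<exists>d>0. \<forall>s. \<bar>s - ?s\<bar> < d \<longrightarrow> J s \<omega> = J ?s \<omega>"
      unfolding eq using 3(2) by (rule mp)
    moreover have "ext_phase c \<omega> = J ?s \<omega>"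
      unfolding ext_phase_def phase_at_def by (rule if_not_P) (use 3 in simp)
    ultimately show ?thesis by (simp only:) blast
  qed
qed

lemma argmax_close:
  assumes g: "good \<omega>" and c: "c = 1 \<or> c = -1" and d: "0 < d"
  shows "\<exists>e0>0. \<forall>e. 0 < e \<longrightarrow> e < e0 \<longrightarrow> (\<exists>h0>0. \<forall>h. 0 < h \<longrightarrow> h < h0 \<longrightarrow>
    (\<forall>m::nat. real m * h < L \<omega> \<longrightarrow>
       (\<forall>i::nat. real i * h < L \<omega> \<longrightarrow> c * X (real i * h) \<omega> - c * (e * (real i * h)) \<le> c * X (real m * h) \<omega> - c * (e * (real m * h))) \<longrightarrow>
       \<bar>real m * h - ext_time c (L \<omega>) \<omega>\<bar> < d \<and> \<bar>c * X (real m * h) \<omega> - wsup (\<lambda>t. c * X t \<omega>) 0 (L \<omega>)\<bar> < d))"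
proof -
  have \<omega>: "\<omega> \<in> space M" and L0: "0 < L \<omega>" and lvL: "lv (\<lambda>t. X t \<omega>) (L \<omega>) = X (L \<omega>) \<omega>"
    using g by (auto simp: good_def)
  let ?y = "\<lambda>t. c * X t \<omega>" and ?s = "ext_time c (L \<omega>) \<omega>"
  interpret path ?y by (rule path_sign[OF c \<omega>])
  have lv: "lv ?y (L \<omega>) = ?y (L \<omega>)"
    using c lvL lv_uminus[OF MX.X_cadlag[OF \<omega>], of "L \<omega>"] by auto
  have s: "?s \<in> amax ?y (L \<omega>)" using ext_time_amax[OF c \<omega>] L0 by simp
  show ?thesis
  proof (rule tilted_argmax_close[OF L0 c amaxD(1,2)[OF s] _ _ _ d])
    show "?y r \<le> wsup ?y 0 (L \<omega>)" if "0 \<le> r" "r \<le> L \<omega>" for r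
      using that by (intro wsup_upper[OF x]) auto
    show "\<exists>u v. u < v \<and> (\<forall>r. u < r \<longrightarrow> r < v \<longrightarrow>
        0 < r \<and> r < L \<omega> \<and> \<bar>r - ?s\<bar> < d \<and> wsup ?y 0 (L \<omega>) - e < ?y r)" if "0 < d" "0 < e" for d e
      by (rule amax_approx[OF s L0 lv that]) blast
    show "\<exists>m<wsup ?y 0 (L \<omega>). \<forall>r. 0 \<le> r \<longrightarrow> r \<le> L \<omega> \<longrightarrow> d \<le> c * (?s - r) \<longrightarrow> ?y r \<le> m" if d: "0 < d" for d
    proof (cases "c = 1")
      case True
      show ?thesis
      proof (cases "d \<le> ?s")
        case le: True
        have "wsup ?y 0 (?s - d) < wsup ?y 0 (L \<omega>)"
          using le d True L0 by (intro wsup_init_less) (auto simp: ext_time_def)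
        moreover have "?y r \<le> wsup ?y 0 (?s - d)" if "0 \<le> r" "d \<le> ?s - r" for r
          using that by (intro wsup_upper[OF x]) auto
        ultimately show ?thesis using True by (intro exI[of _ "wsup ?y 0 (?s - d)"]) auto
      next
        case False
        then show ?thesis using True
          by (intro exI[of _ "wsup ?y 0 (L \<omega>) - 1"]) auto
      qed
    next
      case False
      then have c1: "c = -1" using c by simp
      show ?thesis
      proof (cases "?s + d \<le> L \<omega>")
        case le: True
        have "wsup ?y (?s + d) (L \<omega>) < wsup ?y 0 (L \<omega>)"
          using le d False L0 by (intro wsup_tail_less) (auto simp: ext_time_def)
        moreover have "?y r \<le> wsup ?y (?s + d) (L \<omega>)" if "r \<le> L \<omega>" "d \<le> r - ?s" for r
          using that d amaxD(1)[OF s] by (intro wsup_upper[OF x]) auto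
        ultimately show ?thesis using c1 by (intro exI[of _ "wsup ?y (?s + d) (L \<omega>)"]) auto
      next
        case False
        then show ?thesis using c1
          by (intro exI[of _ "wsup ?y 0 (L \<omega>) - 1"]) auto
      qed
    qed
  qed
qed

definition walk :: "real \<Rightarrow> real \<Rightarrow> 'w \<Rightarrow> nat \<Rightarrow> real" where
  "walk e h \<omega> i = X (real i * h) \<omega> - e * (real i * h)"

definition sampled :: "real \<Rightarrow> 'n \<Rightarrow> (real \<Rightarrow> real) \<Rightarrow> (real \<Rightarrow> real) \<Rightarrow> real \<Rightarrow> real \<Rightarrow> nat \<Rightarrow> nat \<Rightarrow> 'w \<Rightarrow> real" where
  "sampled c k f g e h n m \<omega> =
    (if marker c (walk e h \<omega>) n m then f (walk e h \<omega> m) * g (walk e h \<omega> n - walk e h \<omega> m) else 0) *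
    (if J (real m * h) \<omega> = Some k \<and> J (real n * h) \<omega> \<noteq> None \<and> J (real (Suc n) * h) \<omega> = None then 1 else 0)"

lemma sampled_sum_eq:
  assumes g: "good \<omega>" and c: "c = 1 \<or> c = -1" and h: "0 < h"
  shows "\<exists>n m. real n * h < L \<omega> \<and> L \<omega> \<le> real (Suc n) * h \<and> marker c (walk e h \<omega>) n m \<and>
    (\<Sum>n. \<Sum>m\<le>n. sampled c k f p e h n m \<omega>) =
      f (walk e h \<omega> m) * p (walk e h \<omega> n - walk e h \<omega> m) * (if J (real m * h) \<omega> = Some k then 1 else 0)"
proof -
  have L0: "0 < L \<omega>" and J: "\<And>t. 0 \<le> t \<Longrightarrow> J t \<omega> = None \<longleftrightarrow> L \<omega> \<le> t"
    using g by (auto simp: good_def)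
  define n where "n = nat (\<lceil>L \<omega> / h\<rceil> - 1)"
  have "0 < L \<omega> / h" using L0 h by simp
  then have "1 \<le> \<lceil>L \<omega> / h\<rceil>" by linarith
  then have "real n = real_of_int \<lceil>L \<omega> / h\<rceil> - 1" by (simp add: n_def)
  then have "real n < L \<omega> / h" "L \<omega> / h \<le> real n + 1" by linarith+
  then have n: "real n * h < L \<omega>" "L \<omega> \<le> real (Suc n) * h"
    using h by (simp_all add: field_simps)
  obtain m where m: "marker c (walk e h \<omega>) n m"
    using marker_exists[OF c] by blast
  have "(\<Sum>m\<le>n'. sampled c k f p e h n' m \<omega>) = 0" if "n' \<noteq> n" for n'
  proof -
    have "\<not> (J (real n' * h) \<omega> \<noteq> None \<and> J (real (Suc n') * h) \<omega> = None)"
    proof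
      assume "J (real n' * h) \<omega> \<noteq> None \<and> J (real (Suc n') * h) \<omega> = None"
      then have n': "real n' * h < L \<omega>" "L \<omega> \<le> real (Suc n') * h"
        using h J[of "real n' * h"] J[of "real (Suc n') * h"] by (auto simp: not_le simp del: of_nat_Suc)
      have "real n' * h < real (Suc n) * h" "real n * h < real (Suc n') * h"
        using n n' by linarith+
      then have "n' < Suc n" "n < Suc n'"
        using h by (simp_all only: mult_less_cancel_right_pos of_nat_less_iff)
      then show False using that by simp
    qed
    then show ?thesis by (intro sum.neutral) (auto simp: sampled_def)
  qed
  then have "(\<Sum>n. \<Sum>m\<le>n. sampled c k f p e h n m \<omega>) = (\<Sum>m\<le>n. sampled c k f p e h n m \<omega>)"
    by (subst suminf_finite[of "{n}"]) auto
  also have "\<dots> = (\<Sum>m\<le>n. if marker c (walk e h \<omega>) n m then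
      f (walk e h \<omega> m) * p (walk e h \<omega> n - walk e h \<omega> m) * (if J (real m * h) \<omega> = Some k then 1 else 0) else 0)"
  proof (intro sum.cong refl)
    have "J (real n * h) \<omega> \<noteq> None" "J (real (Suc n) * h) \<omega> = None"
      using n J[of "real n * h"] J[of "real (Suc n) * h"] h by (simp_all add: not_le del: of_nat_Suc)
    then show "sampled c k f p e h n m \<omega> = (if marker c (walk e h \<omega>) n m then
      f (walk e h \<omega> m) * p (walk e h \<omega> n - walk e h \<omega> m) * (if J (real m * h) \<omega> = Some k then 1 else 0) else 0)" for m
      by (simp add: sampled_def del: of_nat_Suc)
  qed
  also have "\<dots> = f (walk e h \<omega> m) * p (walk e h \<omega> n - walk e h \<omega> m) * (if J (real m * h) \<omega> = Some k then 1 else 0)"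
    by (rule sum_marker[OF m])
  finally show ?thesis using n m by blast
qed

lemma sampled_tendsto:
  assumes g: "good \<omega>" and c: "c = 1 \<or> c = -1"
    and f: "\<And>x. isCont f x" and p: "\<And>x. isCont p x"
  shows "((\<lambda>q. \<Sum>n. \<Sum>m\<le>n. sampled c k f p (tilt q) (mesh q) n m \<omega>) \<longlongrightarrow>
    f (ext_value c \<omega>) * p (X (L \<omega>) \<omega> - ext_value c \<omega>) * (if ext_phase c \<omega> = Some k then 1 else 0)) iter_seq"
proof -
  have \<omega>: "\<omega> \<in> space M" and L0: "0 < L \<omega>" and lvL: "lv (\<lambda>t. X t \<omega>) (L \<omega>) = X (L \<omega>) \<omega>"
    using g by (auto simp: good_def)
  define P where "P q n m \<longleftrightarrow> real n * mesh q < L \<omega> \<and> L \<omega> \<le> real (Suc n) * mesh q \<and>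
    marker c (walk (tilt q) (mesh q) \<omega>) n m \<and>
    (\<Sum>n. \<Sum>m\<le>n. sampled c k f p (tilt q) (mesh q) n m \<omega>) =
      f (walk (tilt q) (mesh q) \<omega> m) * p (walk (tilt q) (mesh q) \<omega> n - walk (tilt q) (mesh q) \<omega> m) *
      (if J (real m * mesh q) \<omega> = Some k then 1 else 0)" for q n m
  have "\<exists>n m. P q n m" for q
    unfolding P_def by (rule sampled_sum_eq[OF g c]) simp
  then obtain n m where "\<And>q. P q (n q) (m q)"
    by metis
  then have nm: "\<And>q. real (n q) * mesh q < L \<omega>" "\<And>q. L \<omega> \<le> real (Suc (n q)) * mesh q"
    "\<And>q. marker c (walk (tilt q) (mesh q) \<omega>) (n q) (m q)"
    "\<And>q. (\<Sum>n. \<Sum>m\<le>n. sampled c k f p (tilt q) (mesh q) n m \<omega>) =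
      f (walk (tilt q) (mesh q) \<omega> (m q)) * p (walk (tilt q) (mesh q) \<omega> (n q) - walk (tilt q) (mesh q) \<omega> (m q)) *
      (if J (real (m q) * mesh q) \<omega> = Some k then 1 else 0)"
    unfolding P_def by blast+
  define ta where "ta q = real (m q) * mesh q" for q
  define tb where "tb q = real (n q) * mesh q" for q
  have ta: "0 \<le> ta q" "ta q < L \<omega>" for q
  proof -
    have "ta q \<le> tb q"
      unfolding ta_def tb_def using marker_le[OF nm(3)] by (intro mult_right_mono) auto
    then show "0 \<le> ta q" "ta q < L \<omega>" using nm(1)[of q] by (auto simp: ta_def tb_def)
  qed
  have tb: "0 \<le> tb q" "tb q < L \<omega>" "L \<omega> - mesh q \<le> tb q" for q
  proof -
    have "real (Suc (n q)) * mesh q = tb q + mesh q"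
      unfolding tb_def of_nat_Suc[of "n q"] by (simp only: distrib_right mult_1_left)
    then show "0 \<le> tb q" "tb q < L \<omega>" "L \<omega> - mesh q \<le> tb q"
      using nm(1,2)[of q] by (simp_all only: tb_def[symmetric]) (simp_all add: tb_def)
  qed
  have best: "c * X (real i * mesh q) \<omega> - c * (tilt q * (real i * mesh q)) \<le>
      c * X (ta q) \<omega> - c * (tilt q * ta q)" if "real i * mesh q < L \<omega>" for i q
  proof -
    have "real i * mesh q < real (Suc (n q)) * mesh q"
      using that nm(2)[of q] by (rule less_le_trans)
    moreover have "0 < mesh q" by simp
    ultimately have "i \<le> n q"
      by (simp only: mult_less_cancel_right_pos of_nat_less_iff less_Suc_eq_le)
    from marker_extremal[OF c nm(3) this]
    show ?thesis by (simp only: walk_def ta_def right_diff_distrib)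
  qed
  have close: "\<forall>\<^sub>F q in iter_seq. \<bar>ta q - ext_time c (L \<omega>) \<omega>\<bar> < d \<and>
      \<bar>c * X (ta q) \<omega> - wsup (\<lambda>t. c * X t \<omega>) 0 (L \<omega>)\<bar> < d" if "0 < d" for d
    using eventually_iter_seq_tilt_mesh[OF argmax_close[OF g c that]]
  proof eventually_elim
    case (elim q)
    show ?case
      using elim[rule_format, of "m q", folded ta_def] ta(2)[of q] best by blast
  qed
  have tilt0: "((\<lambda>q. tilt q * t q) \<longlongrightarrow> 0) iter_seq" if "\<And>q. 0 \<le> t q" "\<And>q. t q < L \<omega>" for t
  proof (rule tendsto_sandwich[OF always_eventually always_eventually tendsto_const])
    show "((\<lambda>q. tilt q * L \<omega>) \<longlongrightarrow> 0) iter_seq"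
      by (rule tendsto_mult_left_zero[OF tilt_tendsto])
    show "\<forall>q. 0 \<le> tilt q * t q" using that(1) by simp
    show "\<forall>q. tilt q * t q \<le> tilt q * L \<omega>"
      using that(2) by (intro allI mult_left_mono less_imp_le) auto
  qed
  have "((\<lambda>q. c * X (ta q) \<omega>) \<longlongrightarrow> wsup (\<lambda>t. c * X t \<omega>) 0 (L \<omega>)) iter_seq"
    by (rule tendstoI) (use close in \<open>force simp: dist_real_def elim: eventually_mono\<close>)
  then have "((\<lambda>q. c * (c * X (ta q) \<omega>)) \<longlongrightarrow> ext_value c \<omega>) iter_seq"
    unfolding ext_value_def by (intro tendsto_mult tendsto_const)
  moreover have "c * (c * r) = r" for r using c by auto
  ultimately have "((\<lambda>q. X (ta q) \<omega>) \<longlongrightarrow> ext_value c \<omega>) iter_seq" by simp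
  from tendsto_diff[OF this tilt0[OF ta]]
  have lim_a: "((\<lambda>q. walk (tilt q) (mesh q) \<omega> (m q)) \<longlongrightarrow> ext_value c \<omega>) iter_seq"
    by (simp only: walk_def ta_def diff_zero)
  have "filterlim tb (at_left (L \<omega>)) iter_seq"
  proof (rule tendsto_imp_filterlim_at_left)
    show "(tb \<longlongrightarrow> L \<omega>) iter_seq"
    proof (rule tendsto_sandwich[OF always_eventually always_eventually _ tendsto_const])
      show "((\<lambda>q. L \<omega> - mesh q) \<longlongrightarrow> L \<omega>) iter_seq"
        using tendsto_diff[OF tendsto_const mesh_tendsto] by simp
    qed (use tb in \<open>auto intro: less_imp_le\<close>)
  qed (use tb in auto)
  from filterlim_compose[OF cadlag_left[OF MX.X_cadlag[OF \<omega>] L0] this]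
  have "((\<lambda>q. X (tb q) \<omega>) \<longlongrightarrow> X (L \<omega>) \<omega>) iter_seq" by (simp only: lvL)
  from tendsto_diff[OF this tilt0[OF tb(1,2)]]
  have lim_b: "((\<lambda>q. walk (tilt q) (mesh q) \<omega> (n q)) \<longlongrightarrow> X (L \<omega>) \<omega>) iter_seq"
    by (simp only: walk_def tb_def diff_zero)
  obtain d where d: "0 < d" "\<And>s. 0 \<le> s \<Longrightarrow> s < L \<omega> \<Longrightarrow> \<bar>s - ext_time c (L \<omega>) \<omega>\<bar> < d \<Longrightarrow> J s \<omega> = ext_phase c \<omega>"
    using phase_near_ext_time[OF g c] by blast
  from close[OF d(1)]
  have "\<forall>\<^sub>F q in iter_seq. (if J (real (m q) * mesh q) \<omega> = Some k then 1 else 0 :: real) = (if ext_phase c \<omega> = Some k then 1 else 0)"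
  proof eventually_elim
    case (elim q)
    then have "J (ta q) \<omega> = ext_phase c \<omega>" using ta[of q] by (intro d(2)) auto
    then show ?case by (simp only: ta_def)
  qed
  then have lim_J: "((\<lambda>q. if J (real (m q) * mesh q) \<omega> = Some k then 1 else 0 :: real) \<longlongrightarrow> (if ext_phase c \<omega> = Some k then 1 else 0)) iter_seq"
    by (rule tendsto_eventually)
  show ?thesis
    unfolding nm(4)
    by (intro tendsto_mult lim_J isCont_tendsto_compose[OF f] isCont_tendsto_compose[OF p] tendsto_diff lim_a lim_b)
qed

end

section \<open>Random walks\<close>

lemma (in prob_space) indep_vars_inj:
  assumes f: "inj_on f I" and ind: "indep_vars (\<lambda>_. N) X (f ` I)"
  shows "indep_vars (\<lambda>_. N) (\<lambda>i. X (f i)) I"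
  unfolding indep_vars_def2
proof (intro conjI ballI)
  show "X (f i) \<in> measurable M N" if "i \<in> I" for i
    using ind that by (auto simp: indep_vars_def2)
  have ev: "{X (f i) -` A \<inter> space M |A. A \<in> sets N} \<subseteq> events" if "i \<in> I" for i
    using ind that by (auto simp: indep_vars_def2 indep_sets_def)
  show "indep_sets (\<lambda>i. {X (f i) -` A \<inter> space M |A. A \<in> sets N}) I"
  proof (rule indep_setsI[OF ev])
    fix A J assume J: "J \<noteq> {}" "J \<subseteq> I" "finite J" and A: "\<forall>j\<in>J. A j \<in> {X (f j) -` A \<inter> space M |A. A \<in> sets N}"
    define g where "g = inv_into I f"
    have g: "g (f j) = j" if "j \<in> J" for j
      using f J that by (auto simp: g_def)
    have ind': "indep_sets (\<lambda>i. {X i -` A \<inter> space M |A. A \<in> sets N}) (f ` I)"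
      using ind by (simp add: indep_vars_def2)
    have "prob (\<Inter>i\<in>f ` J. A (g i)) = (\<Prod>i\<in>f ` J. prob (A (g i)))"
      by (rule indep_setsD[OF ind']) (use J A g in auto)
    also have "\<dots> = (\<Prod>j\<in>J. prob (A j))"
      using inj_on_subset[OF f J(2)] by (subst prod.reindex) (auto simp: g)
    also have "(\<Inter>i\<in>f ` J. A (g i)) = (\<Inter>j\<in>J. A j)"
      by (auto simp: g)
    finally show "prob (\<Inter>j\<in>J. A j) = (\<Prod>j\<in>J. prob (A j))" .
  qed
qed

definition part :: "(nat \<Rightarrow> real) \<Rightarrow> nat \<Rightarrow> nat \<Rightarrow> real" where
  "part w i j = (\<Sum>l\<in>{i..<j}. w l)"

definition stay :: "real set \<Rightarrow> (real \<Rightarrow> real) \<Rightarrow> nat \<Rightarrow> (nat \<Rightarrow> real) \<Rightarrow> real" where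
  "stay V f m w = (if \<forall>j. 0 < j \<longrightarrow> j \<le> m \<longrightarrow> part w 0 j \<in> V then f (part w 0 m) else 0)"

definition walk_exp :: "real measure \<Rightarrow> real set \<Rightarrow> (real \<Rightarrow> real) \<Rightarrow> nat \<Rightarrow> real" where
  "walk_exp D V f m = (\<integral>w. stay V f m w \<partial>Pi\<^sub>M {..<m} (\<lambda>_. D))"

lemma part_measurable [measurable]:
  "{i..<j} \<subseteq> A \<Longrightarrow> (\<lambda>w. part w i j) \<in> borel_measurable (Pi\<^sub>M A (\<lambda>_. borel))"
  unfolding part_def by (intro borel_measurable_sum measurable_component_singleton) auto

lemma stay_measurable:
  assumes [measurable]: "V \<in> sets borel" "f \<in> borel_measurable borel"
  shows "stay V f m \<in> borel_measurable (Pi\<^sub>M {..<m} (\<lambda>_. borel))"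
proof -
  have [measurable]: "Measurable.pred (Pi\<^sub>M {..<m} (\<lambda>_. borel)) (\<lambda>w. part w 0 j \<in> V)" if "j \<in> {0<..m}" for j
  proof -
    have [measurable]: "(\<lambda>w. part w 0 j) \<in> borel_measurable (Pi\<^sub>M {..<m} (\<lambda>_. borel))"
      using that by (intro part_measurable) auto
    show ?thesis by measurable
  qed
  have "Measurable.pred (Pi\<^sub>M {..<m} (\<lambda>_. borel)) (\<lambda>w. \<forall>j\<in>{0<..m}. part w 0 j \<in> V)"
    by (rule pred_intros_finite) auto
  moreover have "(\<lambda>w. \<forall>j\<in>{0<..m}. part w 0 j \<in> V) = (\<lambda>w. \<forall>j. 0 < j \<longrightarrow> j \<le> m \<longrightarrow> part w 0 j \<in> V)"
    by auto
  ultimately have [measurable]: "Measurable.pred (Pi\<^sub>M {..<m} (\<lambda>_. borel)) (\<lambda>w. \<forall>j. 0 < j \<longrightarrow> j \<le> m \<longrightarrow> part w 0 j \<in> V)"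
    by simp
  have [measurable]: "(\<lambda>w. f (part w 0 m)) \<in> borel_measurable (Pi\<^sub>M {..<m} (\<lambda>_. borel))"
    by (rule measurable_compose[OF part_measurable]) auto
  show ?thesis unfolding stay_def[abs_def] by measurable
qed

lemma up_dn_measurable [measurable]: "up c \<in> sets borel" "dn c \<in> sets borel"
  by (auto simp: up_def dn_def)

context killed_levy
begin

definition step :: "real \<Rightarrow> real \<Rightarrow> nat \<Rightarrow> 'w \<Rightarrow> real" where
  "step e h i \<omega> = walk e h \<omega> (Suc i) - walk e h \<omega> i"

definition step_law :: "real \<Rightarrow> real \<Rightarrow> real measure" where
  "step_law e h = distr M borel (\<lambda>\<omega>. X h \<omega> - e * h)"

context
  fixes e h :: real
  assumes h: "0 < h"
begin

lemma walk_0: "\<omega> \<in> space M \<Longrightarrow> walk e h \<omega> 0 = 0"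
  by (simp add: walk_def MX.X_0)

lemma indep_steps: "indep_vars (\<lambda>_. borel) (step e h) {..<n}"
proof -
  have "indep_vars (\<lambda>_. borel) (\<lambda>i \<omega>. X (real (Suc i) * h) \<omega> - X (real i * h) \<omega>) {..<n}"
    using levy h unfolding levy_process_def by (elim conjE allE[of _ n] allE[of _ "\<lambda>i. real i * h"]) (simp add: algebra_simps)
  then have "indep_vars (\<lambda>_. borel) (\<lambda>i \<omega>. (\<lambda>x. x - e * h) (X (real (Suc i) * h) \<omega> - X (real i * h) \<omega>)) {..<n}"
    by (rule indep_vars_compose2) simp
  moreover have "step e h = (\<lambda>i \<omega>. (\<lambda>x. x - e * h) (X (real (Suc i) * h) \<omega> - X (real i * h) \<omega>))"
    by (simp add: fun_eq_iff step_def walk_def algebra_simps)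
  ultimately show ?thesis by simp
qed

lemma step_measurable [measurable]: "step e h i \<in> borel_measurable M"
  unfolding step_def walk_def using h by (intro borel_measurable_diff borel_measurable_const MX.X_meas) auto

lemma distr_step: "distr M borel (step e h i) = step_law e h"
proof -
  have [measurable]: "X h \<in> borel_measurable M" "X (real i * h + h) \<in> borel_measurable M" "X (real i * h) \<in> borel_measurable M"
    using h by (auto intro!: MX.X_meas)
  have "distr M borel (\<lambda>\<omega>. X (real i * h + h) \<omega> - X (real i * h) \<omega>) = distr M borel (X h)"
    using levy h unfolding levy_process_def by simp
  then have "distr (distr M borel (\<lambda>\<omega>. X (real i * h + h) \<omega> - X (real i * h) \<omega>)) borel (\<lambda>x. x - e * h)
    = distr (distr M borel (X h)) borel (\<lambda>x. x - e * h)" by (rule arg_cong)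
  then have "distr M borel (\<lambda>\<omega>. X (real i * h + h) \<omega> - X (real i * h) \<omega> - e * h) = step_law e h"
    by (simp add: distr_distr o_def step_law_def)
  moreover have "step e h i = (\<lambda>\<omega>. X (real i * h + h) \<omega> - X (real i * h) \<omega> - e * h)"
    by (simp add: fun_eq_iff step_def walk_def algebra_simps)
  ultimately show ?thesis by simp
qed

lemma sets_step_law [simp]: "sets (step_law e h) = sets borel" "space (step_law e h) = UNIV"
  by (simp_all add: step_law_def)

lemma expectation_steps:
  fixes p :: "nat \<Rightarrow> nat" and G :: "(nat \<Rightarrow> real) \<Rightarrow> real"
  assumes p: "inj_on p {..<l}" and G[measurable]: "G \<in> borel_measurable (Pi\<^sub>M {..<l} (\<lambda>_. borel))"
  shows "expectation (\<lambda>\<omega>. G (\<lambda>i\<in>{..<l}. step e h (p i) \<omega>)) = (\<integral>w. G w \<partial>Pi\<^sub>M {..<l} (\<lambda>_. step_law e h))"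
proof (cases "l = 0")
  case True
  have "expectation (\<lambda>\<omega>. r) = r" for r :: real
    by (simp add: prob_space)
  from this[of "G (\<lambda>_. undefined)"] True show ?thesis
    by (simp add: PiM_empty lebesgue_integral_count_space_finite restrict_def)
next
  case False
  define n where "n = Suc (Max (p ` {..<l}))"
  have "p ` {..<l} \<subseteq> {..<n}"
    unfolding n_def by (auto simp: less_Suc_eq_le)
  then have "indep_vars (\<lambda>_. borel) (step e h) (p ` {..<l})"
    using indep_steps indep_vars_subset by blast
  from indep_vars_inj[OF p this]
  have "indep_vars (\<lambda>_. borel) (\<lambda>i. step e h (p i)) {..<l}" .
  then have "distr M (Pi\<^sub>M {..<l} (\<lambda>_. borel)) (\<lambda>\<omega>. \<lambda>i\<in>{..<l}. step e h (p i) \<omega>)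
    = Pi\<^sub>M {..<l} (\<lambda>i. distr M borel (step e h (p i)))"
    using False by (subst indep_vars_iff_distr_eq_PiM[symmetric]) auto
  then have eq: "distr M (Pi\<^sub>M {..<l} (\<lambda>_. borel)) (\<lambda>\<omega>. \<lambda>i\<in>{..<l}. step e h (p i) \<omega>)
    = Pi\<^sub>M {..<l} (\<lambda>_. step_law e h)" by (simp add: distr_step)
  show ?thesis
    unfolding eq[symmetric] by (subst integral_distr) auto
qed

lemma stay_cong: "(\<And>i. i < m \<Longrightarrow> v i = w i) \<Longrightarrow> stay V f m v = stay V f m w"
proof -
  assume "\<And>i. i < m \<Longrightarrow> v i = w i"
  then have "part v 0 j = part w 0 j" if "j \<le> m" for j
    unfolding part_def using that by (intro sum.cong) auto
  then show ?thesis by (auto simp: stay_def)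
qed

lemma expectation_stay:
  assumes "inj_on p {..<l}" "V \<in> sets borel" "f \<in> borel_measurable borel"
  shows "expectation (\<lambda>\<omega>. stay V f l (\<lambda>i. step e h (p i) \<omega>)) = walk_exp (step_law e h) V f l"
proof -
  have "stay V f l (\<lambda>i. step e h (p i) \<omega>) = stay V f l (\<lambda>i\<in>{..<l}. step e h (p i) \<omega>)" for \<omega>
    by (rule stay_cong) simp
  then show ?thesis
    using expectation_steps[OF assms(1) stay_measurable[OF assms(2,3)]] by (simp add: walk_exp_def)
qed

text \<open>The walk before time \<open>m\<close> is looked at backwards from \<open>m\<close>.\<close>

definition pre :: "real set \<Rightarrow> (real \<Rightarrow> real) \<Rightarrow> nat \<Rightarrow> 'w \<Rightarrow> real" where
  "pre V f m \<omega> = stay V f m (\<lambda>i. step e h (m - 1 - i) \<omega>)"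

definition post :: "real set \<Rightarrow> (real \<Rightarrow> real) \<Rightarrow> nat \<Rightarrow> nat \<Rightarrow> 'w \<Rightarrow> real" where
  "post V f m l \<omega> = stay V f l (\<lambda>i. step e h (m + i) \<omega>)"

lemma pre_eq:
  assumes "\<omega> \<in> space M"
  shows "pre V f m \<omega> = (if \<forall>i<m. walk e h \<omega> m - walk e h \<omega> i \<in> V then f (walk e h \<omega> m) else 0)"
proof -
  have part: "part (\<lambda>i. step e h (m - 1 - i) \<omega>) 0 j = walk e h \<omega> m - walk e h \<omega> (m - j)" if "j \<le> m" for j
    using that
  proof (induction j)
    case (Suc j)
    have "part (\<lambda>i. step e h (m - 1 - i) \<omega>) 0 (Suc j) = part (\<lambda>i. step e h (m - 1 - i) \<omega>) 0 j + step e h (m - 1 - j) \<omega>"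
      by (simp add: part_def)
    also have "step e h (m - 1 - j) \<omega> = walk e h \<omega> (m - j) - walk e h \<omega> (m - Suc j)"
      using Suc.prems by (simp add: step_def Suc_diff_Suc)
    finally show ?case using Suc by simp
  qed (simp add: part_def)
  have eq: "(\<forall>j. 0 < j \<longrightarrow> j \<le> m \<longrightarrow> part (\<lambda>i. step e h (m - 1 - i) \<omega>) 0 j \<in> V) \<longleftrightarrow> (\<forall>i<m. walk e h \<omega> m - walk e h \<omega> i \<in> V)"
  proof
    assume *: "\<forall>j. 0 < j \<longrightarrow> j \<le> m \<longrightarrow> part (\<lambda>i. step e h (m - 1 - i) \<omega>) 0 j \<in> V"
    show "\<forall>i<m. walk e h \<omega> m - walk e h \<omega> i \<in> V"
    proof (intro allI impI)
      fix i assume "i < m"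
      then show "walk e h \<omega> m - walk e h \<omega> i \<in> V"
        using *[rule_format, of "m - i"] part[of "m - i"] by simp
    qed
  next
    assume *: "\<forall>i<m. walk e h \<omega> m - walk e h \<omega> i \<in> V"
    show "\<forall>j. 0 < j \<longrightarrow> j \<le> m \<longrightarrow> part (\<lambda>i. step e h (m - 1 - i) \<omega>) 0 j \<in> V"
      using * part by simp
  qed
  show ?thesis
    unfolding pre_def stay_def eq using part[of m] walk_0[OF assms] by auto
qed

lemma post_eq:
  "post V f m l \<omega> = (if \<forall>j. m < j \<longrightarrow> j \<le> m + l \<longrightarrow> walk e h \<omega> j - walk e h \<omega> m \<in> V
    then f (walk e h \<omega> (m + l) - walk e h \<omega> m) else 0)"
proof -
  have part: "part (\<lambda>i. step e h (m + i) \<omega>) 0 j = walk e h \<omega> (m + j) - walk e h \<omega> m" for j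
    by (induction j) (simp_all add: part_def step_def)
  have eq: "(\<forall>j. 0 < j \<longrightarrow> j \<le> l \<longrightarrow> part (\<lambda>i. step e h (m + i) \<omega>) 0 j \<in> V) \<longleftrightarrow>
    (\<forall>j. m < j \<longrightarrow> j \<le> m + l \<longrightarrow> walk e h \<omega> j - walk e h \<omega> m \<in> V)"
  proof
    assume *: "\<forall>j. 0 < j \<longrightarrow> j \<le> l \<longrightarrow> part (\<lambda>i. step e h (m + i) \<omega>) 0 j \<in> V"
    show "\<forall>j. m < j \<longrightarrow> j \<le> m + l \<longrightarrow> walk e h \<omega> j - walk e h \<omega> m \<in> V"
    proof (intro allI impI)
      fix j assume "m < j" "j \<le> m + l"
      then show "walk e h \<omega> j - walk e h \<omega> m \<in> V"
        using *[rule_format, of "j - m"] part[of "j - m"] by simp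
    qed
  next
    assume *: "\<forall>j. m < j \<longrightarrow> j \<le> m + l \<longrightarrow> walk e h \<omega> j - walk e h \<omega> m \<in> V"
    show "\<forall>j. 0 < j \<longrightarrow> j \<le> l \<longrightarrow> part (\<lambda>i. step e h (m + i) \<omega>) 0 j \<in> V"
      using * part by simp
  qed
  show ?thesis
    unfolding post_def stay_def eq by (simp only: part)
qed

lemma marker_pre_post:
  assumes "\<omega> \<in> space M" "m \<le> n"
  shows "(if marker c (walk e h \<omega>) n m then f (walk e h \<omega> m) * g (walk e h \<omega> n - walk e h \<omega> m) else 0) =
    pre (up c) f m \<omega> * post (dn c) g m (n - m) \<omega>"
  using assms(2) unfolding pre_eq[OF assms(1)] post_eq marker_def by auto

lemma indep_pre_post:
  assumes V: "V \<in> sets borel" "V' \<in> sets borel" and f: "f \<in> borel_measurable borel" "g \<in> borel_measurable borel"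
  shows "indep_var borel (pre V f m) borel (post V' g m l)"
proof -
  have i: "indep_var (Pi\<^sub>M {..<m} (\<lambda>_. borel)) (\<lambda>\<omega>. \<lambda>i\<in>{..<m}. step e h i \<omega>)
      (Pi\<^sub>M {m..<m+l} (\<lambda>_. borel)) (\<lambda>\<omega>. \<lambda>i\<in>{m..<m+l}. step e h i \<omega>)"
    by (rule indep_var_restrict[OF indep_steps[of "m + l"]]) auto
  have 1: "(\<lambda>w. stay V f m (\<lambda>i\<in>{..<m}. w (m - 1 - i))) \<in> borel_measurable (Pi\<^sub>M {..<m} (\<lambda>_. borel))"
    by (rule measurable_compose[OF _ stay_measurable[OF V(1) f(1)]])
      (intro measurable_restrict measurable_component_singleton, auto)
  have 2: "(\<lambda>w. stay V' g l (\<lambda>i\<in>{..<l}. w (m + i))) \<in> borel_measurable (Pi\<^sub>M {m..<m+l} (\<lambda>_. borel))"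
    by (rule measurable_compose[OF _ stay_measurable[OF V(2) f(2)]])
      (intro measurable_restrict measurable_component_singleton, auto)
  have p: "(\<lambda>w. stay V f m (\<lambda>i\<in>{..<m}. w (m - 1 - i))) \<circ> (\<lambda>\<omega>. \<lambda>i\<in>{..<m}. step e h i \<omega>) = pre V f m"
    by (auto simp: fun_eq_iff pre_def intro!: stay_cong)
  have q: "(\<lambda>w. stay V' g l (\<lambda>i\<in>{..<l}. w (m + i))) \<circ> (\<lambda>\<omega>. \<lambda>i\<in>{m..<m+l}. step e h i \<omega>) = post V' g m l"
    by (auto simp: fun_eq_iff post_def intro!: stay_cong)
  show ?thesis
    using indep_var_compose[OF i 1 2] unfolding p q .
qed

lemma pre_post_measurable:
  assumes V: "V \<in> sets borel" "V' \<in> sets borel" and f: "f \<in> borel_measurable borel" "g \<in> borel_measurable borel"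
  shows "pre V f m \<in> borel_measurable M" "post V' g m l \<in> borel_measurable M"
  using indep_var_rv1[OF indep_pre_post[OF assms]] indep_var_rv2[OF indep_pre_post[OF assms]] by auto

lemma stay_bounds: "(\<And>x. 0 \<le> f x \<and> f x \<le> 1) \<Longrightarrow> 0 \<le> stay V f m w \<and> stay V f m w \<le> 1"
  by (simp add: stay_def)

lemma expectation_pre_post:
  assumes V: "V \<in> sets borel" "V' \<in> sets borel" and f: "f \<in> borel_measurable borel" "g \<in> borel_measurable borel"
    and bd: "\<And>x. 0 \<le> f x \<and> f x \<le> 1" "\<And>x. 0 \<le> g x \<and> g x \<le> 1"
  shows "expectation (\<lambda>\<omega>. pre V f m \<omega> * post V' g m l \<omega>) =
    walk_exp (step_law e h) V f m * walk_exp (step_law e h) V' g l"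
proof -
  note m = pre_post_measurable[OF V f]
  have int: "integrable M (pre V f m)" "integrable M (post V' g m l)"
    using stay_bounds[of f, OF bd(1)] stay_bounds[of g, OF bd(2)] m
    by (auto intro!: integrable_const_bound[where B=1] simp: pre_def post_def)
  have "inj_on (\<lambda>i. m - 1 - i) {..<m}" by (auto simp: inj_on_def)
  then have "expectation (pre V f m) = walk_exp (step_law e h) V f m"
    unfolding pre_def[abs_def] by (rule expectation_stay[OF _ V(1) f(1)])
  moreover have "expectation (post V' g m l) = walk_exp (step_law e h) V' g l"
    unfolding post_def[abs_def] by (rule expectation_stay[OF _ V(2) f(2)]) (auto simp: inj_on_def)
  ultimately show ?thesis
    using indep_var_lebesgue_integral[OF indep_pre_post[OF V f] int] by simp
qed

end

end

section \<open>The law of the sampled extremum\<close>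

locale decaying_killed_levy = killed_levy M X J a U
  for M :: "'w measure" and X :: "real \<Rightarrow> 'w \<Rightarrow> real" and J :: "real \<Rightarrow> 'w \<Rightarrow> 'n::finite option"
    and a :: "real^'n" and U :: "real^'n^'n" +
  assumes surv_vanishes: "\<And>i. ((\<lambda>t. surv U t i) \<longlongrightarrow> 0) at_top"
begin

lemma prob_space_indep_mult:
  assumes W: "W \<in> borel_measurable VX" "\<And>\<omega>. \<bar>W \<omega>\<bar> \<le> 1" and B: "B \<in> sets VJ"
  shows "expectation (\<lambda>\<omega>. W \<omega> * indicator B \<omega>) = expectation W * prob B"
proof -
  have BM: "B \<in> events" using B sets_V by auto
  have WM: "W \<in> borel_measurable M"
    using W(1) sets_V(1) by (auto simp: measurable_def)
  have iB: "(indicator B :: 'w \<Rightarrow> real) \<in> borel_measurable VJ" using B by simp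
  have "indep_var borel W borel (indicator B :: 'w \<Rightarrow> real)"
    unfolding indep_var_eq
  proof (intro conjI WM)
    show "(indicator B :: 'w \<Rightarrow> real) \<in> borel_measurable M" using BM by simp
    have sub: "sigma_sets (space M) {Y -` A \<inter> space M |A. A \<in> sets borel} \<subseteq> sets V"
      if "Y \<in> borel_measurable V" "space V = space M" for Y :: "'w \<Rightarrow> real" and V
    proof -
      have "{Y -` A \<inter> space V |A. A \<in> sets borel} \<subseteq> sets V"
        using measurable_sets[OF that(1)] by auto
      from sets.sigma_sets_subset[OF this] show ?thesis by (simp only: that(2))
    qed
    show "indep_set (sigma_sets (space M) {W -` A \<inter> space M |A. A \<in> sets borel})
      (sigma_sets (space M) {(indicator B :: 'w \<Rightarrow> real) -` A \<inter> space M |A. A \<in> sets borel})"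
      unfolding indep_set_def
      by (rule indep_sets_mono_sets[OF indep_XJ[unfolded indep_set_def]])
        (use sub[OF W(1)] sub[OF iB] in \<open>auto split: bool.splits\<close>)
  qed
  then have "expectation (\<lambda>\<omega>. W \<omega> * indicator B \<omega>) = expectation W * expectation (indicator B)"
    using W(2) WM BM
    by (intro indep_var_lebesgue_integral) (auto intro!: integrable_const_bound[where B=1])
  then show ?thesis using BM sets.sets_into_space[OF BM] by (simp add: Int_absorb2)
qed

lemma walk_measurable_VX: "0 \<le> h \<Longrightarrow> (\<lambda>\<omega>. walk e h \<omega> i) \<in> borel_measurable VX"
  unfolding walk_def by (intro borel_measurable_diff borel_measurable_const VXX.X_meas) simp

lemma prob_phase_pattern:
  assumes "0 \<le> s" "s \<le> t" "t < u"
  shows "prob {\<omega> \<in> space M. J s \<omega> = Some k \<and> J t \<omega> \<noteq> None \<and> J u \<omega> = None} =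
    occ_prob a U s k * (surv U (t - s) k - surv U (u - s) k)"
proof -
  have [measurable]: "J s \<in> measurable M (count_space UNIV)" "J t \<in> measurable M (count_space UNIV)" "J u \<in> measurable M (count_space UNIV)"
    using assms by auto
  let ?A = "{\<omega> \<in> space M. J s \<omega> = Some k \<and> J t \<omega> \<noteq> None}"
  let ?B = "{\<omega> \<in> space M. J s \<omega> = Some k \<and> J u \<omega> \<noteq> None}"
  let ?C = "{\<omega> \<in> space M. J s \<omega> = Some k \<and> J t \<omega> \<noteq> None \<and> J u \<omega> = None}"
  have "AE \<omega> in M. J t \<omega> = None \<longrightarrow> J u \<omega> = None"
    using AE_absorbing
  proof eventually_elim
    case (elim \<omega>)
    have "0 \<le> t" using assms by simp
    with elim assms(3) show ?case by blast
  qed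
  then have "AE \<omega> in M. \<omega> \<in> ?A \<longleftrightarrow> \<omega> \<in> ?C \<union> ?B"
    by eventually_elim auto
  then have "prob ?A = prob (?C \<union> ?B)"
    by (rule finite_measure_eq_AE) measurable
  also have "\<dots> = prob ?C + prob ?B"
    by (rule finite_measure_Union) auto
  finally have *: "prob ?A = prob ?C + prob ?B" .
  have "prob ?A = occ_prob a U s k * surv U (t - s) k" "prob ?B = occ_prob a U s k * surv U (u - s) k"
    using assms by (intro prob_J_alive; simp)+
  with * show ?thesis by (simp only: right_diff_distrib)
qed

lemma expectation_sampled:
  assumes h: "0 < h" and "m \<le> n"
    and f: "f \<in> borel_measurable borel" "g \<in> borel_measurable borel"
    and bd: "\<And>x. 0 \<le> f x \<and> f x \<le> 1" "\<And>x. 0 \<le> g x \<and> g x \<le> 1"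
  shows "sampled c k f g e h n m \<in> borel_measurable M" "\<And>\<omega>. 0 \<le> sampled c k f g e h n m \<omega>"
    "\<And>\<omega>. sampled c k f g e h n m \<omega> \<le> (if J (real n * h) \<omega> \<noteq> None then 1 else 0)"
    "expectation (sampled c k f g e h n m) =
      walk_exp (step_law e h) (up c) f m * walk_exp (step_law e h) (dn c) g (n - m) *
      (occ_prob a U (real m * h) k * (surv U (real (n - m) * h) k - surv U (real (Suc (n - m)) * h) k))"
proof -
  define W where "W \<omega> = (if marker c (walk e h \<omega>) n m then f (walk e h \<omega> m) * g (walk e h \<omega> n - walk e h \<omega> m) else 0)" for \<omega>
  define B where "B = {\<omega> \<in> space M. J (real m * h) \<omega> = Some k \<and> J (real n * h) \<omega> \<noteq> None \<and> J (real (Suc n) * h) \<omega> = None}"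
  have [measurable]: "(\<lambda>\<omega>. walk e h \<omega> i) \<in> borel_measurable VX" for i
    using h by (intro walk_measurable_VX) simp
  note [measurable] = f
  have p1: "Measurable.pred VX (\<lambda>\<omega>. \<forall>i\<in>{..<m}. walk e h \<omega> m - walk e h \<omega> i \<in> up c)"
    by (rule pred_intros_finite) measurable
  have p2: "Measurable.pred VX (\<lambda>\<omega>. \<forall>j\<in>{m<..n}. walk e h \<omega> j - walk e h \<omega> m \<in> dn c)"
    by (rule pred_intros_finite) measurable
  have "Measurable.pred VX (\<lambda>\<omega>. (\<forall>i\<in>{..<m}. walk e h \<omega> m - walk e h \<omega> i \<in> up c) \<and> (\<forall>j\<in>{m<..n}. walk e h \<omega> j - walk e h \<omega> m \<in> dn c))"
    using p1 p2 by (rule pred_intros_logic)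
  moreover have "(\<lambda>\<omega>. (\<forall>i\<in>{..<m}. walk e h \<omega> m - walk e h \<omega> i \<in> up c) \<and> (\<forall>j\<in>{m<..n}. walk e h \<omega> j - walk e h \<omega> m \<in> dn c)) = (\<lambda>\<omega>. marker c (walk e h \<omega>) n m)"
    using assms(2) by (auto simp: marker_def fun_eq_iff)
  ultimately have [measurable]: "Measurable.pred VX (\<lambda>\<omega>. marker c (walk e h \<omega>) n m)" by simp
  have W: "W \<in> borel_measurable VX" unfolding W_def by measurable
  have Wbd: "0 \<le> W \<omega>" "W \<omega> \<le> 1" for \<omega>
    using bd(1)[of "walk e h \<omega> m"] bd(2)[of "walk e h \<omega> n - walk e h \<omega> m"] by (auto simp: W_def mult_le_one)
  have [measurable]: "J (real i * h) \<in> measurable VJ (count_space UNIV)" for i :: nat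
    using h by (intro VJJ.J_meas) simp
  have "{\<omega> \<in> space VJ. J (real m * h) \<omega> = Some k \<and> J (real n * h) \<omega> \<noteq> None \<and> J (real (Suc n) * h) \<omega> = None} \<in> sets VJ"
    by measurable
  then have B: "B \<in> sets VJ" by (simp add: B_def)
  have eq: "sampled c k f g e h n m \<omega> = W \<omega> * indicator B \<omega>" if "\<omega> \<in> space M" for \<omega>
    using that by (simp add: sampled_def W_def B_def indicator_def)
  have WM: "W \<in> borel_measurable M"
    using W sets_V(1) by (auto simp: measurable_def)
  have "(\<lambda>\<omega>. W \<omega> * indicator B \<omega>) \<in> borel_measurable M"
    using WM B sets_V(2) by auto
  then show "sampled c k f g e h n m \<in> borel_measurable M"
    using eq by (simp cong: measurable_cong)
  show "0 \<le> sampled c k f g e h n m \<omega>" "sampled c k f g e h n m \<omega> \<le> (if J (real n * h) \<omega> \<noteq> None then 1 else 0)" for \<omega>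
    using Wbd[of \<omega>] by (simp_all add: sampled_def W_def[symmetric])
  have "expectation (sampled c k f g e h n m) = expectation (\<lambda>\<omega>. W \<omega> * indicator B \<omega>)"
    using eq by (intro Bochner_Integration.integral_cong) auto
  also have "\<dots> = expectation W * prob B"
    using Wbd by (intro prob_space_indep_mult W B) auto
  also have "expectation W = expectation (\<lambda>\<omega>. pre e h (up c) f m \<omega> * post e h (dn c) g m (n - m) \<omega>)"
    unfolding W_def by (intro Bochner_Integration.integral_cong refl marker_pre_post[OF h _ assms(2)])
  also have "\<dots> = walk_exp (step_law e h) (up c) f m * walk_exp (step_law e h) (dn c) g (n - m)"
    by (rule expectation_pre_post[OF h up_dn_measurable f bd])
  also have "prob B = occ_prob a U (real m * h) k * (surv U (real n * h - real m * h) k - surv U (real (Suc n) * h - real m * h) k)"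
    unfolding B_def using h assms(2) by (intro prob_phase_pattern) auto
  also have "real n * h - real m * h = real (n - m) * h"
    using assms(2) by (simp add: of_nat_diff algebra_simps)
  also have "real (Suc n) * h - real m * h = real (Suc (n - m)) * h"
    using assms(2) by (simp add: of_nat_diff algebra_simps)
  finally show "expectation (sampled c k f g e h n m) =
      walk_exp (step_law e h) (up c) f m * walk_exp (step_law e h) (dn c) g (n - m) *
      (occ_prob a U (real m * h) k * (surv U (real (n - m) * h) k - surv U (real (Suc (n - m)) * h) k))" .
qed

lemma walk_exp_bounds:
  assumes h: "0 < h" and f: "f \<in> borel_measurable borel" "\<And>x. 0 \<le> f x \<and> f x \<le> 1" and V: "V \<in> sets borel"
  shows "0 \<le> walk_exp (step_law e h) V f m" "walk_exp (step_law e h) V f m \<le> 1"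
proof -
  have i: "inj_on (\<lambda>i. i) {..<m}" by simp
  note eq = expectation_stay[OF h i V f(1), of e, symmetric]
  have bd: "0 \<le> stay V f m w \<and> stay V f m w \<le> 1" for w
    by (rule stay_bounds[OF h f(2)])
  show "0 \<le> walk_exp (step_law e h) V f m"
    unfolding eq using bd by (intro integral_nonneg_AE) auto
  show "walk_exp (step_law e h) V f m \<le> 1"
    unfolding eq
  proof (rule integral_le_const)
    show "integrable M (\<lambda>\<omega>. stay V f m (\<lambda>i. step e h i \<omega>))"
    proof (rule integrable_const_bound[where B=1])
      have "post e h V f 0 m \<in> borel_measurable M"
        by (rule pre_post_measurable(2)[OF h V V f(1) f(1)])
      then show "(\<lambda>\<omega>. stay V f m (\<lambda>i. step e h i \<omega>)) \<in> borel_measurable M"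
        by (simp add: post_def[OF h, abs_def])
    qed (use bd in auto)
  qed (use bd in auto)
qed

lemma initial_nonneg: "0 \<le> a $ i" and initial_sum_le: "(\<Sum>i\<in>UNIV. a $ i) \<le> 1"
proof -
  show "0 \<le> a $ i" for i
    unfolding prob_J_0(1)[symmetric] by simp
  have "(\<Sum>y\<in>UNIV. prob {\<omega> \<in> space M. J 0 \<omega> = y}) = 1"
    using prob_finite_split[of "J 0" "\<lambda>_. True"] by (simp add: prob_space)
  then show "(\<Sum>i\<in>UNIV. a $ i) \<le> 1"
    by (simp add: sum_UNIV_option prob_J_0)
qed

lemma occ_prob_nonneg: "0 \<le> t \<Longrightarrow> 0 \<le> occ_prob a U t k"
  unfolding occ_prob_def by (intro sum_nonneg mult_nonneg_nonneg initial_nonneg trans_nonneg[OF U])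

lemma decay_bounds:
  obtains r C where "0 < r" "0 < C" "\<And>t i. 0 \<le> t \<Longrightarrow> surv U t i \<le> C * exp (- (r * t))"
    "\<And>t. 0 \<le> t \<Longrightarrow> (\<Sum>k\<in>UNIV. occ_prob a U t k) \<le> C * exp (- (r * t))"
    "\<And>t k. 0 \<le> t \<Longrightarrow> occ_prob a U t k \<le> C * exp (- (r * t))"
proof -
  obtain r C where rC: "0 < r" "0 < C" "\<And>t i. 0 \<le> t \<Longrightarrow> surv U t i \<le> C * exp (- (r * t))"
    using surv_decay[OF U surv_vanishes] by blast
  have s: "(\<Sum>k\<in>UNIV. occ_prob a U t k) \<le> C * exp (- (r * t))" if "0 \<le> t" for t
  proof -
    have "(\<Sum>k\<in>UNIV. occ_prob a U t k) = (\<Sum>i\<in>UNIV. a $ i * surv U t i)"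
      by (simp add: occ_prob_def surv_def sum_distrib_left) (rule sum.swap)
    also have "\<dots> \<le> (\<Sum>i\<in>UNIV. a $ i * (C * exp (- (r * t))))"
      by (intro sum_mono mult_left_mono rC that initial_nonneg)
    also have "\<dots> = (\<Sum>i\<in>UNIV. a $ i) * (C * exp (- (r * t)))"
      by (simp add: sum_distrib_right)
    also have "\<dots> \<le> 1 * (C * exp (- (r * t)))"
      using rC(2) initial_sum_le by (intro mult_right_mono) auto
    finally show ?thesis by simp
  qed
  moreover have "occ_prob a U t k \<le> C * exp (- (r * t))" if "0 \<le> t" for t k
    using member_le_sum[of k UNIV "\<lambda>k. occ_prob a U t k"] s[OF that] occ_prob_nonneg[OF that] by force
  ultimately show ?thesis using rC that by blast
qed

lemma geometric_summable:
  assumes "0 < r" "0 < h" shows "summable (\<lambda>n. exp (- (r * (real n * h))))"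
proof -
  have "exp (- (r * (real n * h))) = exp (- (r * h)) ^ n" for n
    by (simp add: exp_of_nat_mult[symmetric] mult_ac)
  moreover have "norm (exp (- (r * h))) < 1" using assms by simp
  ultimately show ?thesis by (simp only: summable_geometric)
qed

definition pre_series :: "real \<Rightarrow> 'n \<Rightarrow> (real \<Rightarrow> real) \<Rightarrow> real \<Rightarrow> real \<Rightarrow> real" where
  "pre_series c k f e h = (\<Sum>m. walk_exp (step_law e h) (up c) f m * occ_prob a U (real m * h) k)"

definition post_series :: "real \<Rightarrow> 'n \<Rightarrow> (real \<Rightarrow> real) \<Rightarrow> real \<Rightarrow> real \<Rightarrow> real" where
  "post_series c k g e h = (\<Sum>l. walk_exp (step_law e h) (dn c) g l * (surv U (real l * h) k - surv U (real (Suc l) * h) k))"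

lemma series_summable:
  assumes h: "0 < h" and f: "f \<in> borel_measurable borel" "\<And>x. 0 \<le> f x \<and> f x \<le> 1"
  shows "summable (\<lambda>m. walk_exp (step_law e h) (up c) f m * occ_prob a U (real m * h) k)"
    and "summable (\<lambda>l. walk_exp (step_law e h) (dn c) f l * surv U (real l * h) k)"
    and "summable (\<lambda>l. walk_exp (step_law e h) (dn c) f l * (surv U (real l * h) k - surv U (real (Suc l) * h) k))"
proof -
  obtain r C where rC: "0 < r" "0 < C" "\<And>t i. 0 \<le> t \<Longrightarrow> surv U t i \<le> C * exp (- (r * t))"
    "\<And>t k. 0 \<le> t \<Longrightarrow> occ_prob a U t k \<le> C * exp (- (r * t))"
    by (rule decay_bounds) blast
  have summ: "summable (\<lambda>n. C * exp (- (r * (real n * h))))"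
    by (intro summable_mult geometric_summable rC h)
  have le: "norm (w * x) \<le> C * exp (- (r * t))" if "0 \<le> w" "w \<le> 1" "0 \<le> x" "x \<le> C * exp (- (r * t))" for w x t
    using that mult_mono[of w 1 x "C * exp (- (r * t))"] by (simp add: abs_mult)
  note wu = walk_exp_bounds[OF h f up_dn_measurable(1)[of c], of e]
  note wd = walk_exp_bounds[OF h f up_dn_measurable(2)[of c], of e]
  have t: "0 \<le> real n * h" for n using h by simp
  show "summable (\<lambda>m. walk_exp (step_law e h) (up c) f m * occ_prob a U (real m * h) k)"
    by (rule summable_comparison_test'[OF summ]) (intro le wu occ_prob_nonneg rC(4) t)
  show "summable (\<lambda>l. walk_exp (step_law e h) (dn c) f l * surv U (real l * h) k)"
    by (rule summable_comparison_test'[OF summ]) (intro le wd surv_nonneg[OF U] rC(3) t)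
  show "summable (\<lambda>l. walk_exp (step_law e h) (dn c) f l * (surv U (real l * h) k - surv U (real (Suc l) * h) k))"
  proof (rule summable_comparison_test'[OF summ], intro le wd)
    fix n
    have "real n * h \<le> real (Suc n) * h" using h by (intro mult_right_mono) auto
    then show "0 \<le> surv U (real n * h) k - surv U (real (Suc n) * h) k"
      using surv_antimono[OF U t] by simp
    show "surv U (real n * h) k - surv U (real (Suc n) * h) k \<le> C * exp (- (r * (real n * h)))"
      using surv_nonneg[OF U t, of "Suc n" k] rC(3)[OF t, of n k] by linarith
  qed
qed

lemma expectation_sampled_sum:
  assumes h: "0 < h"
    and f: "f \<in> borel_measurable borel" "g \<in> borel_measurable borel"
    and bd: "\<And>x. 0 \<le> f x \<and> f x \<le> 1" "\<And>x. 0 \<le> g x \<and> g x \<le> 1"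
  shows "expectation (\<lambda>\<omega>. \<Sum>n. \<Sum>m\<le>n. sampled c k f g e h n m \<omega>) = pre_series c k f e h * post_series c k g e h"
proof -
  define A where "A m = walk_exp (step_law e h) (up c) f m * occ_prob a U (real m * h) k" for m
  define B where "B l = walk_exp (step_law e h) (dn c) g l * (surv U (real l * h) k - surv U (real (Suc l) * h) k)" for l
  define F where "F n \<omega> = (\<Sum>m\<le>n. sampled c k f g e h n m \<omega>)" for n \<omega>
  note samp = expectation_sampled[OF h _ f bd, of _ _ c k e]
  have int: "integrable M (sampled c k f g e h n m)" if "m \<le> n" for n m
  proof (rule integrable_const_bound[where B=1])
    show "AE \<omega> in M. norm (sampled c k f g e h n m \<omega>) \<le> 1"
      using samp(2)[OF that] samp(3)[OF that] by (intro always_eventually allI) (simp add: order_trans split: if_splits, smt (verit))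
  qed (rule samp(1)[OF that])
  have intF: "integrable M (F n)" for n
    unfolding F_def[abs_def] using int by (intro Bochner_Integration.integrable_sum) auto
  have Fpos: "0 \<le> F n \<omega>" for n \<omega>
    unfolding F_def using samp(2) by (intro sum_nonneg) auto
  have EF: "expectation (F n) = (\<Sum>m\<le>n. A m * B (n - m))" for n
    unfolding F_def[abs_def]
    by (subst Bochner_Integration.integral_sum) (auto simp: int samp(4) A_def B_def mult_ac intro!: sum.cong)
  have sA: "summable (\<lambda>k. norm (A k))" and sB: "summable (\<lambda>k. norm (B k))"
  proof -
    have "0 \<le> A m" for m
      unfolding A_def using h by (intro mult_nonneg_nonneg walk_exp_bounds[OF h f(1) bd(1)] up_dn_measurable occ_prob_nonneg) simp_all
    then show "summable (\<lambda>k. norm (A k))"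
      using series_summable(1)[OF h f(1) bd(1), of e c k, folded A_def] by simp
    have "0 \<le> B m" for m
    proof -
      have "0 \<le> real m * h" "real m * h \<le> real (Suc m) * h" using h by (auto intro!: mult_right_mono)
      from surv_antimono[OF U this, of k] show ?thesis
        unfolding B_def
        by (intro mult_nonneg_nonneg walk_exp_bounds[OF h f(2) bd(2)] up_dn_measurable) simp
    qed
    then show "summable (\<lambda>k. norm (B k))"
      using series_summable(3)[OF h f(2) bd(2), of e c k, folded B_def] by simp
  qed
  note cauchy = Cauchy_product_sums[OF sA sB]
  have "expectation (\<lambda>\<omega>. \<Sum>n. F n \<omega>) = (\<Sum>n. expectation (F n))"
  proof (rule integral_suminf[OF intF])
    show "AE \<omega> in M. summable (\<lambda>n. norm (F n \<omega>))"
      using AE_good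
    proof eventually_elim
      case (elim \<omega>)
      obtain N :: nat where N: "L \<omega> / h < real N" using reals_Archimedean2 by blast
      have "F n \<omega> = 0" if "N \<le> n" for n
      proof -
        have "L \<omega> \<le> real n * h"
        proof -
          have "L \<omega> / h \<le> real n" using N that by simp
          then show ?thesis using h by (simp add: pos_divide_le_eq)
        qed
        then have "J (real n * h) \<omega> = None" using elim h unfolding good_def by simp
        then show ?thesis by (simp add: F_def sampled_def)
      qed
      then show ?case
        by (intro summable_finite[of "{..<N}"]) auto
    qed
    show "summable (\<lambda>n. \<integral>\<omega>. norm (F n \<omega>) \<partial>M)"
      using sums_summable[OF cauchy] Fpos by (simp add: EF)
  qed
  also have "\<dots> = (\<Sum>k. A k) * (\<Sum>k. B k)"
    unfolding EF using sums_unique[OF cauchy] by simp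
  finally show ?thesis by (simp only: F_def A_def B_def pre_series_def post_series_def)
qed

end

lemma isCont_borel: "(\<And>x. isCont f x) \<Longrightarrow> f \<in> borel_measurable borel" for f :: "real \<Rightarrow> real"
  by (intro borel_measurable_continuous_onI continuous_at_imp_continuous_on ballI)

context killed_levy
begin

definition ext_moment :: "real \<Rightarrow> 'n \<Rightarrow> (real \<Rightarrow> real) \<Rightarrow> (real \<Rightarrow> real) \<Rightarrow> real" where
  "ext_moment c k f g = expectation (\<lambda>\<omega>. f (ext_value c \<omega>) * g (X (L \<omega>) \<omega> - ext_value c \<omega>) *
    (if ext_phase c \<omega> = Some k then 1 else 0))"

end

context decaying_killed_levy
begin

lemma series_tendsto:
  assumes c: "c = 1 \<or> c = -1"
    and f: "\<And>x. isCont f x" "\<And>x. isCont g x"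
    and bd: "\<And>x. 0 \<le> f x \<and> f x \<le> 1" "\<And>x. 0 \<le> g x \<and> g x \<le> 1"
  shows "((\<lambda>q. pre_series c k f (tilt q) (mesh q) * post_series c k g (tilt q) (mesh q)) \<longlongrightarrow> ext_moment c k f g) iter_seq"
proof -
  define Z where "Z n m \<omega> = (\<Sum>i. \<Sum>j\<le>i. sampled c k f g (1 / real (Suc n)) (1 / real (Suc m)) i j \<omega>)" for n m :: nat and \<omega>
  define Y where "Y \<omega> = f (ext_value c \<omega>) * g (X (L \<omega>) \<omega> - ext_value c \<omega>) * (if ext_phase c \<omega> = Some k then 1 else 0)" for \<omega>
  note fm [measurable] = isCont_borel[OF f(1)] isCont_borel[OF f(2)]
  have h: "0 < 1 / real (Suc m)" for m by simp
  have Zm: "Z n m \<in> borel_measurable M" for n m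
    unfolding Z_def[abs_def]
    by (intro borel_measurable_suminf borel_measurable_sum expectation_sampled(1)[OF h _ fm bd]) auto
  have [measurable]: "ext_value c \<in> borel_measurable M" by (rule ext_value_measurable[OF c])
  have [measurable]: "Measurable.pred M (\<lambda>\<omega>. ext_phase c \<omega> = Some k)" by (rule ext_phase_measurable[OF c])
  have [measurable]: "(\<lambda>\<omega>. X (L \<omega>) \<omega>) \<in> borel_measurable M"
    by (rule MX.X_random_time[OF MJ.lifetime_measurable MJ.lifetime_nonneg])
  have Ym: "Y \<in> borel_measurable M" unfolding Y_def[abs_def] by measurable
  have prod: "\<bar>f x * g y * (if b then 1 else 0)\<bar> \<le> 1" for x y b
    using bd(1)[of x] bd(2)[of y] by (auto simp: abs_mult mult_le_one)
  have Zbd: "AE \<omega> in M. \<bar>Z n m \<omega>\<bar> \<le> 1" for n m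
    using AE_good
  proof eventually_elim
    case (elim \<omega>)
    from sampled_sum_eq[OF elim c h[of m], where k=k and f=f and p=g and e="1 / real (Suc n)"]
    show ?case using prod unfolding Z_def by auto
  qed
  have Ybd: "AE \<omega> in M. \<bar>Y \<omega>\<bar> \<le> 1"
    unfolding Y_def using prod by (intro always_eventually allI)
  have "AE \<omega> in M. \<forall>e>0. \<forall>\<^sub>F n in sequentially. \<forall>\<^sub>F m in sequentially. \<bar>Z n m \<omega> - Y \<omega>\<bar> < e"
    using AE_good
  proof eventually_elim
    case (elim \<omega>)
    show ?case
    proof (intro allI impI)
      fix e :: real assume "0 < e"
      from tendstoD[OF sampled_tendsto[OF elim c f, of k] this]
      show "\<forall>\<^sub>F n in sequentially. \<forall>\<^sub>F m in sequentially. \<bar>Z n m \<omega> - Y \<omega>\<bar> < e"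
        unfolding eventually_iter_seq Z_def Y_def dist_real_def fst_conv snd_conv .
    qed
  qed
  from iterated_dominated_convergence[OF Zm Ym Zbd Ybd this]
  have "((\<lambda>q. expectation (Z (fst q) (snd q))) \<longlongrightarrow> expectation Y) iter_seq" .
  moreover have "expectation (Z (fst q) (snd q)) = pre_series c k f (tilt q) (mesh q) * post_series c k g (tilt q) (mesh q)" for q
    unfolding Z_def[abs_def] by (rule expectation_sampled_sum[OF h fm bd])
  moreover have "expectation Y = ext_moment c k f g"
    unfolding Y_def[abs_def] ext_moment_def ..
  ultimately show ?thesis by simp
qed

lemma ext_moment_product:
  assumes c: "c = 1 \<or> c = -1"
    and f: "\<And>x. isCont f x" "\<And>x. isCont g x"
    and bd: "\<And>x. 0 \<le> f x \<and> f x \<le> 1" "\<And>x. 0 \<le> g x \<and> g x \<le> 1"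
  shows "ext_moment c k f g * ext_moment c k (\<lambda>_. 1) (\<lambda>_. 1) = ext_moment c k f (\<lambda>_. 1) * ext_moment c k (\<lambda>_. 1) g"
proof (rule tendsto_unique[OF iter_seq_neq_bot])
  let ?A = "\<lambda>f q. pre_series c k f (tilt q) (mesh q)" and ?B = "\<lambda>g q. post_series c k g (tilt q) (mesh q)"
  show "((\<lambda>q. (?A f q * ?B g q) * (?A (\<lambda>_. 1) q * ?B (\<lambda>_. 1) q)) \<longlongrightarrow> ext_moment c k f g * ext_moment c k (\<lambda>_. 1) (\<lambda>_. 1)) iter_seq"
    by (intro tendsto_mult series_tendsto c f bd) auto
  have "((\<lambda>q. (?A f q * ?B (\<lambda>_. 1) q) * (?A (\<lambda>_. 1) q * ?B g q)) \<longlongrightarrow> ext_moment c k f (\<lambda>_. 1) * ext_moment c k (\<lambda>_. 1) g) iter_seq"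
    by (intro tendsto_mult series_tendsto c f bd) auto
  then show "((\<lambda>q. (?A f q * ?B g q) * (?A (\<lambda>_. 1) q * ?B (\<lambda>_. 1) q)) \<longlongrightarrow> ext_moment c k f (\<lambda>_. 1) * ext_moment c k (\<lambda>_. 1) g) iter_seq"
    by (simp only: mult_ac)
qed

definition flow_series :: "real \<Rightarrow> 'n \<Rightarrow> (real \<Rightarrow> real) \<Rightarrow> real \<Rightarrow> real \<Rightarrow> real" where
  "flow_series c k g e h = (\<Sum>l. walk_exp (step_law e h) (dn c) g l * exit_flow U (real l * h) k)"

definition defect :: "real \<Rightarrow> real" where
  "defect h = (\<Sum>j\<in>UNIV. \<bar>1 - surv U h j - h * exit_flow U 0 j\<bar>)"

lemma defect_bound:
  assumes "0 \<le> t"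
  shows "\<bar>surv U t k - surv U (t + h) k - h * exit_flow U t k\<bar> \<le> defect h * surv U t k"
proof -
  have "surv U t k - surv U (t + h) k - h * exit_flow U t k =
    (\<Sum>j\<in>UNIV. trans U t $ k $ j * (1 - surv U h j - h * exit_flow U 0 j))"
  proof -
    have "surv U t k = (\<Sum>j\<in>UNIV. trans U t $ k $ j)" by (simp add: surv_def)
    moreover have "h * exit_flow U t k = (\<Sum>j\<in>UNIV. trans U t $ k $ j * (h * exit_flow U 0 j))"
      using exit_flow_add[of U t 0 k] by (simp add: sum_distrib_left mult_ac)
    ultimately show ?thesis
      by (simp add: surv_add right_diff_distrib sum_subtractf)
  qed
  also have "\<bar>\<dots>\<bar> \<le> (\<Sum>j\<in>UNIV. trans U t $ k $ j * \<bar>1 - surv U h j - h * exit_flow U 0 j\<bar>)"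
    using trans_nonneg[OF U assms] by (intro order_trans[OF sum_abs]) (simp add: abs_mult)
  also have "\<dots> \<le> (\<Sum>j\<in>UNIV. surv U t k * \<bar>1 - surv U h j - h * exit_flow U 0 j\<bar>)"
    by (intro sum_mono mult_right_mono trans_le_surv[OF U assms]) simp
  finally show ?thesis by (simp add: defect_def sum_distrib_left mult.commute)
qed

lemma defect_small: "((\<lambda>q. defect (mesh q) / mesh q) \<longlongrightarrow> 0) iter_seq"
proof (rule tendsto_iter_seq_snd)
  have lim0: "filterlim (\<lambda>n. 1 / real (Suc n)) (at 0) sequentially"
    unfolding filterlim_at using LIMSEQ_Suc[OF lim_inverse_n'] by (auto intro!: always_eventually)
  have "(\<lambda>n. \<bar>1 - surv U (1 / real (Suc n)) j - (1 / real (Suc n)) * exit_flow U 0 j\<bar> / (1 / real (Suc n))) \<longlonglongrightarrow> 0" for j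
  proof -
    have "((\<lambda>h. (surv U (0 + h) j - surv U 0 j) / h) \<longlongrightarrow> - exit_flow U 0 j) (at 0)"
      using surv_has_derivative[of U j 0] unfolding has_field_derivative_def DERIV_def[symmetric]
      by (simp add: DERIV_def has_field_derivative_def[symmetric])
    from filterlim_compose[OF this lim0]
    have "(\<lambda>n. (surv U (1 / real (Suc n)) j - 1) / (1 / real (Suc n)) + exit_flow U 0 j) \<longlonglongrightarrow> - exit_flow U 0 j + exit_flow U 0 j"
      by (intro tendsto_add tendsto_const) (simp only: add_0_left surv_0)
    then have "(\<lambda>n. \<bar>(surv U (1 / real (Suc n)) j - 1) / (1 / real (Suc n)) + exit_flow U 0 j\<bar>) \<longlonglongrightarrow> 0"
      by (intro tendsto_rabs_zero) (simp only: add.left_inverse)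
    moreover have alg: "\<bar>(s - 1) / h + x\<bar> = \<bar>1 - s - h * x\<bar> / h" if "0 < h" for s h x :: real
    proof -
      have "(s - 1) / h + x = - (1 - s - h * x) / h" using that by (simp add: field_simps)
      then show ?thesis using that by (simp only: abs_divide abs_minus_cancel abs_of_pos)
    qed
    have "\<bar>(surv U (1 / real (Suc n)) j - 1) / (1 / real (Suc n)) + exit_flow U 0 j\<bar> =
      \<bar>1 - surv U (1 / real (Suc n)) j - (1 / real (Suc n)) * exit_flow U 0 j\<bar> / (1 / real (Suc n))" for n
      by (rule alg) simp
    ultimately show ?thesis by (simp only:)
  qed
  then show "(\<lambda>n. defect (1 / real (Suc n)) / (1 / real (Suc n))) \<longlonglongrightarrow> 0"
    unfolding defect_def sum_divide_distrib by (intro tendsto_null_sum)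
qed

lemma sum_walk_exp_le:
  assumes h: "0 < h" and g: "g \<in> borel_measurable borel" "\<And>x. 0 \<le> g x \<and> g x \<le> 1"
    and c: "c = 1 \<or> c = -1"
  shows "(\<Sum>m\<le>n. walk_exp (step_law e h) (up c) (\<lambda>_. 1) m * walk_exp (step_law e h) (dn c) g (n - m)) \<le> 1"
proof -
  have one: "(\<lambda>_. 1 :: real) \<in> borel_measurable (borel :: real measure)" "\<And>x::real. 0 \<le> (1::real) \<and> (1::real) \<le> 1" by auto
  let ?F = "\<lambda>m \<omega>. pre e h (up c) (\<lambda>_. 1) m \<omega> * post e h (dn c) g m (n - m) \<omega>"
  have F: "?F m \<in> borel_measurable M" for m
    using pre_post_measurable[OF h up_dn_measurable one(1) g(1)] by (intro borel_measurable_times) auto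
  have bd: "0 \<le> ?F m \<omega>" "?F m \<omega> \<le> 1" for m \<omega>
    unfolding pre_def[OF h] post_def[OF h]
    using stay_bounds[OF h one(2)] stay_bounds[OF h g(2)] by (auto intro: mult_le_one)
  have int: "integrable M (?F m)" for m
    using F bd by (auto intro!: integrable_const_bound[where B=1])
  have "(\<Sum>m\<le>n. walk_exp (step_law e h) (up c) (\<lambda>_. 1) m * walk_exp (step_law e h) (dn c) g (n - m)) =
    (\<Sum>m\<le>n. expectation (?F m))"
    using expectation_pre_post[OF h up_dn_measurable one(1) g(1) one(2) g(2)] by simp
  also have "\<dots> = expectation (\<lambda>\<omega>. \<Sum>m\<le>n. ?F m \<omega>)"
    using int by (subst Bochner_Integration.integral_sum) auto
  also have "\<dots> \<le> 1"
  proof (rule integral_le_const)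
    show "integrable M (\<lambda>\<omega>. \<Sum>m\<le>n. ?F m \<omega>)" using int by auto
    show "AE \<omega> in M. (\<Sum>m\<le>n. ?F m \<omega>) \<le> 1"
    proof (rule AE_I2)
      fix \<omega> assume \<omega>: "\<omega> \<in> space M"
      obtain m where m: "marker c (walk e h \<omega>) n m" using marker_exists[OF c] by blast
      have "(\<Sum>m\<le>n. ?F m \<omega>) = (\<Sum>m\<le>n. if marker c (walk e h \<omega>) n m then 1 * g (walk e h \<omega> n - walk e h \<omega> m) else 0)"
        using marker_pre_post[OF h \<omega>, where n=n and c=c and f="\<lambda>_. 1" and g=g and e=e] by (intro sum.cong) auto
      also have "\<dots> = 1 * g (walk e h \<omega> n - walk e h \<omega> m)" by (rule sum_marker[OF m])
      also have "\<dots> \<le> 1" using g(2) by simp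
      finally show "(\<Sum>m\<le>n. ?F m \<omega>) \<le> 1" .
    qed
  qed
  finally show ?thesis .
qed

lemma pre_survival_bound:
  obtains K where "0 \<le> K" "\<And>c g e h. c = 1 \<or> c = -1 \<Longrightarrow> 0 < h \<Longrightarrow> h \<le> 1 \<Longrightarrow>
    g \<in> borel_measurable borel \<Longrightarrow> (\<And>x. 0 \<le> g x \<and> g x \<le> 1) \<Longrightarrow>
    pre_series c k (\<lambda>_. 1) e h * (\<Sum>l. walk_exp (step_law e h) (dn c) g l * surv U (real l * h) k) \<le> K / h"
proof -
  obtain r C where rC: "0 < r" "0 < C" "\<And>t. 0 \<le> t \<Longrightarrow> (\<Sum>k\<in>UNIV. occ_prob a U t k) \<le> C * exp (- (r * t))"
    by (rule decay_bounds) blast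
  show ?thesis
  proof (rule that)
    show "0 \<le> C * ((1 + r) / r)" using rC by simp
    fix c e h :: real and g :: "real \<Rightarrow> real"
    assume c: "c = 1 \<or> c = -1" and h: "0 < h" "h \<le> 1" and g: "g \<in> borel_measurable borel" "\<And>x. 0 \<le> g x \<and> g x \<le> 1"
    have one: "(\<lambda>_. 1 :: real) \<in> borel_measurable (borel :: real measure)" "\<And>x::real. 0 \<le> (1::real) \<and> (1::real) \<le> 1" by auto
    define wu where "wu m = walk_exp (step_law e h) (up c) (\<lambda>_. 1) m" for m
    define wd where "wd l = walk_exp (step_law e h) (dn c) g l" for l
    have wu: "0 \<le> wu m" for m unfolding wu_def by (rule walk_exp_bounds(1)[OF h(1) one up_dn_measurable(1)])
    have wd: "0 \<le> wd l" for l unfolding wd_def by (rule walk_exp_bounds(1)[OF h(1) g up_dn_measurable(2)])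
    define A where "A m = wu m * occ_prob a U (real m * h) k" for m
    define B where "B l = wd l * surv U (real l * h) k" for l
    have t: "0 \<le> real n * h" for n using h by simp
    have pos: "0 \<le> A m" "0 \<le> B l" for m l
      unfolding A_def B_def by (intro mult_nonneg_nonneg wu wd occ_prob_nonneg surv_nonneg[OF U] t)+
    have sA: "summable (\<lambda>m. norm (A m))"
      using series_summable(1)[OF h(1) one, of e c k] pos by (simp add: A_def wu_def)
    have sB: "summable (\<lambda>l. norm (B l))"
      using series_summable(2)[OF h(1) g, of e c k] pos by (simp add: B_def wd_def)
    have term_le: "(\<Sum>m\<le>n. A m * B (n - m)) \<le> C * exp (- (r * (real n * h)))" for n
    proof -
      have "occ_prob a U (real m * h) k * surv U (real (n - m) * h) k \<le> C * exp (- (r * (real n * h)))" if "m \<le> n" for m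
      proof -
        have "occ_prob a U (real m * h) k * surv U (real (n - m) * h) k
          \<le> (\<Sum>j\<in>UNIV. occ_prob a U (real m * h) j * surv U (real (n - m) * h) j)"
          by (intro member_le_sum[of k UNIV "\<lambda>j. occ_prob a U (real m * h) j * surv U (real (n - m) * h) j"]
              mult_nonneg_nonneg occ_prob_nonneg surv_nonneg[OF U] t) auto
        also have "\<dots> = (\<Sum>k\<in>UNIV. occ_prob a U (real m * h + real (n - m) * h) k)"
          unfolding occ_prob_add by (simp add: surv_def sum_distrib_left) (rule sum.swap)
        also have "real m * h + real (n - m) * h = real n * h"
          using that by (simp add: of_nat_diff algebra_simps)
        also have "(\<Sum>k\<in>UNIV. occ_prob a U (real n * h) k) \<le> C * exp (- (r * (real n * h)))"
          by (rule rC(3)[OF t])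
        finally show ?thesis .
      qed
      then have "(\<Sum>m\<le>n. A m * B (n - m)) \<le> (\<Sum>m\<le>n. wu m * wd (n - m) * (C * exp (- (r * (real n * h)))))"
      proof (intro sum_mono)
        fix m assume "m \<in> {..n}" and *: "\<And>m. m \<le> n \<Longrightarrow> occ_prob a U (real m * h) k * surv U (real (n - m) * h) k \<le> C * exp (- (r * (real n * h)))"
        then have "wu m * wd (n - m) * (occ_prob a U (real m * h) k * surv U (real (n - m) * h) k) \<le> wu m * wd (n - m) * (C * exp (- (r * (real n * h))))"
          using wu wd by (intro mult_left_mono) auto
        then show "A m * B (n - m) \<le> wu m * wd (n - m) * (C * exp (- (r * (real n * h))))"
          by (simp add: A_def B_def mult_ac)
      qed
      also have "\<dots> = (\<Sum>m\<le>n. wu m * wd (n - m)) * (C * exp (- (r * (real n * h))))"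
        by (simp add: sum_distrib_right)
      also have "\<dots> \<le> 1 * (C * exp (- (r * (real n * h))))"
        unfolding wu_def wd_def using rC(2) by (intro mult_right_mono sum_walk_exp_le[OF h(1) g c]) auto
      finally show ?thesis by simp
    qed
    have ex: "exp (- (r * (real n * h))) = exp (- (r * h)) ^ n" for n
      by (simp add: exp_of_nat_mult[symmetric] mult_ac)
    have lt: "norm (exp (- (r * h))) < 1" using rC h by simp
    have "(\<Sum>m. A m) * (\<Sum>l. B l) = (\<Sum>n. \<Sum>m\<le>n. A m * B (n - m))"
      using sums_unique[OF Cauchy_product_sums[OF sA sB]] by simp
    also have "\<dots> \<le> (\<Sum>n. C * exp (- (r * (real n * h))))"
      by (intro suminf_le term_le sums_summable[OF Cauchy_product_sums[OF sA sB]] summable_mult geometric_summable rC h)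
    also have "\<dots> = C * (1 / (1 - exp (- (r * h))))"
      using suminf_geometric[OF lt] geometric_summable[OF rC(1) h(1)] by (simp add: suminf_mult ex)
    also have "\<dots> \<le> C * ((1 + r) / r / h)"
    proof (intro mult_left_mono)
      have rh: "0 < r * h" using rC h by simp
      have "1 + r * h \<le> exp (r * h)" by (rule exp_ge_add_one_self)
      then have "exp (- (r * h)) \<le> 1 / (1 + r * h)"
        using rh by (simp add: exp_minus field_simps)
      then have "r * h / (1 + r * h) \<le> 1 - exp (- (r * h))"
        using rh by (simp add: field_simps)
      then have "1 / (1 - exp (- (r * h))) \<le> 1 / (r * h / (1 + r * h))"
        using rh by (intro divide_left_mono mult_pos_pos) auto
      also have "\<dots> = (1 + r * h) / (r * h)" by simp
      also have "\<dots> \<le> (1 + r) / (r * h)"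
        using rC h by (intro divide_right_mono) auto
      finally show "1 / (1 - exp (- (r * h))) \<le> (1 + r) / r / h" by (simp add: field_simps)
    qed (use rC in simp)
    finally show "pre_series c k (\<lambda>_. 1) e h * (\<Sum>l. walk_exp (step_law e h) (dn c) g l * surv U (real l * h) k) \<le> C * ((1 + r) / r) / h"
      by (simp add: pre_series_def A_def B_def wu_def wd_def)
  qed
qed

lemma flow_series_summable:
  assumes h: "0 < h" and g: "g \<in> borel_measurable borel" "\<And>x. 0 \<le> g x \<and> g x \<le> 1"
  shows "summable (\<lambda>l. walk_exp (step_law e h) (dn c) g l * exit_flow U (real l * h) k)"
proof (rule summable_comparison_test')
  define C where "C = (\<Sum>j\<in>UNIV. exit_rates U $ j)"
  show "summable (\<lambda>l. C * (walk_exp (step_law e h) (dn c) g l * surv U (real l * h) k))"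
    by (intro summable_mult series_summable(2)[OF h g])
  fix l :: nat
  have t: "0 \<le> real l * h" using h by simp
  have "exit_flow U (real l * h) k \<le> (\<Sum>j\<in>UNIV. surv U (real l * h) k * exit_rates U $ j)"
    unfolding exit_flow_def by (intro sum_mono mult_right_mono trans_le_surv[OF U t] exit_rates_nonneg[OF U])
  also have "\<dots> = C * surv U (real l * h) k" by (simp add: C_def sum_distrib_right mult.commute)
  finally have "walk_exp (step_law e h) (dn c) g l * exit_flow U (real l * h) k \<le>
      walk_exp (step_law e h) (dn c) g l * (C * surv U (real l * h) k)"
    by (rule mult_left_mono) (rule walk_exp_bounds(1)[OF h g up_dn_measurable(2)])
  then show "norm (walk_exp (step_law e h) (dn c) g l * exit_flow U (real l * h) k) \<le> C * (walk_exp (step_law e h) (dn c) g l * surv U (real l * h) k)"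
    using walk_exp_bounds(1)[OF h g up_dn_measurable(2), of e c l] exit_flow_nonneg[OF U t, of k]
    by (simp add: abs_mult mult.left_commute)
qed

text \<open>In the post-extremum part of the sampled process the increments of the survival function may be
  replaced by the mesh times the exit flow.\<close>

lemma flow_series_tendsto:
  assumes c: "c = 1 \<or> c = -1" and g: "\<And>x. isCont g x" "\<And>x. 0 \<le> g x \<and> g x \<le> 1"
  shows "((\<lambda>q. pre_series c k (\<lambda>_. 1) (tilt q) (mesh q) * (mesh q * flow_series c k g (tilt q) (mesh q))) \<longlongrightarrow>
    ext_moment c k (\<lambda>_. 1) g) iter_seq"
proof -
  obtain K where K: "0 \<le> K" "\<And>c g e h. c = 1 \<or> c = -1 \<Longrightarrow> 0 < h \<Longrightarrow> h \<le> 1 \<Longrightarrow>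
    g \<in> borel_measurable borel \<Longrightarrow> (\<And>x. 0 \<le> g x \<and> g x \<le> 1) \<Longrightarrow>
    pre_series c k (\<lambda>_. 1) e h * (\<Sum>l. walk_exp (step_law e h) (dn c) g l * surv U (real l * h) k) \<le> K / h"
    by (rule pre_survival_bound) blast
  note gm = isCont_borel[OF g(1)]
  have one: "(\<lambda>_. 1 :: real) \<in> borel_measurable (borel :: real measure)" "\<And>x::real. 0 \<le> (1::real) \<and> (1::real) \<le> 1" by auto
  have est: "\<bar>pre_series c k (\<lambda>_. 1) e h * (post_series c k g e h - h * flow_series c k g e h)\<bar> \<le> K * (defect h / h)"
    if h: "0 < h" "h \<le> 1" for e h
  proof -
    define w where "w l = walk_exp (step_law e h) (dn c) g l" for l
    have w: "0 \<le> w l" for l unfolding w_def by (rule walk_exp_bounds(1)[OF h(1) gm g(2) up_dn_measurable(2)])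
    have t: "0 \<le> real n * h" for n using h by simp
    have Suc: "real (Suc l) * h = real l * h + h" for l by (simp add: algebra_simps)
    note s = series_summable(2,3)[OF h(1) gm g(2), of e c k, folded w_def] flow_series_summable[OF h(1) gm g(2), of e c k, folded w_def]
    have "post_series c k g e h - h * flow_series c k g e h =
      (\<Sum>l. w l * (surv U (real l * h) k - surv U (real (Suc l) * h) k) - h * (w l * exit_flow U (real l * h) k))"
      unfolding post_series_def flow_series_def w_def[symmetric]
      by (subst suminf_mult[OF s(3), symmetric], subst suminf_diff[OF s(2) summable_mult[OF s(3)]]) simp
    also have "\<dots> = (\<Sum>l. w l * (surv U (real l * h) k - surv U (real l * h + h) k - h * exit_flow U (real l * h) k))"
      unfolding Suc by (simp add: algebra_simps)
    finally have eq: "post_series c k g e h - h * flow_series c k g e h =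
      (\<Sum>l. w l * (surv U (real l * h) k - surv U (real l * h + h) k - h * exit_flow U (real l * h) k))" .
    have le: "\<bar>w l * (surv U (real l * h) k - surv U (real l * h + h) k - h * exit_flow U (real l * h) k)\<bar>
      \<le> defect h * (w l * surv U (real l * h) k)" for l
      using mult_left_mono[OF defect_bound[OF t, of l k h] w[of l]] w[of l] by (simp add: abs_mult mult_ac)
    have sd: "summable (\<lambda>l. defect h * (w l * surv U (real l * h) k))" by (intro summable_mult s)
    have sn: "summable (\<lambda>l. \<bar>w l * (surv U (real l * h) k - surv U (real l * h + h) k - h * exit_flow U (real l * h) k)\<bar>)"
      by (rule summable_comparison_test'[OF sd]) (use le in simp)
    have "\<bar>post_series c k g e h - h * flow_series c k g e h\<bar> \<le> (\<Sum>l. defect h * (w l * surv U (real l * h) k))"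
      unfolding eq by (rule order_trans[OF summable_rabs[OF sn] suminf_le[OF le sn sd]])
    also have "\<dots> = defect h * (\<Sum>l. w l * surv U (real l * h) k)" by (rule suminf_mult[OF s(1)])
    finally have d: "\<bar>post_series c k g e h - h * flow_series c k g e h\<bar> \<le> defect h * (\<Sum>l. w l * surv U (real l * h) k)" .
    have p: "0 \<le> pre_series c k (\<lambda>_. 1) e h"
      unfolding pre_series_def
      by (intro suminf_nonneg series_summable(1)[OF h(1) one] mult_nonneg_nonneg occ_prob_nonneg t
          walk_exp_bounds(1)[OF h(1) one up_dn_measurable(1)])
    have df: "0 \<le> defect h" by (simp add: defect_def sum_nonneg)
    have "\<bar>pre_series c k (\<lambda>_. 1) e h * (post_series c k g e h - h * flow_series c k g e h)\<bar>
      \<le> pre_series c k (\<lambda>_. 1) e h * (defect h * (\<Sum>l. w l * surv U (real l * h) k))"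
      using mult_left_mono[OF d p] p by (simp add: abs_mult)
    also have "\<dots> = defect h * (pre_series c k (\<lambda>_. 1) e h * (\<Sum>l. w l * surv U (real l * h) k))" by simp
    also have "\<dots> \<le> defect h * (K / h)"
      unfolding w_def by (intro mult_left_mono K(2) c h gm g(2) df)
    finally show ?thesis by (simp add: mult.commute)
  qed
  have "((\<lambda>q. pre_series c k (\<lambda>_. 1) (tilt q) (mesh q) * (post_series c k g (tilt q) (mesh q) - mesh q * flow_series c k g (tilt q) (mesh q))) \<longlongrightarrow> 0) iter_seq"
  proof (rule Lim_null_comparison)
    show "\<forall>\<^sub>F q in iter_seq. norm (pre_series c k (\<lambda>_. 1) (tilt q) (mesh q) * (post_series c k g (tilt q) (mesh q) - mesh q * flow_series c k g (tilt q) (mesh q))) \<le> K * (defect (mesh q) / mesh q)"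
      unfolding real_norm_def by (intro always_eventually allI est) auto
    show "((\<lambda>q. K * (defect (mesh q) / mesh q)) \<longlongrightarrow> 0) iter_seq"
      by (rule tendsto_mult_right_zero[OF defect_small])
  qed
  moreover have "((\<lambda>q. pre_series c k (\<lambda>_. 1) (tilt q) (mesh q) * post_series c k g (tilt q) (mesh q)) \<longlongrightarrow> ext_moment c k (\<lambda>_. 1) g) iter_seq"
    by (intro series_tendsto c g) auto
  ultimately have "((\<lambda>q. pre_series c k (\<lambda>_. 1) (tilt q) (mesh q) * post_series c k g (tilt q) (mesh q) -
    pre_series c k (\<lambda>_. 1) (tilt q) (mesh q) * (post_series c k g (tilt q) (mesh q) - mesh q * flow_series c k g (tilt q) (mesh q))) \<longlongrightarrow> ext_moment c k (\<lambda>_. 1) g - 0) iter_seq"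
    by (intro tendsto_diff)
  then show ?thesis by (simp only: right_diff_distrib diff_diff_eq2 add_diff_cancel_left' diff_zero cancel_ab_semigroup_add_class.add_diff_cancel_left)
qed

end

section \<open>Positivity of the conditioning events\<close>

lemma cadlag_le_of_Rats:
  assumes x: "cadlag x" and p: "0 \<le> p" and le: "\<And>q. q \<in> \<rat> \<Longrightarrow> p \<le> q \<Longrightarrow> q \<le> r \<Longrightarrow> x q \<le> K"
  shows "p \<le> t \<Longrightarrow> t < r \<Longrightarrow> x t \<le> K" and "p < t \<Longrightarrow> t < r \<Longrightarrow> lv x t \<le> K"
proof -
  have 1: "x t \<le> K" if t: "p \<le> t" "t < r" for t
  proof (rule ccontr)
    assume "\<not> x t \<le> K"
    then have "K < x t" by simp
    then have "\<forall>\<^sub>F u in at_right t. K < x u"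
      using order_tendstoD(1)[OF cadlag_right[OF x]] t p by simp
    then obtain b where b: "t < b" "\<And>u. t < u \<Longrightarrow> u < b \<Longrightarrow> K < x u"
      by (auto simp: eventually_at_right_field)
    obtain q where q: "q \<in> \<rat>" "t < q" "q < min b r"
      using Rats_dense_in_real[of t "min b r"] b t by auto
    then have "K < x q" "x q \<le> K"
      using b(2)[of q] le[of q] t by auto
    then show False by simp
  qed
  then show "p \<le> t \<Longrightarrow> t < r \<Longrightarrow> x t \<le> K" .
  show "lv x t \<le> K" if t: "p < t" "t < r"
  proof (rule tendsto_upperbound[OF cadlag_left[OF x]])
    from eventually_at_left_real[OF t(1)]
    show "\<forall>\<^sub>F u in at_left t. x u \<le> K"
      by eventually_elim (use 1 t in auto)
  qed (use t p in auto)
qed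

context killed_levy
begin

lemma increment_distr:
  assumes "0 \<le> s" "s \<le> t"
  shows "distr M borel (\<lambda>\<omega>. X t \<omega> - X s \<omega>) = distr M borel (X (t - s))"
proof -
  have "\<forall>s\<ge>0. \<forall>h\<ge>0. distr M borel (\<lambda>\<omega>. X (s + h) \<omega> - X s \<omega>) = distr M borel (X h)"
    using levy by (simp add: levy_process_def)
  from this[rule_format, of s "t - s"] assms show ?thesis by simp
qed

lemma prob_increment:
  assumes st: "0 \<le> s" "s \<le> t" and B: "B \<in> sets borel"
  shows "prob {\<omega> \<in> space M. X t \<omega> - X s \<omega> \<in> B} = prob {\<omega> \<in> space M. X (t - s) \<omega> \<in> B}"
proof -
  have [measurable]: "X s \<in> borel_measurable M" "X t \<in> borel_measurable M" "X (t - s) \<in> borel_measurable M"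
    using st by (auto intro!: MX.X_meas)
  have "measure (distr M borel (\<lambda>\<omega>. X t \<omega> - X s \<omega>)) B = measure (distr M borel (X (t - s))) B"
    by (simp only: increment_distr[OF st])
  then show ?thesis
    using B by (simp add: measure_distr vimage_def Int_def conj_commute)
qed

lemma ex_positive_time:
  assumes c: "c = 1 \<or> c = -1" and nm: "\<not> (AE \<omega> in M. \<forall>s t. 0 \<le> s \<longrightarrow> s \<le> t \<longrightarrow> c * X t \<omega> \<le> c * X s \<omega>)"
  shows "\<exists>u>0. 0 < prob {\<omega> \<in> space M. 0 < c * X u \<omega>}"
proof (rule ccontr)
  assume nex: "\<nexists>u. 0 < u \<and> 0 < prob {\<omega> \<in> space M. 0 < c * X u \<omega>}"
  have z: "prob {\<omega> \<in> space M. 0 < c * X u \<omega>} = 0" if "0 < u" for u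
  proof (rule ccontr)
    assume "prob {\<omega> \<in> space M. 0 < c * X u \<omega>} \<noteq> 0"
    then have "0 < prob {\<omega> \<in> space M. 0 < c * X u \<omega>}"
      unfolding zero_less_measure_iff .
    with that nex show False by blast
  qed
  have "AE \<omega> in M. \<forall>p\<in>\<rat> \<inter> {0..}. \<forall>q\<in>\<rat> \<inter> {0..}. p < q \<longrightarrow> c * X q \<omega> \<le> c * X p \<omega>"
  proof (intro AE_ball_countable' countable_Int1 countable_rat)
    fix p q :: real assume pq: "p \<in> \<rat> \<inter> {0..}" "q \<in> \<rat> \<inter> {0..}"
    show "AE \<omega> in M. p < q \<longrightarrow> c * X q \<omega> \<le> c * X p \<omega>"
    proof (cases "p < q")
      case True
      have [measurable]: "X p \<in> borel_measurable M" "X q \<in> borel_measurable M"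
        using pq by (auto intro!: MX.X_meas)
      have B: "{x. 0 < c * x} \<in> sets borel" by measurable
      have "0 \<le> p" "p \<le> q" "0 < q - p" using pq True by auto
      from prob_increment[OF this(1,2) B] z[OF this(3)]
      have z0: "prob {\<omega> \<in> space M. 0 < c * (X q \<omega> - X p \<omega>)} = 0"
        by (simp only: mem_Collect_eq)
      have "{\<omega> \<in> space M. 0 < c * (X q \<omega> - X p \<omega>)} \<in> null_sets M"
      proof (rule null_setsI)
        show "{\<omega> \<in> space M. 0 < c * (X q \<omega> - X p \<omega>)} \<in> events" by measurable
      qed (simp only: emeasure_eq_measure z0 ennreal_0)
      then have "AE \<omega> in M. \<not> 0 < c * (X q \<omega> - X p \<omega>)"
        by (rule AE_I') blast
      then show ?thesis by eventually_elim (simp only: right_diff_distrib not_less diff_le_0_iff_le simp_thms)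
    qed simp
  qed
  with AE_space have "AE \<omega> in M. \<forall>s t. 0 \<le> s \<longrightarrow> s \<le> t \<longrightarrow> c * X t \<omega> \<le> c * X s \<omega>"
  proof eventually_elim
    case (elim \<omega>)
    interpret path "\<lambda>t. c * X t \<omega>" by (rule path_sign[OF c elim(1)])
    show ?case
    proof (intro allI impI)
      fix s t :: real assume st: "0 \<le> s" "s \<le> t"
      have le: "c * X t \<omega> \<le> c * X p \<omega>" if p: "p \<in> \<rat>" "s \<le> p" "p < t" for p
      proof (rule cadlag_le_of_Rats(1)[OF x, of t "t + 1"])
        show "c * X q \<omega> \<le> c * X p \<omega>" if "q \<in> \<rat>" "t \<le> q" for q
        proof -
          have pq: "p \<in> \<rat> \<inter> {0..}" "q \<in> \<rat> \<inter> {0..}" "p < q" using that p st by auto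
          show ?thesis by (rule bspec[OF bspec[OF elim(2) pq(1)] pq(2), rule_format, OF pq(3)])
        qed
        show "0 \<le> t" using st by simp
      qed simp_all
      show "c * X t \<omega> \<le> c * X s \<omega>"
      proof (cases "s = t")
        case False
        then have lt: "s < t" using st by simp
        have "- (c * X s \<omega>) \<le> - (c * X t \<omega>)"
        proof (rule cadlag_le_of_Rats(1)[OF cadlag_uminus[OF x], of s "(s + t) / 2"])
          show "- (c * X q \<omega>) \<le> - (c * X t \<omega>)" if "q \<in> \<rat>" "s \<le> q" "q \<le> (s + t) / 2" for q
          proof -
            have "q < t" using that lt by simp
            from le[OF that(1,2) this] show ?thesis by simp
          qed
        qed (use st lt in simp_all)
        then show ?thesis by simp
      qed simp
    qed
  qed
  with nm show False by (rule notE)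
qed

lemma prob_up_down:
  assumes uv: "0 < u" "0 < v"
  shows "prob {\<omega> \<in> space M. 0 < c * X u \<omega> \<and> c * X (u + v) \<omega> < c * X u \<omega>} =
    prob {\<omega> \<in> space M. 0 < c * X u \<omega>} * prob {\<omega> \<in> space M. c * X v \<omega> < 0}"
proof -
  define s :: "nat \<Rightarrow> real" where "s i = (if i = 0 then 0 else if i = 1 then u else u + v)" for i
  define Y where "Y i \<omega> = X (s (Suc i)) \<omega> - X (s i) \<omega>" for i \<omega>
  define A where "A i = (if i = 0 then {x. 0 < c * x} else {x. c * x < 0})" for i :: nat
  have "\<forall>i<2. s i < s (Suc i)" using uv by (auto simp: s_def less_Suc_eq numeral_2_eq_2)
  moreover have "0 \<le> s 0" by (simp add: s_def)
  ultimately have ind: "indep_vars (\<lambda>_. borel) Y {..<2}"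
    using levy unfolding levy_process_def Y_def[abs_def] by blast
  have A: "A i \<in> sets borel" for i
  proof -
    have "{x. 0 < c * x} \<in> sets borel" "{x. c * x < 0} \<in> sets borel" by measurable
    then show ?thesis by (simp add: A_def)
  qed
  have "prob (\<Inter>i\<in>{0,1}. Y i -` A i \<inter> space M) = (\<Prod>i\<in>{0,1::nat}. prob (Y i -` A i \<inter> space M))"
    by (rule indep_varsD[OF ind]) (auto simp: A)
  moreover have "(\<Inter>i\<in>{0,1}. Y i -` A i \<inter> space M) = {\<omega> \<in> space M. 0 < c * X u \<omega> \<and> c * X (u + v) \<omega> < c * X u \<omega>}"
    using MX.X_0 by (auto simp: Y_def A_def s_def right_diff_distrib)
  moreover have "Y 0 -` A 0 \<inter> space M = {\<omega> \<in> space M. 0 < c * X u \<omega>}"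
    using MX.X_0 by (auto simp: Y_def A_def s_def)
  moreover have "prob (Y 1 -` A 1 \<inter> space M) = prob {\<omega> \<in> space M. c * X v \<omega> < 0}"
    using prob_increment[of u "u + v" "{x. c * x < 0}"] A[of 1] uv
    by (simp add: Y_def A_def s_def vimage_def Int_def conj_commute)
  ultimately show ?thesis by simp
qed

lemma prob_J_chain:
  assumes "0 \<le> s 0" "\<forall>l<m. s l < s (Suc l)"
  shows "prob {\<omega> \<in> space M. \<forall>l\<le>m. J (s l) \<omega> = x l} =
    prob {\<omega> \<in> space M. J (s 0) \<omega> = x 0} * (\<Prod>l<m. trans (extend_generator U) (s (Suc l) - s l) $ x l $ x (Suc l))"
  using assms(2)
proof (induction m)
  case (Suc m)
  have "\<forall>l\<le>m. s l < s (Suc l)" using Suc.prems by auto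
  from markov[OF assms(1) this, of x]
  show ?case using Suc by simp
qed simp

lemma phase_stays:
  assumes sb: "0 < s" "s < b" "0 < d" and occ: "0 < occ_prob a U s k" and surv: "surv U d k < 1"
  shows "\<exists>B\<in>sets VJ. 0 < prob B \<and> B \<subseteq> space M \<and>
    (\<forall>\<omega>\<in>B. (\<forall>t. s \<le> t \<longrightarrow> t \<le> b \<longrightarrow> J t \<omega> = Some k) \<and> J (b + d) \<omega> = None)"
proof -
  obtain C where C: "0 \<le> C" "\<And>t i. 0 \<le> t \<Longrightarrow> exp (- (t * C)) \<le> trans U t $ i $ i"
    by (rule subgenerator_bound[OF U]) blast
  define D where "D N = (b - s) / 2 ^ N" for N :: nat
  define B where "B N = {\<omega> \<in> space M. (\<forall>i\<in>{..2 ^ N}. J (s + real i * D N) \<omega> = Some k) \<and> J (b + d) \<omega> = None}" for N :: nat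
  define p where "p = occ_prob a U s k * (exp (- ((b - s) * C)) * (1 - surv U d k))"
  have p: "0 < p" using occ surv by (simp add: p_def)
  have D0: "0 < D N" for N using sb by (simp add: D_def)
  have Dend: "s + real (2 ^ N) * D N = b" for N using sb by (simp add: D_def)
  have BV: "B N \<in> sets VJ" for N
  proof -
    have J: "J (s + real i * D N) \<in> measurable VJ (count_space UNIV)" "J (b + d) \<in> measurable VJ (count_space UNIV)" for i :: nat
      using sb D0[of N] by (auto intro!: VJJ.J_meas)
    have [measurable]: "Measurable.pred VJ (\<lambda>\<omega>. \<forall>i\<in>{..2 ^ N}. J (s + real i * D N) \<omega> = Some k)"
    proof (rule pred_intros_finite)
      fix i :: nat
      from J(1)[of i, measurable] show "Measurable.pred VJ (\<lambda>\<omega>. J (s + real i * D N) \<omega> = Some k)" by measurable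
    qed simp
    note J(2)[measurable]
    have "{\<omega> \<in> space VJ. (\<forall>i\<in>{..2 ^ N}. J (s + real i * D N) \<omega> = Some k) \<and> J (b + d) \<omega> = None} \<in> sets VJ"
      by measurable
    then show ?thesis by (simp add: B_def)
  qed
  have Bp: "p \<le> prob (B N)" for N
  proof -
    define m :: nat where "m = 2 ^ N"
    define t where "t l = (if l \<le> m then s + real l * D N else b + d)" for l
    define x where "x l = (if l \<le> m then Some k else None)" for l
    have tend: "t m = b" using Dend[of N] by (simp add: t_def m_def)
    have "t l < t (Suc l)" if "l < Suc m" for l
    proof (cases "l = m")
      case True
      then show ?thesis using tend sb by (simp add: t_def)
    next
      case False
      then show ?thesis using that D0[of N] by (simp add: t_def algebra_simps)
    qed
    then have "prob {\<omega> \<in> space M. \<forall>l\<le>Suc m. J (t l) \<omega> = x l} =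
      prob {\<omega> \<in> space M. J (t 0) \<omega> = x 0} * (\<Prod>l<Suc m. trans (extend_generator U) (t (Suc l) - t l) $ x l $ x (Suc l))"
      using sb by (intro prob_J_chain) (auto simp: t_def)
    also have "{\<omega> \<in> space M. \<forall>l\<le>Suc m. J (t l) \<omega> = x l} = B N"
      by (auto simp: B_def t_def x_def le_Suc_eq m_def[symmetric])
    also have "prob {\<omega> \<in> space M. J (t 0) \<omega> = x 0} = occ_prob a U s k"
      using sb by (simp add: t_def x_def prob_J)
    also have "(\<Prod>l<Suc m. trans (extend_generator U) (t (Suc l) - t l) $ x l $ x (Suc l)) =
      (\<Prod>l<m. trans U (D N) $ k $ k) * (1 - surv U d k)"
    proof -
      have "trans (extend_generator U) (t (Suc l) - t l) $ x l $ x (Suc l) = trans U (D N) $ k $ k" if "l < m" for l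
        using that by (simp add: t_def x_def trans_extend algebra_simps)
      moreover have "trans (extend_generator U) (t (Suc m) - t m) $ x m $ x (Suc m) = 1 - surv U d k"
        unfolding tend by (simp add: t_def x_def trans_extend)
      ultimately show ?thesis by simp
    qed
    finally have eq: "prob (B N) = occ_prob a U s k * ((trans U (D N) $ k $ k) ^ m * (1 - surv U d k))" by simp
    have "exp (- (D N * C)) ^ m \<le> (trans U (D N) $ k $ k) ^ m"
      using C(2)[of "D N" k] D0[of N] by (intro power_mono) auto
    moreover have "exp (- (D N * C)) ^ m = exp (- ((b - s) * C))"
      unfolding exp_of_nat_mult[symmetric] by (simp add: m_def D_def)
    ultimately show ?thesis
      unfolding eq p_def using occ surv by (intro mult_left_mono mult_right_mono) auto
  qed
  have dec: "decseq B"
  proof (rule decseq_SucI)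
    fix N
    show "B (Suc N) \<subseteq> B N"
    proof
      fix \<omega> assume w: "\<omega> \<in> B (Suc N)"
      have "J (s + real i * D N) \<omega> = Some k" if "i \<le> 2 ^ N" for i
      proof -
        have "2 * i \<le> 2 ^ Suc N" using that by simp
        then have "J (s + real (2 * i) * D (Suc N)) \<omega> = Some k"
          using w unfolding B_def by blast
        moreover have "real (2 * i) * D (Suc N) = real i * D N" by (simp add: D_def)
        ultimately show ?thesis by (simp only:)
      qed
      then show "\<omega> \<in> B N" using w by (auto simp: B_def)
    qed
  qed
  have "range B \<subseteq> events" using BV sets_V by auto
  from finite_Lim_measure_decseq[OF this dec]
  have "p \<le> prob (\<Inter>N. B N)"
    by (rule tendsto_lowerbound) (use Bp in auto)
  with p have pos: "0 < prob (\<Inter>N. B N)" by simp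
  have stay: "J t \<omega> = Some k" if w: "\<omega> \<in> (\<Inter>N. B N)" and t: "s \<le> t" "t \<le> b" for t \<omega>
  proof (cases "t = b")
    case True
    have "\<omega> \<in> B 0" using w by blast
    then have "\<forall>i\<in>{..2 ^ 0}. J (s + real i * D 0) \<omega> = Some k" unfolding B_def by blast
    then have "J (s + real (2 ^ 0) * D 0) \<omega> = Some k" by (rule bspec) simp
    then show ?thesis using Dend[of 0] True by simp
  next
    case False
    then have tb: "t < b" using t by simp
    have "\<omega> \<in> space M" using w by (auto simp: B_def)
    then obtain e where e: "0 < e" "\<And>u. t \<le> u \<Longrightarrow> u < t + e \<Longrightarrow> J u \<omega> = J t \<omega>"
      using jump_path_right[OF MJ.J_path, of \<omega> t] t sb by auto
    obtain N where N: "(1 / 2) ^ N < min e (b - t) / (b - s)"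
      using real_arch_pow_inv[of "min e (b - t) / (b - s)" "1 / 2"] e tb sb by auto
    have DN: "D N < e" "D N < b - t"
      using N sb by (simp_all add: D_def power_one_over field_simps)
    define i where "i = nat \<lceil>(t - s) / D N\<rceil>"
    have "0 \<le> (t - s) / D N" using t D0[of N] by simp
    then have i: "(t - s) / D N \<le> real i" "real i < (t - s) / D N + 1"
      by (simp_all add: i_def) linarith+
    have i': "t \<le> s + real i * D N" "s + real i * D N < t + D N"
      using i D0[of N] by (simp_all add: field_simps)
    have "real i * D N < real (2 ^ N) * D N"
      using i'(2) DN(2) Dend[of N] by linarith
    then have "i \<le> 2 ^ N"
      using D0[of N] by (simp only: mult_less_cancel_right_pos of_nat_less_iff less_imp_le)
    then have "J (s + real i * D N) \<omega> = Some k" using w by (auto simp: B_def)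
    moreover have "J (s + real i * D N) \<omega> = J t \<omega>"
      using i' DN(1) by (intro e(2)) auto
    ultimately show ?thesis by simp
  qed
  have "(\<Inter>N. B N) \<in> sets VJ" using BV by auto
  moreover have "(\<Inter>N. B N) \<subseteq> space M" "\<forall>\<omega>\<in>(\<Inter>N. B N). J (b + d) \<omega> = None"
    by (auto simp: B_def)
  ultimately show ?thesis using pos stay by (intro bexI[of _ "\<Inter>N. B N"]) auto
qed

lemma ext_phase_positive:
  assumes c: "c = 1 \<or> c = -1"
    and u: "0 < u" "0 < prob {\<omega> \<in> space M. 0 < c * X u \<omega>}"
    and v: "0 < v" "0 < prob {\<omega> \<in> space M. c * X v \<omega> < 0}"
    and occ: "\<And>t. 0 < t \<Longrightarrow> 0 < occ_prob a U t k" and surv: "\<And>t. 0 < t \<Longrightarrow> surv U t k < 1"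
  shows "0 < prob {\<omega> \<in> space M. ext_phase c \<omega> = Some k}"
proof -
  define b where "b = u + v"
  define r where "r n = 1 / real (Suc n)" for n
  have r: "0 < r n" for n by (simp add: r_def)
  define Q where "Q n = \<rat> \<inter> ({0..r n} \<union> {b..b + r n})" for n
  have Q0: "0 \<le> q" if "q \<in> Q n" for q n using that u v by (auto simp: Q_def b_def)
  define A where "A n = {\<omega> \<in> space M. \<forall>q\<in>Q n. c * X q \<omega> \<le> c * X u \<omega> - r n}" for n
  have AV: "A n \<in> sets VX" for n
  proof -
    have [measurable]: "X u \<in> borel_measurable VX" using u by (intro VXX.X_meas) simp
    have "Measurable.pred VX (\<lambda>\<omega>. \<exists>q\<in>Q n. \<not> c * X q \<omega> \<le> c * X u \<omega> - r n)"
    proof (rule pred_Bex_countable)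
      fix q assume "q \<in> Q n"
      then have [measurable]: "X q \<in> borel_measurable VX" using Q0 by (intro VXX.X_meas) auto
      show "Measurable.pred VX (\<lambda>\<omega>. \<not> c * X q \<omega> \<le> c * X u \<omega> - r n)" by measurable
    qed (simp add: Q_def countable_rat)
    then have "{\<omega> \<in> space VX. \<not> (\<exists>q\<in>Q n. \<not> c * X q \<omega> \<le> c * X u \<omega> - r n)} \<in> sets VX"
      by measurable
    then show ?thesis by (simp add: A_def)
  qed
  have sub: "{\<omega> \<in> space M. 0 < c * X u \<omega> \<and> c * X b \<omega> < c * X u \<omega>} \<subseteq> (\<Union>n. A n)"
  proof safe
    fix \<omega> assume w: "\<omega> \<in> space M" "0 < c * X u \<omega>" "c * X b \<omega> < c * X u \<omega>"
    interpret path "\<lambda>t. c * X t \<omega>" by (rule path_sign[OF c w(1)])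
    define K where "K = (max 0 (c * X b \<omega>) + c * X u \<omega>) / 2"
    have K: "0 < K" "c * X b \<omega> < K" "K < c * X u \<omega>" using w by (auto simp: K_def)
    have b0: "0 \<le> b" using u v by (simp add: b_def)
    obtain d1 where d1: "0 < d1" "\<And>t. 0 \<le> t \<Longrightarrow> \<bar>t - 0\<bar> < d1 \<Longrightarrow> c * X t \<omega> < K"
      using cadlag_nhd[OF x order_refl order_refl, of K] K x0 by auto
    obtain d2 where d2: "0 < d2" "\<And>t. b \<le> t \<Longrightarrow> \<bar>t - b\<bar> < d2 \<Longrightarrow> c * X t \<omega> < K"
      using cadlag_nhd[OF x b0 order_refl, of K] K by auto
    obtain n where n: "r n < min (min d1 d2) (c * X u \<omega> - K)"
      unfolding r_def by (rule nat_approx_posE[of "min (min d1 d2) (c * X u \<omega> - K)"]) (use d1 d2 K in auto)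
    have "c * X q \<omega> \<le> c * X u \<omega> - r n" if "q \<in> Q n" for q
      using that n d1(2)[of q] d2(2)[of q] by (auto simp: Q_def)
    then show "\<omega> \<in> (\<Union>n. A n)" using w by (auto simp: A_def)
  qed
  have Aev: "A n \<in> events" for n using AV sets_V by auto
  have "\<exists>n. 0 < prob (A n)"
  proof (rule ccontr)
    assume "\<nexists>n. 0 < prob (A n)"
    then have "A n \<in> null_sets M" for n
      using Aev[of n] by (intro null_setsI) (simp_all add: emeasure_eq_measure zero_less_measure_iff measure_eq_0_null_sets)
    then have "(\<Union>n. A n) \<in> null_sets M" by auto
    then have "prob (\<Union>n. A n) = 0" by (simp add: measure_eq_0_null_sets)
    moreover have "prob {\<omega> \<in> space M. 0 < c * X u \<omega> \<and> c * X b \<omega> < c * X u \<omega>} \<le> prob (\<Union>n. A n)"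
      using Aev by (intro finite_measure_mono sub) auto
    moreover have "0 < prob {\<omega> \<in> space M. 0 < c * X u \<omega> \<and> c * X b \<omega> < c * X u \<omega>}"
      unfolding b_def prob_up_down[OF u(1) v(1)] using u v by simp
    ultimately show False by simp
  qed
  then obtain n where n: "0 < prob (A n)" ..
  have le: "c * X t \<omega> \<le> c * X u \<omega> - r n" "0 < t \<Longrightarrow> t \<noteq> b \<Longrightarrow> lv (\<lambda>t. c * X t \<omega>) t \<le> c * X u \<omega> - r n"
    if w: "\<omega> \<in> A n" and t: "0 \<le> t \<and> t < r n \<or> b \<le> t \<and> t < b + r n" for \<omega> t
  proof -
    have ws: "\<omega> \<in> space M" and q: "\<And>q. q \<in> Q n \<Longrightarrow> c * X q \<omega> \<le> c * X u \<omega> - r n" using w by (auto simp: A_def)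
    interpret path "\<lambda>t. c * X t \<omega>" by (rule path_sign[OF c ws])
    have b0: "0 \<le> b" using u v by (simp add: b_def)
    note l0 = cadlag_le_of_Rats[OF x order_refl, of "r n" "c * X u \<omega> - r n"]
      and lb = cadlag_le_of_Rats[OF x b0, of "b + r n" "c * X u \<omega> - r n"]
    have q0: "\<And>q. q \<in> \<rat> \<Longrightarrow> 0 \<le> q \<Longrightarrow> q \<le> r n \<Longrightarrow> c * X q \<omega> \<le> c * X u \<omega> - r n"
      and qb: "\<And>q. q \<in> \<rat> \<Longrightarrow> b \<le> q \<Longrightarrow> q \<le> b + r n \<Longrightarrow> c * X q \<omega> \<le> c * X u \<omega> - r n"
      using q by (auto simp: Q_def)
    show "c * X t \<omega> \<le> c * X u \<omega> - r n"
      using t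
    proof
      assume "0 \<le> t \<and> t < r n"
      then show ?thesis by (intro l0(1)[OF q0]) auto
    next
      assume "b \<le> t \<and> t < b + r n"
      then show ?thesis by (intro lb(1)[OF qb]) auto
    qed
    show "lv (\<lambda>t. c * X t \<omega>) t \<le> c * X u \<omega> - r n" if "0 < t" "t \<noteq> b"
      using t
    proof
      assume "0 \<le> t \<and> t < r n"
      then show ?thesis using that by (intro l0(2)[OF q0]) auto
    next
      assume "b \<le> t \<and> t < b + r n"
      then show ?thesis using that by (intro lb(2)[OF qb]) auto
    qed
  qed
  have "A n \<noteq> {}" using n by auto
  then obtain w where "w \<in> A n" by blast
  have ur: "r n \<le> u"
  proof (rule ccontr)
    assume "\<not> r n \<le> u"
    then have "c * X u w \<le> c * X u w - r n" using u by (intro le(1)[OF \<open>w \<in> A n\<close>]) simp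
    then show False using r[of n] by simp
  qed
  define s where "s = r n / 2"
  have s: "0 < s" "s < b" "s < r n" using ur r[of n] u v by (auto simp: s_def b_def)
  obtain B where B': "B \<in> sets VJ" "0 < prob B" "B \<subseteq> space M"
    "\<forall>\<omega>\<in>B. (\<forall>t. s \<le> t \<longrightarrow> t \<le> b \<longrightarrow> J t \<omega> = Some k) \<and> J (b + s) \<omega> = None"
    using phase_stays[OF s(1,2,1) occ[OF s(1)] surv[OF s(1)]] by (elim bexE conjE)
  have B: "J t \<omega> = Some k" "J (b + s) \<omega> = None" if "\<omega> \<in> B" "s \<le> t" "t \<le> b" for \<omega> t
    using B' that by blast+
  have hit: "ext_phase c \<omega> = Some k" if g: "good \<omega>" and w: "\<omega> \<in> A n" "\<omega> \<in> B" for \<omega>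
  proof -
    have ws: "\<omega> \<in> space M" and J: "\<And>t. 0 \<le> t \<Longrightarrow> J t \<omega> = None \<longleftrightarrow> L \<omega> \<le> t"
      using g by (auto simp: good_def)
    interpret path "\<lambda>t. c * X t \<omega>" by (rule path_sign[OF c ws])
    have L: "b < L \<omega>" "L \<omega> \<le> b + s"
      using J[of b] J[of "b + s"] B[OF w(2), of b] s by auto
    let ?y = "\<lambda>t. c * X t \<omega>" and ?t = "ext_time c (L \<omega>) \<omega>"
    have t: "?t \<in> amax ?y (L \<omega>)" using L s by (intro ext_time_amax[OF c ws]) auto
    have M: "c * X u \<omega> \<le> wsup ?y 0 (L \<omega>)"
      using L u v by (intro wsup_upper[OF x]) (auto simp: b_def)
    have not: False if bad: "0 \<le> ?t \<and> ?t < r n \<or> b \<le> ?t \<and> ?t < b + r n" "?t \<noteq> b"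
    proof -
      have "?y ?t < wsup ?y 0 (L \<omega>)"
        using le(1)[OF w(1) bad(1)] M r[of n] by linarith
      then have "0 < ?t" "lv ?y ?t = wsup ?y 0 (L \<omega>)" using amaxD(3)[OF t] by auto
      then show False using le(2)[OF w(1) bad(1) _ bad(2)] M r[of n] by linarith
    qed
    have ts: "s \<le> ?t"
    proof (rule ccontr)
      assume "\<not> s \<le> ?t"
      then show False using s amaxD(1)[OF t] by (intro not) auto
    qed
    have tb: "?t \<le> b"
    proof (rule ccontr)
      assume "\<not> ?t \<le> b"
      then show False using s L amaxD(2)[OF t] by (intro not) auto
    qed
    have "J ?t \<omega> = Some k" by (rule B(1)[OF w(2) ts tb])
    moreover have "ext_phase c \<omega> = J ?t \<omega>"
      unfolding ext_phase_def phase_at_def by (rule if_not_P) (use tb L in simp)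
    ultimately show ?thesis by simp
  qed
  have ev: "{\<omega> \<in> space M. ext_phase c \<omega> = Some k} \<in> events"
    using ext_phase_measurable[OF c, of "Some k"] by (simp add: pred_def)
  have "0 < prob (A n) * prob B" using n B'(2) by simp
  also have "\<dots> = prob (A n \<inter> B)" by (rule indep_setD[OF indep_XJ AV B'(1), symmetric])
  also have "\<dots> \<le> prob {\<omega> \<in> space M. ext_phase c \<omega> = Some k}"
  proof (rule finite_measure_mono_AE[OF _ ev])
    show "AE \<omega> in M. \<omega> \<in> A n \<inter> B \<longrightarrow> \<omega> \<in> {\<omega> \<in> space M. ext_phase c \<omega> = Some k}"
      using AE_good by eventually_elim (use hit in \<open>auto simp: good_def\<close>)
  qed
  finally show ?thesis .
qed

end

section \<open>Conditional laws\<close>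

lemma finite_borel_measure_eqI:
  fixes P Q :: "real measure"
  assumes P: "finite_measure P" "sets P = sets borel" and Q: "finite_measure Q" "sets Q = sets borel"
    and eq: "\<And>f :: real \<Rightarrow> real. (\<And>x. isCont f x) \<Longrightarrow> (\<And>x. 0 \<le> f x \<and> f x \<le> 1) \<Longrightarrow> (\<integral>x. f x \<partial>P) = (\<integral>x. f x \<partial>Q)"
  shows "P = Q"
proof (rule measure_eqI_generator_eq[where E="range atMost" and \<Omega>=UNIV and A="\<lambda>i. {..real i}"])
  show "Int_stable (range (atMost :: real \<Rightarrow> real set))"
    by (auto simp: Int_stable_def)
  show "sets P = sigma_sets UNIV (range atMost)" "sets Q = sigma_sets UNIV (range atMost)"
    unfolding P(2) Q(2) by (subst borel_eq_atMost, simp)+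
  show "(\<Union>i. {..real i}) = UNIV" by (auto intro: real_arch_simple)
  show "emeasure P {..real i} \<noteq> \<infinity>" for i
    using finite_measure.emeasure_finite[OF P(1)] by simp
  show "emeasure P Y = emeasure Q Y" if Yr: "Y \<in> range atMost" for Y
  proof -
    obtain a where Y: "Y = {..a}" using Yr by auto
    define f where "f n x = max 0 (min 1 (1 - real n * (x - a)))" for n :: nat and x
    have cont: "isCont (f n) x" for n x unfolding f_def by (intro continuous_intros)
    have fm: "f n \<in> borel_measurable borel" for n by (rule isCont_borel[OF cont])
    have bd: "0 \<le> f n x \<and> f n x \<le> 1" for n x by (simp add: f_def)
    have lim: "(\<lambda>n. f n x) \<longlonglongrightarrow> indicator {..a} x" for x
    proof (cases "x \<le> a")
      case True
      then have "0 \<le> real n * (a - x)" for n by simp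
      then have "f n x = 1" for n by (simp add: f_def algebra_simps)
      then show ?thesis using True by simp
    next
      case False
      then obtain N :: nat where N: "1 / (x - a) < real N" using reals_Archimedean2 by blast
      have "f n x = 0" if "N \<le> n" for n
      proof -
        have "1 / (x - a) < real n" using N that by simp
        then have "1 < real n * (x - a)" using False by (simp add: pos_divide_less_eq)
        then show ?thesis by (simp add: f_def)
      qed
      then have "\<forall>\<^sub>F n in sequentially. f n x = 0" unfolding eventually_sequentially by blast
      then show ?thesis using False by (simp add: tendsto_eventually)
    qed
    have conv: "(\<lambda>n. \<integral>x. f n x \<partial>R) \<longlonglongrightarrow> measure R {..a}" if "finite_measure R" "sets R = sets borel" for R :: "real measure"
    proof -
      interpret R: finite_measure R by (rule that)
      have sR: "space R = UNIV" using sets_eq_imp_space_eq[OF that(2)] by simp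
      have fR: "f n \<in> borel_measurable R" for n using fm[of n] measurable_cong_sets[OF that(2) refl] by blast
      have iR: "(indicator {..a} :: real \<Rightarrow> real) \<in> borel_measurable R" using that(2) by simp
      have "(\<lambda>n. \<integral>x. f n x \<partial>R) \<longlonglongrightarrow> (\<integral>x. indicator {..a} x \<partial>R)"
        by (rule integral_dominated_convergence[where w="\<lambda>_. 1"]) (use fR iR bd lim in auto)
      then show ?thesis using that(2) sR by simp
    qed
    have "(\<integral>x. f n x \<partial>P) = (\<integral>x. f n x \<partial>Q)" for n
      by (rule eq[OF cont bd])
    with conv[OF P] have "(\<lambda>n. \<integral>x. f n x \<partial>Q) \<longlonglongrightarrow> measure P {..a}" by simp
    from LIMSEQ_unique[OF this conv[OF Q]] show ?thesis
      using P(1) Q(1) by (simp add: Y finite_measure.emeasure_eq_measure)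
  qed
qed auto

lemma weighted_law:
  assumes R: "prob_space R" and m: "w \<in> borel_measurable R" "h \<in> borel_measurable R" and bd: "\<And>z. 0 \<le> w z \<and> w z \<le> 1"
  shows "finite_measure (distr (density R (\<lambda>z. ennreal (w z))) borel h)"
    and "f \<in> borel_measurable borel \<Longrightarrow>
      (\<integral>x. f x \<partial>distr (density R (\<lambda>z. ennreal (w z))) borel h) = (\<integral>z. w z * (f (h z) :: real) \<partial>R)"
proof -
  interpret prob_space R by (rule R)
  show "finite_measure (distr (density R (\<lambda>z. ennreal (w z))) borel h)"
  proof (rule finite_measure.finite_measure_distr)
    have "(\<integral>\<^sup>+ z. ennreal (w z) \<partial>R) \<le> (\<integral>\<^sup>+ z. 1 \<partial>R)"
      using bd by (intro nn_integral_mono) (auto simp: ennreal_le_1)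
    also have "\<dots> = 1" by (simp add: emeasure_space_1)
    finally have le: "(\<integral>\<^sup>+ z. ennreal (w z) \<partial>R) \<le> 1" .
    show "finite_measure (density R (\<lambda>z. ennreal (w z)))"
    proof (rule finite_measureI)
      have "emeasure (density R (\<lambda>z. ennreal (w z))) (space (density R (\<lambda>z. ennreal (w z)))) = (\<integral>\<^sup>+ z. ennreal (w z) * indicator (space R) z \<partial>R)"
        using m(1) by (simp add: emeasure_density)
      also have "\<dots> = (\<integral>\<^sup>+ z. ennreal (w z) \<partial>R)"
        by (rule nn_integral_cong) simp
      finally show "emeasure (density R (\<lambda>z. ennreal (w z))) (space (density R (\<lambda>z. ennreal (w z)))) \<noteq> \<infinity>"
        using le by (auto simp: top_unique)
    qed
    show "h \<in> measurable (density R (\<lambda>z. ennreal (w z))) borel" using m(2) by simp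
  qed
  show "(\<integral>x. f x \<partial>distr (density R (\<lambda>z. ennreal (w z))) borel h) = (\<integral>z. w z * f (h z) \<partial>R)"
    if f: "f \<in> borel_measurable borel"
  proof -
    have fh: "(\<lambda>z. f (h z)) \<in> borel_measurable R" by (rule measurable_compose[OF m(2) f])
    have "(\<integral>x. f x \<partial>distr (density R (\<lambda>z. ennreal (w z))) borel h) = (\<integral>z. f (h z) \<partial>density R (\<lambda>z. ennreal (w z)))"
      by (rule integral_distr) (use m f in simp_all)
    also have "\<dots> = (\<integral>z. w z *\<^sub>R f (h z) \<partial>R)"
      by (rule integral_density) (use fh m bd in auto)
    finally show ?thesis by simp
  qed
qed

lemma weighted_law_eq:
  fixes w h :: "'u \<Rightarrow> real" and w' h' :: "'v \<Rightarrow> real"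
  assumes R: "prob_space R" "w \<in> borel_measurable R" "h \<in> borel_measurable R" "\<And>z. 0 \<le> w z \<and> w z \<le> 1"
    and S: "prob_space S" "w' \<in> borel_measurable S" "h' \<in> borel_measurable S" "\<And>z. 0 \<le> w' z \<and> w' z \<le> 1"
    and eq: "\<And>f :: real \<Rightarrow> real. (\<And>x. isCont f x) \<Longrightarrow> (\<And>x. 0 \<le> f x \<and> f x \<le> 1) \<Longrightarrow>
      (\<integral>z. w z * f (h z) \<partial>R) = (\<integral>z. w' z * f (h' z) \<partial>S)"
    and A: "A \<in> sets borel"
  shows "(\<integral>z. w z * indicator A (h z) \<partial>R) = (\<integral>z. w' z * indicator A (h' z) \<partial>S)"
proof -
  note r = weighted_law[OF R] and s = weighted_law[OF S]
  have "distr (density R (\<lambda>z. ennreal (w z))) borel h = distr (density S (\<lambda>z. ennreal (w' z))) borel h'"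
  proof (rule finite_borel_measure_eqI[OF r(1) _ s(1)])
    fix f :: "real \<Rightarrow> real"
    assume f: "\<And>x. isCont f x" "\<And>x. 0 \<le> f x \<and> f x \<le> 1"
    show "(\<integral>x. f x \<partial>distr (density R (\<lambda>z. ennreal (w z))) borel h) = (\<integral>x. f x \<partial>distr (density S (\<lambda>z. ennreal (w' z))) borel h')"
      unfolding r(2)[OF isCont_borel[OF f(1)]] s(2)[OF isCont_borel[OF f(1)]] by (rule eq[OF f])
  qed simp_all
  moreover have "(indicator A :: real \<Rightarrow> real) \<in> borel_measurable borel" using A by simp
  ultimately show ?thesis
    using r(2)[of "indicator A"] s(2)[of "indicator A"] by simp
qed

text \<open>The product formula is extended from continuous functions to indicators one factor at a time.\<close>

lemma pair_law_eqI:
  fixes R :: "(real \<times> real) measure"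
  assumes R: "prob_space R" "sets R = sets (borel \<Otimes>\<^sub>M borel)"
    and P: "prob_space P" "sets P = sets borel" and Q: "prob_space Q" "sets Q = sets borel"
    and eq: "\<And>f g :: real \<Rightarrow> real. (\<And>x. isCont f x) \<Longrightarrow> (\<And>x. 0 \<le> f x \<and> f x \<le> 1) \<Longrightarrow>
      (\<And>x. isCont g x) \<Longrightarrow> (\<And>x. 0 \<le> g x \<and> g x \<le> 1) \<Longrightarrow>
      (\<integral>z. f (fst z) * g (snd z) \<partial>R) = (\<integral>x. f x \<partial>P) * (\<integral>y. g y \<partial>Q)"
  shows "R = P \<Otimes>\<^sub>M Q"
proof -
  interpret R: prob_space R by (rule R)
  interpret P: prob_space P by (rule P)
  interpret Q: prob_space Q by (rule Q)
  have spR: "space R = UNIV" using sets_eq_imp_space_eq[OF R(2)] by (simp add: space_pair_measure)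
  have spP: "space P = UNIV" and spQ: "space Q = UNIV"
    using sets_eq_imp_space_eq[OF P(2)] sets_eq_imp_space_eq[OF Q(2)] by auto
  have fst_R: "fst \<in> measurable R borel" and snd_R: "snd \<in> measurable R borel"
    by (simp_all add: measurable_cong_sets[OF R(2) refl])
  have id: "(\<lambda>x. x) \<in> borel_measurable P" "(\<lambda>x. x) \<in> borel_measurable Q"
    by (simp_all add: measurable_cong_sets[OF P(2) refl] measurable_cong_sets[OF Q(2) refl])
  have half: "(\<integral>z. g (snd z) * indicator A (fst z) \<partial>R) = (\<integral>y. g y \<partial>Q) * measure P A"
    if g: "\<And>x. isCont g x" "\<And>x. 0 \<le> g x \<and> g x \<le> 1" and A: "A \<in> sets borel" for g :: "real \<Rightarrow> real" and A
  proof -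
    have gQ: "g \<in> borel_measurable Q"
      using isCont_borel[OF g(1)] by (simp add: measurable_cong_sets[OF Q(2) refl])
    have "0 \<le> (\<integral>y. g y \<partial>Q)" using g(2) by (intro integral_nonneg_AE) auto
    moreover have "(\<integral>y. g y \<partial>Q) \<le> 1"
      using g(2) gQ by (intro Q.integral_le_const Q.integrable_const_bound[where B=1]) auto
    ultimately have "(\<integral>z. g (snd z) * indicator A (fst z) \<partial>R) = (\<integral>x. (\<integral>y. g y \<partial>Q) * indicator A x \<partial>P)"
      using measurable_compose[OF snd_R isCont_borel[OF g(1)]] g(2) A
      by (intro weighted_law_eq[OF R(1) _ fst_R _ P(1) _ id(1)]) (simp_all add: eq[OF _ _ g, symmetric] mult.commute)
    then show ?thesis using A P(2) spP by simp
  qed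
  have full: "measure R (A \<times> B) = measure P A * measure Q B" if A: "A \<in> sets borel" and B: "B \<in> sets borel" for A B
  proof -
    have "(\<integral>z. indicator A (fst z) * indicator B (snd z) \<partial>R) = (\<integral>y. measure P A * indicator B y \<partial>Q)"
    proof (rule weighted_law_eq[OF R(1) _ snd_R _ Q(1) _ id(2) _ _ B])
      show "(\<lambda>z. indicator A (fst z) :: real) \<in> borel_measurable R"
        using A by (intro measurable_compose[OF fst_R]) simp
      show "(\<integral>z. indicator A (fst z) * g (snd z) \<partial>R) = (\<integral>y. measure P A * g y \<partial>Q)"
        if "\<And>x. isCont g x" "\<And>x. 0 \<le> g x \<and> g x \<le> 1" for g :: "real \<Rightarrow> real"
        using half[OF that A] by (simp add: mult.commute)
    qed (auto simp: indicator_def)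
    moreover have "indicator A (fst z) * indicator B (snd z) = (indicator (A \<times> B) z :: real)" for z
      by (cases z) (auto simp: indicator_def)
    moreover have "A \<times> B \<in> sets R" unfolding R(2) using A B by simp
    ultimately show ?thesis using B Q(2) spQ spR by simp
  qed
  have "P \<Otimes>\<^sub>M Q = R"
  proof (rule pair_measure_eqI)
    show "sigma_finite_measure P" "sigma_finite_measure Q" by unfold_locales
    show "sets (P \<Otimes>\<^sub>M Q) = sets R"
      unfolding R(2) by (rule sets_pair_measure_cong[OF P(2) Q(2)])
    show "emeasure P A * emeasure Q B = emeasure R (A \<times> B)" if "A \<in> sets P" "B \<in> sets Q" for A B
      using full[of A B] that P(2) Q(2)
      by (simp add: P.emeasure_eq_measure Q.emeasure_eq_measure R.emeasure_eq_measure ennreal_mult)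
  qed
  then show ?thesis by simp
qed

lemma (in prob_space) cond_law:
  assumes E: "{\<omega> \<in> space M. E \<omega>} \<in> events" "0 < prob {\<omega> \<in> space M. E \<omega>}" and Y: "Y \<in> measurable M N"
  shows "prob_space (cond_law M N Y E)"
    and "f \<in> borel_measurable N \<Longrightarrow> (\<integral>x. f x \<partial>cond_law M N Y E) =
      expectation (\<lambda>\<omega>. f (Y \<omega>) * (if E \<omega> then 1 else 0)) / prob {\<omega> \<in> space M. E \<omega>}"
proof -
  let ?A = "{\<omega> \<in> space M. E \<omega>}"
  have A: "emeasure M ?A \<noteq> 0" "emeasure M ?A \<noteq> \<infinity>" using E(2) by (auto simp: emeasure_eq_measure)
  have YU: "Y \<in> measurable (uniform_measure M ?A) N" using Y by simp
  show "prob_space (cond_law M N Y E)"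
    unfolding cond_law_def by (rule prob_space.prob_space_distr[OF prob_space_uniform_measure[OF A] YU])
  show "(\<integral>x. f x \<partial>cond_law M N Y E) = expectation (\<lambda>\<omega>. f (Y \<omega>) * (if E \<omega> then 1 else 0)) / prob ?A"
    if f: "f \<in> borel_measurable N" for f :: "_ \<Rightarrow> real"
  proof -
    have fY: "(\<lambda>\<omega>. f (Y \<omega>)) \<in> borel_measurable M" by (rule measurable_compose[OF Y f])
    have U: "uniform_measure M ?A = density M (\<lambda>\<omega>. ennreal (indicator ?A \<omega> / prob ?A))"
      unfolding uniform_measure_def
    proof (rule density_cong)
      show "AE \<omega> in M. indicator ?A \<omega> / emeasure M ?A = ennreal (indicator ?A \<omega> / prob ?A)"
        using E(2) by (intro always_eventually allI)
          (auto simp: emeasure_eq_measure divide_ennreal[symmetric] indicator_def)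
    qed (use E(1) in simp_all)
    have "(\<integral>x. f x \<partial>cond_law M N Y E) = (\<integral>\<omega>. f (Y \<omega>) \<partial>uniform_measure M ?A)"
      unfolding cond_law_def by (rule integral_distr[OF YU f])
    also have "\<dots> = expectation (\<lambda>\<omega>. (indicator ?A \<omega> / prob ?A) *\<^sub>R f (Y \<omega>))"
      unfolding U using fY E by (intro integral_density) auto
    also have "\<dots> = expectation (\<lambda>\<omega>. f (Y \<omega>) * (if E \<omega> then 1 else 0) / prob ?A)"
      by (rule Bochner_Integration.integral_cong) (auto simp: indicator_def)
    finally show ?thesis by simp
  qed
qed

lemma cond_law_cong:
  assumes "\<And>\<omega>. \<omega> \<in> space M \<Longrightarrow> Y \<omega> = Y' \<omega>" "\<And>\<omega>. \<omega> \<in> space M \<Longrightarrow> E \<omega> \<longleftrightarrow> E' \<omega>"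
  shows "cond_law M N Y E = cond_law M N Y' E'"
proof -
  have "{\<omega> \<in> space M. E \<omega>} = {\<omega> \<in> space M. E' \<omega>}" using assms(2) by auto
  then show ?thesis
    unfolding cond_law_def using assms(1) by (intro distr_cong) auto
qed

lemma distr_process_law:
  assumes t: "0 \<le> t" and X: "\<And>t. 0 \<le> t \<Longrightarrow> X t \<in> measurable M S"
  shows "distr (process_law M S X) S (\<lambda>p. p t) = distr M S (X t)"
proof -
  have p: "path_map X \<in> measurable M (Pi\<^sub>M {0..} (\<lambda>_. S))"
    unfolding path_map_def[abs_def] using X by (intro measurable_restrict) auto
  have c: "(\<lambda>p. p t) \<in> measurable (Pi\<^sub>M {0..} (\<lambda>_. S)) S"
    using t by (intro measurable_component_singleton) simp
  have "(\<lambda>p. p t) \<circ> path_map X = X t" using t by (simp add: fun_eq_iff path_map_def)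
  then show ?thesis
    unfolding process_law_def using distr_distr[OF c p] by simp
qed

context killed_levy
begin

lemma alive_tendsto_0: "((\<lambda>t. \<Sum>k\<in>UNIV. occ_prob a U t k) \<longlongrightarrow> 0) at_top"
proof (rule tendsto_at_topI_sequentially)
  fix t :: "nat \<Rightarrow> real" assume t: "filterlim t at_top sequentially"
  have "(\<lambda>n. expectation (indicator {\<omega> \<in> space M. 0 \<le> t n \<and> J (t n) \<omega> \<noteq> None} :: 'w \<Rightarrow> real)) \<longlonglongrightarrow> expectation (\<lambda>_. 0)"
  proof (rule integral_dominated_convergence[where w="\<lambda>_. 1"])
    show "AE \<omega> in M. (\<lambda>n. indicator {\<omega> \<in> space M. 0 \<le> t n \<and> J (t n) \<omega> \<noteq> None} \<omega> :: real) \<longlonglongrightarrow> 0"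
      using AE_lifetime
    proof eventually_elim
      case (elim \<omega>)
      have "\<forall>\<^sub>F n in sequentially. L \<omega> \<le> t n" using t by (simp add: filterlim_at_top)
      then have "\<forall>\<^sub>F n in sequentially. indicator {\<omega> \<in> space M. 0 \<le> t n \<and> J (t n) \<omega> \<noteq> None} \<omega> = (0::real)"
      proof eventually_elim
        case (elim n)
        then show ?case using \<open>0 < L \<omega> \<and> _\<close> by (simp add: indicator_def)
      qed
      then show ?case by (rule tendsto_eventually)
    qed
    show "(indicator {\<omega> \<in> space M. 0 \<le> t n \<and> J (t n) \<omega> \<noteq> None} :: 'w \<Rightarrow> real) \<in> borel_measurable M" for n
    proof (cases "0 \<le> t n")
      case True
      then have [measurable]: "J (t n) \<in> measurable M (count_space UNIV)" by (rule MJ.J_meas)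
      show ?thesis by measurable
    qed simp
  qed (auto simp: indicator_def)
  then have lim: "(\<lambda>n. prob {\<omega> \<in> space M. 0 \<le> t n \<and> J (t n) \<omega> \<noteq> None}) \<longlonglongrightarrow> 0"
    by (simp add: Int_def conj_ac cong: conj_cong)
  have "\<forall>\<^sub>F n in sequentially. 0 \<le> t n" using t by (simp add: filterlim_at_top)
  then have "\<forall>\<^sub>F n in sequentially. prob {\<omega> \<in> space M. 0 \<le> t n \<and> J (t n) \<omega> \<noteq> None} = (\<Sum>k\<in>UNIV. occ_prob a U (t n) k)"
  proof eventually_elim
    case (elim n)
    have "prob {\<omega> \<in> space M. J (t n) \<omega> \<noteq> None} = (\<Sum>y\<in>UNIV. prob {\<omega> \<in> space M. J (t n) \<omega> = y \<and> J (t n) \<omega> \<noteq> None})"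
      using elim by (intro prob_finite_split) auto
    also have "\<dots> = (\<Sum>k\<in>UNIV. prob {\<omega> \<in> space M. J (t n) \<omega> = Some k})"
    proof -
      have "{\<omega> \<in> space M. J (t n) \<omega> = None \<and> J (t n) \<omega> \<noteq> None} = {}"
        "{\<omega> \<in> space M. J (t n) \<omega> = Some k \<and> J (t n) \<omega> \<noteq> None} = {\<omega> \<in> space M. J (t n) \<omega> = Some k}" for k
        by auto
      then show ?thesis by (simp only: sum_UNIV_option measure_empty add_0_left)
    qed
    finally show ?case using elim by (simp add: prob_J)
  qed
  from Lim_transform_eventually[OF lim this]
  show "(\<lambda>n. \<Sum>k\<in>UNIV. occ_prob a U (t n) k) \<longlonglongrightarrow> 0" .
qed

lemma ext_phase_event: "c = 1 \<or> c = -1 \<Longrightarrow> {\<omega> \<in> space M. ext_phase c \<omega> = i} \<in> events"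
  using ext_phase_measurable[of c i] by (simp add: pred_def)

lemma ext_moment_1:
  assumes "c = 1 \<or> c = -1"
  shows "ext_moment c k (\<lambda>_. 1) (\<lambda>_. 1) = prob {\<omega> \<in> space M. ext_phase c \<omega> = Some k}"
proof -
  have "ext_moment c k (\<lambda>_. 1) (\<lambda>_. 1) = expectation (indicator {\<omega> \<in> space M. ext_phase c \<omega> = Some k})"
    unfolding ext_moment_def by (rule Bochner_Integration.integral_cong) (auto simp: indicator_def)
  then show ?thesis by (simp add: Int_def conj_ac cong: conj_cong)
qed

lemma step_law_eq_distr:
  assumes "0 \<le> h" shows "step_law e h = distr (distr M borel (X h)) borel (\<lambda>x. x - e * h)"
  using MX.X_meas[OF assms] by (simp add: step_law_def distr_distr o_def)

lemma non_monotone_times: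
  assumes "non_monotone M X"
  shows "\<exists>u>0. 0 < prob {\<omega> \<in> space M. 0 < X u \<omega>}" "\<exists>v>0. 0 < prob {\<omega> \<in> space M. X v \<omega> < 0}"
proof -
  have "\<not> (AE \<omega> in M. \<forall>s t. 0 \<le> s \<longrightarrow> s \<le> t \<longrightarrow> 1 * X t \<omega> \<le> 1 * X s \<omega>)"
  proof
    assume "AE \<omega> in M. \<forall>s t. 0 \<le> s \<longrightarrow> s \<le> t \<longrightarrow> 1 * X t \<omega> \<le> 1 * X s \<omega>"
    then have "AE \<omega> in M. antimono_on {0..} (\<lambda>t. X t \<omega>)"
      by eventually_elim (auto simp: monotone_on_def)
    with assms show False by (simp add: non_monotone_def)
  qed
  from ex_positive_time[OF _ this] show "\<exists>u>0. 0 < prob {\<omega> \<in> space M. 0 < X u \<omega>}" by simp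
  have "\<not> (AE \<omega> in M. \<forall>s t. 0 \<le> s \<longrightarrow> s \<le> t \<longrightarrow> (-1) * X t \<omega> \<le> (-1) * X s \<omega>)"
  proof
    assume "AE \<omega> in M. \<forall>s t. 0 \<le> s \<longrightarrow> s \<le> t \<longrightarrow> (-1) * X t \<omega> \<le> (-1) * X s \<omega>"
    then have "AE \<omega> in M. mono_on {0..} (\<lambda>t. X t \<omega>)"
      by eventually_elim (auto simp: monotone_on_def)
    with assms show False by (simp add: non_monotone_def)
  qed
  from ex_positive_time[OF _ this] show "\<exists>v>0. 0 < prob {\<omega> \<in> space M. X v \<omega> < 0}" by simp
qed

lemma prob_X_pos_neg:
  assumes "0 \<le> t"
  shows "prob {\<omega> \<in> space M. 0 < X t \<omega>} = measure (distr M borel (X t)) {0<..}"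
    "prob {\<omega> \<in> space M. X t \<omega> < 0} = measure (distr M borel (X t)) {..<0}"
  using MX.X_meas[OF assms] by (simp_all add: measure_distr vimage_def Int_def conj_commute)

end

lemma reversed_killed_levy:
  assumes r: "reversal U b" and lp: "levy_with_phases M X J (reversed_initial b U) (reversed_generator b U)"
  shows "decaying_killed_levy M X J (reversed_initial b U) (reversed_generator b U)"
proof -
  interpret reversal U b by (rule r)
  show ?thesis
    by unfold_locales (rule lp subgenerator_reversed surv_reversed_tendsto_0)+
qed

text \<open>The sampled pre-minimum part of the reversed process and the sampled post-maximum part of the
  original one share the factor \<open>flow_series\<close>, up to constants that do not depend on the test
  function.\<close>

lemma reversed_series_tendsto:
  assumes P: "decaying_killed_levy P X J a U" and r: "reversal U b"
    and R: "decaying_killed_levy R Y I (reversed_initial b U) (reversed_generator b U)"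
    and eq: "process_law R borel Y = process_law P borel X"
    and g: "\<And>x. isCont g x" "\<And>x. 0 \<le> g x \<and> g x \<le> 1"
  shows "((\<lambda>q. occupation b U $ k *
      decaying_killed_levy.post_series R Y (reversed_generator b U) (-1) k (\<lambda>_. 1) (tilt q) (mesh q) *
      decaying_killed_levy.flow_series P X U 1 k g (tilt q) (mesh q)) \<longlongrightarrow>
    killed_levy.ext_moment R Y I (-1) k g (\<lambda>_. 1)) iter_seq"
proof -
  interpret P: decaying_killed_levy P X J a U by (rule P)
  interpret R: decaying_killed_levy R Y I "reversed_initial b U" "reversed_generator b U" by (rule R)
  interpret reversal U b by (rule r)
  have law: "R.step_law e h = P.step_law e h" if "0 < h" for e h
  proof -
    have "distr R borel (Y h) = distr P borel (X h)"
      using distr_process_law[of h Y R borel] distr_process_law[of h X P borel] that eq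
      by (simp add: P.MX.X_meas R.MX.X_meas)
    then show ?thesis using that by (simp add: P.step_law_eq_distr R.step_law_eq_distr)
  qed
  have ud: "up (-1) = dn 1" by (simp add: up_def dn_def)
  have pre: "R.pre_series (-1) k g (tilt q) (mesh q) = nu k * P.flow_series 1 k g (tilt q) (mesh q)" for q
  proof -
    have h: "0 < mesh q" by simp
    have "R.pre_series (-1) k g (tilt q) (mesh q) =
      (\<Sum>m. nu k * (walk_exp (P.step_law (tilt q) (mesh q)) (dn 1) g m * exit_flow U (real m * mesh q) k))"
      unfolding R.pre_series_def law[OF h] ud occ_prob_reversed by (simp only: mult.left_commute)
    also have "\<dots> = nu k * P.flow_series 1 k g (tilt q) (mesh q)"
      unfolding P.flow_series_def
      by (rule suminf_mult[OF P.flow_series_summable[OF h isCont_borel[OF g(1)] g(2)]])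
    finally show ?thesis .
  qed
  have "((\<lambda>q. R.pre_series (-1) k g (tilt q) (mesh q) * R.post_series (-1) k (\<lambda>_. 1) (tilt q) (mesh q)) \<longlongrightarrow>
    R.ext_moment (-1) k g (\<lambda>_. 1)) iter_seq"
    by (rule R.series_tendsto) (use g in auto)
  then show ?thesis unfolding pre by (simp only: mult_ac)
qed

lemma cross_limit:
  fixes x y F G :: "nat \<times> nat \<Rightarrow> real"
  assumes "((\<lambda>q. x q * F q) \<longlongrightarrow> a) iter_seq" "((\<lambda>q. x q * G q) \<longlongrightarrow> b) iter_seq"
    "((\<lambda>q. y q * F q) \<longlongrightarrow> c) iter_seq" "((\<lambda>q. y q * G q) \<longlongrightarrow> d) iter_seq"
  shows "a * d = b * c"
proof (rule tendsto_unique[OF iter_seq_neq_bot])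
  show "((\<lambda>q. (x q * F q) * (y q * G q)) \<longlongrightarrow> a * d) iter_seq"
    by (intro tendsto_mult assms)
  have "((\<lambda>q. (x q * G q) * (y q * F q)) \<longlongrightarrow> b * c) iter_seq"
    by (intro tendsto_mult assms)
  then show "((\<lambda>q. (x q * F q) * (y q * G q)) \<longlongrightarrow> b * c) iter_seq"
    by (simp only: mult_ac)
qed

lemma reversed_ext_phase_positive:
  assumes P: "killed_levy P X J a U" and nm: "non_monotone P X" and r: "reversal U b"
    and R: "decaying_killed_levy R Y I (reversed_initial b U) (reversed_generator b U)"
    and eq: "process_law R borel Y = process_law P borel X"
  shows "0 < measure R {\<omega> \<in> space R. killed_levy.ext_phase Y I (-1) \<omega> = Some k}"
proof -
  interpret P: killed_levy P X J a U by (rule P)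
  interpret R: decaying_killed_levy R Y I "reversed_initial b U" "reversed_generator b U" by (rule R)
  interpret reversal U b by (rule r)
  have law: "distr R borel (Y t) = distr P borel (X t)" if "0 < t" for t
    using distr_process_law[of t Y R borel] distr_process_law[of t X P borel] that eq
    by (simp add: P.MX.X_meas R.MX.X_meas)
  obtain u where u: "0 < u" "0 < P.prob {\<omega> \<in> space P. 0 < X u \<omega>}"
    using P.non_monotone_times(1)[OF nm] by auto
  obtain v where v: "0 < v" "0 < P.prob {\<omega> \<in> space P. X v \<omega> < 0}"
    using P.non_monotone_times(2)[OF nm] by auto
  have u': "0 < R.prob {\<omega> \<in> space R. 0 < Y u \<omega>}" and v': "0 < R.prob {\<omega> \<in> space R. Y v \<omega> < 0}"
    using u v by (simp_all add: P.prob_X_pos_neg R.prob_X_pos_neg law)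
  show ?thesis
  proof (rule R.ext_phase_positive[where u=v and v=u])
    show "0 < occ_prob (reversed_initial b U) (reversed_generator b U) t k" if "0 < t" for t
      unfolding occ_prob_reversed
      by (intro mult_pos_pos occupation_pos exit_flow_pos[OF U b lim that])
    show "surv (reversed_generator b U) t k < 1" if "0 < t" for t
    proof (rule surv_less_1[OF subgenerator_reversed that])
      show "0 < exit_flow (reversed_generator b U) s k" if "0 < s" for s
        unfolding exit_flow_reversed
        by (intro divide_pos_pos occupation_pos occ_prob_pos[OF U b that])
    qed
  qed (use u(1) v(1) u' v' in simp_all)
qed

context killed_levy
begin

lemma cond_law_ext_value:
  assumes c: "c = 1 \<or> c = -1" and pos: "0 < prob {\<omega> \<in> space M. ext_phase c \<omega> = Some k}"
  shows "prob_space (cond_law M borel (ext_value c) (\<lambda>\<omega>. ext_phase c \<omega> = Some k))"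
    and "f \<in> borel_measurable borel \<Longrightarrow> (\<integral>x. f x \<partial>cond_law M borel (ext_value c) (\<lambda>\<omega>. ext_phase c \<omega> = Some k)) =
      ext_moment c k f (\<lambda>_. 1) / prob {\<omega> \<in> space M. ext_phase c \<omega> = Some k}"
proof -
  note law = cond_law[OF ext_phase_event[OF c] pos ext_value_measurable[OF c]]
  show "prob_space (cond_law M borel (ext_value c) (\<lambda>\<omega>. ext_phase c \<omega> = Some k))" by (rule law(1))
  show "(\<integral>x. f x \<partial>cond_law M borel (ext_value c) (\<lambda>\<omega>. ext_phase c \<omega> = Some k)) =
      ext_moment c k f (\<lambda>_. 1) / prob {\<omega> \<in> space M. ext_phase c \<omega> = Some k}" if "f \<in> borel_measurable borel"
    unfolding law(2)[OF that] ext_moment_def by simp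
qed

lemma cond_law_ext_pair:
  assumes c: "c = 1 \<or> c = -1" and pos: "0 < prob {\<omega> \<in> space M. ext_phase c \<omega> = Some k}"
  defines "R \<equiv> cond_law M (borel \<Otimes>\<^sub>M borel) (\<lambda>\<omega>. (ext_value c \<omega>, X (L \<omega>) \<omega> - ext_value c \<omega>))
    (\<lambda>\<omega>. ext_phase c \<omega> = Some k)"
  shows "prob_space R"
    and "f \<in> borel_measurable borel \<Longrightarrow> g \<in> borel_measurable borel \<Longrightarrow> (\<integral>z. f (fst z) * g (snd z) \<partial>R) =
      ext_moment c k f g / prob {\<omega> \<in> space M. ext_phase c \<omega> = Some k}"
proof -
  have [measurable]: "(\<lambda>\<omega>. X (L \<omega>) \<omega>) \<in> borel_measurable M"
    by (rule MX.X_random_time[OF MJ.lifetime_measurable MJ.lifetime_nonneg])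
  note [measurable] = ext_value_measurable[OF c]
  have Y: "(\<lambda>\<omega>. (ext_value c \<omega>, X (L \<omega>) \<omega> - ext_value c \<omega>)) \<in> measurable M (borel \<Otimes>\<^sub>M borel)"
    by measurable
  note law = cond_law[OF ext_phase_event[OF c] pos Y]
  show "prob_space R" unfolding R_def by (rule law(1))
  show "(\<integral>z. f (fst z) * g (snd z) \<partial>R) = ext_moment c k f g / prob {\<omega> \<in> space M. ext_phase c \<omega> = Some k}"
    if [measurable]: "f \<in> borel_measurable borel" "g \<in> borel_measurable borel"
  proof -
    have "(\<lambda>z. f (fst z) * g (snd z)) \<in> borel_measurable (borel \<Otimes>\<^sub>M borel)" by measurable
    from law(2)[OF this] show ?thesis by (simp add: R_def ext_moment_def)
  qed
qed

end

theorem corollary2: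
  fixes P :: "'a measure" and X :: "real \<Rightarrow> 'a \<Rightarrow> real" and J :: "real \<Rightarrow> 'a \<Rightarrow> 'n::finite option"
    and Ps :: "'b measure" and Xs :: "real \<Rightarrow> 'b \<Rightarrow> real" and Js :: "real \<Rightarrow> 'b \<Rightarrow> 'n option"
    and Ph :: "'c measure" and Xh :: "real \<Rightarrow> 'c \<Rightarrow> real" and Jh :: "real \<Rightarrow> 'c \<Rightarrow> 'n option"
    and \<alpha> \<alpha>h :: "real^'n" and T :: "real^'n^'n"
  assumes "subgenerator T" and "\<alpha> \<in> restart_vectors T" and "\<alpha>h \<in> restart_vectors T"
    and "levy_with_phases P X J \<alpha> T" and "non_monotone P X"
    and "levy_with_phases Ps Xs Js (reversed_initial \<alpha> T) (reversed_generator \<alpha> T)"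
    and "process_law Ps borel Xs = process_law P borel X"
    and "levy_with_phases Ph Xh Jh (reversed_initial \<alpha>h T) (reversed_generator \<alpha>h T)"
    and "process_law Ph borel Xh = process_law P borel X"
  shows "(\<forall>k.
      cond_law P (borel \<Otimes>\<^sub>M borel)
        (\<lambda>\<omega>. (run_sup X (lifetime J \<omega>) \<omega>, X (lifetime J \<omega>) \<omega> - run_sup X (lifetime J \<omega>) \<omega>))
        (\<lambda>\<omega>. phase_at_sup X J \<omega> = Some k)
      = cond_law P borel (\<lambda>\<omega>. run_sup X (lifetime J \<omega>) \<omega>) (\<lambda>\<omega>. phase_at_sup X J \<omega> = Some k)
        \<Otimes>\<^sub>M cond_law Ph borel (\<lambda>\<omega>. run_inf Xh (lifetime Jh \<omega>) \<omega>)
              (\<lambda>\<omega>. phase_at_inf Xh Jh \<omega> = Some k))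
    \<and> (\<forall>k.
      cond_law Ps borel (\<lambda>\<omega>. run_inf Xs (lifetime Js \<omega>) \<omega>) (\<lambda>\<omega>. phase_at_inf Xs Js \<omega> = Some k)
      = cond_law Ph borel (\<lambda>\<omega>. run_inf Xh (lifetime Jh \<omega>) \<omega>)
          (\<lambda>\<omega>. phase_at_inf Xh Jh \<omega> = Some k))"
proof -
  note T = assms(1) and lev = assms(4,6,8)
  have one: "\<And>x :: real. isCont (\<lambda>_. 1 :: real) x" "\<And>x :: real. 0 \<le> (1 :: real) \<and> (1 :: real) \<le> 1" by auto
  have P0: "killed_levy P X J \<alpha> T" by unfold_locales (rule lev T)+
  have lim: "((\<lambda>t. surv T t i) \<longlongrightarrow> 0) at_top" for i
    by (rule surv_tendsto_0[OF T assms(2) killed_levy.alive_tendsto_0[OF P0]])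
  have ra: "reversal T \<alpha>" and rh: "reversal T \<alpha>h" by unfold_locales (rule T assms(2,3) lim)+
  have Pd: "decaying_killed_levy P X J \<alpha> T"
    using P0 lim by (simp add: decaying_killed_levy_def decaying_killed_levy_axioms_def)
  note Sd = reversed_killed_levy[OF ra lev(2)] and Hd = reversed_killed_levy[OF rh lev(3)]
  interpret P: decaying_killed_levy P X J \<alpha> T by (rule Pd)
  interpret S: decaying_killed_levy Ps Xs Js "reversed_initial \<alpha> T" "reversed_generator \<alpha> T" by (rule Sd)
  interpret H: decaying_killed_levy Ph Xh Jh "reversed_initial \<alpha>h T" "reversed_generator \<alpha>h T" by (rule Hd)
  have flow: "0 < exit_flow T t k" if "0 < t" for t k
    by (rule exit_flow_pos[OF T assms(2) lim that])
  obtain u where u: "0 < u" "0 < P.prob {\<omega> \<in> space P. 0 < X u \<omega>}"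
    using P.non_monotone_times(1)[OF assms(5)] by auto
  obtain v where v: "0 < v" "0 < P.prob {\<omega> \<in> space P. X v \<omega> < 0}"
    using P.non_monotone_times(2)[OF assms(5)] by auto
  have posP: "0 < P.prob {\<omega> \<in> space P. P.ext_phase 1 \<omega> = Some k}" for k
    using u v occ_prob_pos[OF T assms(2)] surv_less_1[OF T _ flow]
    by (intro P.ext_phase_positive[of 1 u v]) auto
  have posS: "0 < S.prob {\<omega> \<in> space Ps. S.ext_phase (-1) \<omega> = Some k}" for k
    by (rule reversed_ext_phase_positive[OF P0 assms(5) ra Sd assms(7)])
  have posH: "0 < H.prob {\<omega> \<in> space Ph. H.ext_phase (-1) \<omega> = Some k}" for k
    by (rule reversed_ext_phase_positive[OF P0 assms(5) rh Hd assms(9)])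
  have h: "cond_law Ph borel (\<lambda>\<omega>. run_inf Xh (lifetime Jh \<omega>) \<omega>) (\<lambda>\<omega>. phase_at_inf Xh Jh \<omega> = Some k) =
      cond_law Ph borel (H.ext_value (-1)) (\<lambda>\<omega>. H.ext_phase (-1) \<omega> = Some k)" for k
    by (rule cond_law_cong) (simp_all add: H.inf_ext)
  have s: "cond_law Ps borel (\<lambda>\<omega>. run_inf Xs (lifetime Js \<omega>) \<omega>) (\<lambda>\<omega>. phase_at_inf Xs Js \<omega> = Some k) =
      cond_law Ps borel (S.ext_value (-1)) (\<lambda>\<omega>. S.ext_phase (-1) \<omega> = Some k)" for k
    by (rule cond_law_cong) (simp_all add: S.inf_ext)
  have sets_cond_law: "sets (cond_law P borel Y0 E0) = sets borel" "sets (cond_law Ph borel Y1 E1) = sets borel"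
    "sets (cond_law Ps borel Y2 E2) = sets borel" "sets (cond_law P (borel \<Otimes>\<^sub>M borel) Y3 E3) = sets (borel \<Otimes>\<^sub>M borel)"
    for Y0 Y1 Y2 :: "_ \<Rightarrow> real" and E0 E1 E2 E3 and Y3 :: "_ \<Rightarrow> real \<times> real"
    by (simp_all add: cond_law_def)
  show ?thesis
  proof (intro conjI allI)
    fix k
    show "cond_law P (borel \<Otimes>\<^sub>M borel)
        (\<lambda>\<omega>. (run_sup X (lifetime J \<omega>) \<omega>, X (lifetime J \<omega>) \<omega> - run_sup X (lifetime J \<omega>) \<omega>))
        (\<lambda>\<omega>. phase_at_sup X J \<omega> = Some k)
      = cond_law P borel (\<lambda>\<omega>. run_sup X (lifetime J \<omega>) \<omega>) (\<lambda>\<omega>. phase_at_sup X J \<omega> = Some k)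
        \<Otimes>\<^sub>M cond_law Ph borel (\<lambda>\<omega>. run_inf Xh (lifetime Jh \<omega>) \<omega>)
              (\<lambda>\<omega>. phase_at_inf Xh Jh \<omega> = Some k)"
      unfolding h P.sup_ext
    proof (rule pair_law_eqI)
      fix f g :: "real \<Rightarrow> real"
      assume f: "\<And>x. isCont f x" "\<And>x. 0 \<le> f x \<and> f x \<le> 1" and g: "\<And>x. isCont g x" "\<And>x. 0 \<le> g x \<and> g x \<le> 1"
      let ?p = "P.prob {\<omega> \<in> space P. P.ext_phase 1 \<omega> = Some k}"
      let ?q = "H.prob {\<omega> \<in> space Ph. H.ext_phase (-1) \<omega> = Some k}"
      have prod: "P.ext_moment 1 k f g * ?p = P.ext_moment 1 k f (\<lambda>_. 1) * P.ext_moment 1 k (\<lambda>_. 1) g"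
        using P.ext_moment_product[of 1 f g k] f g by (simp add: P.ext_moment_1)
      have cross: "P.ext_moment 1 k (\<lambda>_. 1) g * ?q = ?p * H.ext_moment (-1) k g (\<lambda>_. 1)"
        using cross_limit[OF
            P.flow_series_tendsto[of 1 g k, unfolded mult.assoc[symmetric]]
            P.flow_series_tendsto[of 1 "\<lambda>_. 1" k, unfolded mult.assoc[symmetric]]
            reversed_series_tendsto[OF Pd rh Hd assms(9) g]
            reversed_series_tendsto[OF Pd rh Hd assms(9) one]] g
        by (simp add: P.ext_moment_1 H.ext_moment_1)
      have "?p * (P.ext_moment 1 k f g * ?q) = P.ext_moment 1 k f (\<lambda>_. 1) * (P.ext_moment 1 k (\<lambda>_. 1) g * ?q)"
        using prod by (simp add: mult_ac)
      also have "\<dots> = ?p * (P.ext_moment 1 k f (\<lambda>_. 1) * H.ext_moment (-1) k g (\<lambda>_. 1))"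
        unfolding cross by (simp add: mult_ac)
      finally have "P.ext_moment 1 k f g * ?q = P.ext_moment 1 k f (\<lambda>_. 1) * H.ext_moment (-1) k g (\<lambda>_. 1)"
        using posP[of k] by simp
      then show "(\<integral>z. f (fst z) * g (snd z) \<partial>cond_law P (borel \<Otimes>\<^sub>M borel)
          (\<lambda>\<omega>. (P.ext_value 1 \<omega>, X (lifetime J \<omega>) \<omega> - P.ext_value 1 \<omega>)) (\<lambda>\<omega>. P.ext_phase 1 \<omega> = Some k)) =
        (\<integral>x. f x \<partial>cond_law P borel (P.ext_value 1) (\<lambda>\<omega>. P.ext_phase 1 \<omega> = Some k)) *
        (\<integral>y. g y \<partial>cond_law Ph borel (H.ext_value (-1)) (\<lambda>\<omega>. H.ext_phase (-1) \<omega> = Some k))"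
        using posP[of k] posH[of k] isCont_borel[OF f(1)] isCont_borel[OF g(1)]
        by (simp add: P.cond_law_ext_pair P.cond_law_ext_value H.cond_law_ext_value field_simps)
    qed (simp_all add: P.cond_law_ext_pair P.cond_law_ext_value H.cond_law_ext_value posP posH sets_cond_law)
  next
    fix k
    show "cond_law Ps borel (\<lambda>\<omega>. run_inf Xs (lifetime Js \<omega>) \<omega>) (\<lambda>\<omega>. phase_at_inf Xs Js \<omega> = Some k)
      = cond_law Ph borel (\<lambda>\<omega>. run_inf Xh (lifetime Jh \<omega>) \<omega>) (\<lambda>\<omega>. phase_at_inf Xh Jh \<omega> = Some k)"
      unfolding h s
    proof (rule finite_borel_measure_eqI)
      fix f :: "real \<Rightarrow> real"
      assume f: "\<And>x. isCont f x" "\<And>x. 0 \<le> f x \<and> f x \<le> 1"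
      have "S.ext_moment (-1) k f (\<lambda>_. 1) * H.prob {\<omega> \<in> space Ph. H.ext_phase (-1) \<omega> = Some k} =
        S.prob {\<omega> \<in> space Ps. S.ext_phase (-1) \<omega> = Some k} * H.ext_moment (-1) k f (\<lambda>_. 1)"
        using cross_limit[OF
            reversed_series_tendsto[OF Pd ra Sd assms(7) f] reversed_series_tendsto[OF Pd ra Sd assms(7) one]
            reversed_series_tendsto[OF Pd rh Hd assms(9) f] reversed_series_tendsto[OF Pd rh Hd assms(9) one]]
        by (simp add: S.ext_moment_1 H.ext_moment_1)
      then show "(\<integral>x. f x \<partial>cond_law Ps borel (S.ext_value (-1)) (\<lambda>\<omega>. S.ext_phase (-1) \<omega> = Some k)) =
        (\<integral>x. f x \<partial>cond_law Ph borel (H.ext_value (-1)) (\<lambda>\<omega>. H.ext_phase (-1) \<omega> = Some k))"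
        using posS[of k] posH[of k] isCont_borel[OF f(1)]
        by (simp add: S.cond_law_ext_value H.cond_law_ext_value field_simps)
    qed (simp_all add: S.cond_law_ext_value H.cond_law_ext_value posS posH sets_cond_law prob_space.finite_measure)
  qed
qed

end
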